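(* Let $\{\phi_j\}_{j=0}^{\infty}$ be the complete orthonormal system of Legendre polynomials in $L_2([t,T])$, i.e. $$\phi_j(s)=\sqrt{\frac{2j+1}{T-t}}\,P_j\!\left(\left(s-\frac{T+t}{2}\right)\frac{2}{T-t}\right),\quad j\ge 0,$$ where $P_j$ is the $j$-th Legendre polynomial. For $i\in\{1,\dots,m\}$ and $j\ge 0$ let $\zeta_j^{(i)}=\int_t^T\phi_j(s)\,d\mathbf f^{(i)}_s$, and let $$C_{j_3j_2j_1}=\int_t^T\phi_{j_3}(s)\int_t^s\phi_{j_2}(s_1)\int_t^{s_1}\phi_{j_1}(s_2)\,ds_2\,ds_1\,ds .$$ Then for all $i_1,i_2,i_3\in\{1,\dots,m\}$, $$\int_t^{*T}\int_t^{*t_3}\int_t^{*t_2}d\mathbf f^{(i_1)}_{t_1}\,d\mathbf f^{(i_2)}_{t_2}\,d\mathbf f^{(i_3)}_{t_3} =\operatorname*{l.i.m.}_{p_1,p_2,p_3\to\infty}\sum_{j_1=0}^{p_1}\sum_{j_2=0}^{p_2}\sum_{j_3=0}^{p_3}C_{j_3j_2j_1}\,\zeta_{j_1}^{(i_1)}\zeta_{j_2}^{(i_2)}\zeta_{j_3}^{(i_3)},$$ where the limit is in the mean-square sense with $p_1,p_2,p_3$ tending to infinity independently.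
   Context: $(\Omega,\mathrm F,\mathsf P)$ is a complete probability space with a nondecreasing right-continuous filtration $\{\mathrm F_s\}_{s\in[0,T]}$, and $\mathbf f_s=(\mathbf f^{(1)}_s,\dots,\mathbf f^{(m)}_s)$ is a standard $m$-dimensional Wiener process adapted to it, with independent components; $0\le t<T$. $\int^{*}$ denotes the Stratonovich stochastic integral, and the triple integral on the left is the iterated Stratonovich integral (the innermost integral $\int_t^{*t_2}d\mathbf f^{(i_1)}_{t_1}$ defines a process in $t_2$, which is integrated in the Stratonovich sense against $d\mathbf f^{(i_2)}_{t_2}$ up to $t_3$, and the result is integrated in the Stratonovich sense against $d\mathbf f^{(i_3)}_{t_3}$ over $[t,T]$). $\operatorname{l.i.m.}$ denotes the limit in mean square (in $L_2(\Omega)$). *)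

theory Defs
  imports "HOL-Probability.Probability"
begin

definition legendre_poly :: "nat \<Rightarrow> real \<Rightarrow> real" where
  "legendre_poly n x =
     (1 / 2 ^ n) * (\<Sum>k\<le>n. real (n choose k) ^ 2 * (x - 1) ^ (n - k) * (x + 1) ^ k)"

definition legendre_phi :: "real \<Rightarrow> real \<Rightarrow> nat \<Rightarrow> real \<Rightarrow> real" where
  "legendre_phi t T j s =
     sqrt ((2 * real j + 1) / (T - t)) * legendre_poly j ((s - (T + t) / 2) * (2 / (T - t)))"

definition coeffC :: "real \<Rightarrow> real \<Rightarrow> nat \<Rightarrow> nat \<Rightarrow> nat \<Rightarrow> real" where
  "coeffC t T j3 j2 j1 =
     integral {t..T} (\<lambda>s. legendre_phi t T j3 s *
       integral {t..s} (\<lambda>s1. legendre_phi t T j2 s1 *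
         integral {t..s1} (\<lambda>s2. legendre_phi t T j1 s2)))"

definition wiener_process ::
  "'a measure \<Rightarrow> (real \<Rightarrow> 'a measure) \<Rightarrow> nat \<Rightarrow> real \<Rightarrow> (nat \<Rightarrow> real \<Rightarrow> 'a \<Rightarrow> real) \<Rightarrow> bool" where
  "wiener_process M F m T W \<longleftrightarrow>
     (\<forall>i\<in>{1..m}. \<forall>s\<in>{0..T}. W i s \<in> borel_measurable (F s)) \<and>
     (\<forall>i\<in>{1..m}. AE \<omega> in M. W i 0 \<omega> = 0) \<and>
     (\<forall>i\<in>{1..m}. AE \<omega> in M. continuous_on {0..T} (\<lambda>s. W i s \<omega>)) \<and>
     (\<forall>i\<in>{1..m}. \<forall>s u. 0 \<le> s \<longrightarrow> s < u \<longrightarrow> u \<le> T \<longrightarrow>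
        distributed M lborel (\<lambda>\<omega>. W i u \<omega> - W i s \<omega>)
          (\<lambda>x. ennreal (normal_density 0 (sqrt (u - s)) x))) \<and>
     (\<forall>s u. 0 \<le> s \<longrightarrow> s < u \<longrightarrow> u \<le> T \<longrightarrow>
        prob_space.indep_set M (sets (F s))
          (sets (vimage_algebra (space M) (\<lambda>\<omega>. \<lambda>i\<in>{1..m}. W i u \<omega> - W i s \<omega>)
             (Pi\<^sub>M {1..m} (\<lambda>_. borel))))) \<and>
     prob_space.indep_vars M (\<lambda>_. Pi\<^sub>M {0..T} (\<lambda>_. borel))
        (\<lambda>i \<omega>. \<lambda>s\<in>{0..T}. W i s \<omega>) {1..m}"

text \<open>Complete probability space with a nondecreasing right-continuous filtration
  of sub-sigma-algebras (indexed by all reals; only [0,T] matters).\<close>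
definition filtered_complete_prob_space :: "'a measure \<Rightarrow> (real \<Rightarrow> 'a measure) \<Rightarrow> real \<Rightarrow> bool" where
  "filtered_complete_prob_space M F T \<longleftrightarrow>
     prob_space M \<and> complete_measure M \<and>
     filtration (space M) F \<and> (\<forall>s. subalgebra M (F s)) \<and>
     (\<forall>s\<in>{0..<T}. sets (F s) = (\<Inter>u\<in>{s<..T}. sets (F u)))"

definition l2_tendsto :: "'a measure \<Rightarrow> ('i \<Rightarrow> 'a \<Rightarrow> real) \<Rightarrow> ('a \<Rightarrow> real) \<Rightarrow> 'i filter \<Rightarrow> bool" where
  "l2_tendsto M X Y G \<longleftrightarrow>
     Y \<in> borel_measurable M \<and>
     (\<forall>\<^sub>F a in G. integrable M (\<lambda>\<omega>. (X a \<omega> - Y \<omega>)\<^sup>2)) \<and>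
     ((\<lambda>a. LINT \<omega>|M. (X a \<omega> - Y \<omega>)\<^sup>2) \<longlongrightarrow> 0) G"

definition fine_partition :: "real \<Rightarrow> real \<Rightarrow> real \<Rightarrow> nat \<Rightarrow> (nat \<Rightarrow> real) \<Rightarrow> bool" where
  "fine_partition a b \<delta> n \<tau> \<longleftrightarrow>
     \<tau> 0 = a \<and> \<tau> n = b \<and> (\<forall>k<n. \<tau> k < \<tau> (Suc k) \<and> \<tau> (Suc k) - \<tau> k < \<delta>)"

definition is_mesh_limit ::
  "'a measure \<Rightarrow> real \<Rightarrow> real \<Rightarrow> (nat \<Rightarrow> (nat \<Rightarrow> real) \<Rightarrow> 'a \<Rightarrow> real) \<Rightarrow> ('a \<Rightarrow> real) \<Rightarrow> bool" where
  "is_mesh_limit M a b S I \<longleftrightarrow>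
     I \<in> borel_measurable M \<and>
     (\<forall>\<epsilon>>0. \<exists>\<delta>>0. \<forall>n \<tau>. fine_partition a b \<delta> n \<tau> \<longrightarrow>
        integrable M (\<lambda>\<omega>. (S n \<tau> \<omega> - I \<omega>)\<^sup>2) \<and>
        (LINT \<omega>|M. (S n \<tau> \<omega> - I \<omega>)\<^sup>2) < \<epsilon>)"

definition ito_integral :: "'a measure \<Rightarrow> (real \<Rightarrow> real) \<Rightarrow> (real \<Rightarrow> 'a \<Rightarrow> real) \<Rightarrow> real \<Rightarrow> real \<Rightarrow> 'a \<Rightarrow> real" where
  "ito_integral M g B a b = (SOME I. is_mesh_limit M a b
     (\<lambda>n \<tau> \<omega>. \<Sum>k<n. g (\<tau> k) * (B (\<tau> (Suc k)) \<omega> - B (\<tau> k) \<omega>)) I)"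

definition strat_integral :: "'a measure \<Rightarrow> (real \<Rightarrow> 'a \<Rightarrow> real) \<Rightarrow> (real \<Rightarrow> 'a \<Rightarrow> real) \<Rightarrow> real \<Rightarrow> real \<Rightarrow> 'a \<Rightarrow> real" where
  "strat_integral M X B a b = (SOME I. is_mesh_limit M a b
     (\<lambda>n \<tau> \<omega>. \<Sum>k<n. (X (\<tau> k) \<omega> + X (\<tau> (Suc k)) \<omega>) / 2 * (B (\<tau> (Suc k)) \<omega> - B (\<tau> k) \<omega>)) I)"

definition strat_iter3 :: "'a measure \<Rightarrow> (real \<Rightarrow> 'a \<Rightarrow> real) \<Rightarrow> (real \<Rightarrow> 'a \<Rightarrow> real) \<Rightarrow> (real \<Rightarrow> 'a \<Rightarrow> real) \<Rightarrow> real \<Rightarrow> real \<Rightarrow> 'a \<Rightarrow> real" where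
  "strat_iter3 M B1 B2 B3 t T =
     (let J1 = (\<lambda>t2. strat_integral M (\<lambda>_ _. 1) B1 t t2);
          J2 = (\<lambda>t3. strat_integral M J1 B2 t t3)
      in strat_integral M J2 B3 t T)"

end

theory Submission
  imports Defs "HOL-Computational_Algebra.Polynomial"
begin

text \<open>
  On a partition of \<open>[t, T]\<close> both the partial sums of the series and the (trapezoidal)
  Stratonovich sums are cubic forms in the increments of the Wiener process. For independent
  centred Gaussian variables a cubic form with coefficients \<open>A\<close> has second moment at most
  \<open>6 \<parallel>A\<parallel>\<^sup>2\<close> plus the squared norm of the sum of the three traces of \<open>A\<close> (split off the variables
  one at a time and expand in Hermite polynomials). Whichever of the indices \<open>i1, i2, i3\<close> coincide,
  it therefore suffices that the kernel of the difference and all three of its traces tend to \<open>0\<close>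
  in \<open>L\<^sub>2\<close>. Passing to the limit in the partition, the kernel becomes the difference of the
  indicator of \<open>x < y < z\<close> and its truncated Legendre expansion. With
  \<open>\<Phi>\<^sub>j(u) = \<integral>\<^sub>t\<^sup>u \<phi>\<^sub>j\<close> and \<open>\<theta>\<^sub>q(u) = u - t - \<Sum>\<^sub>j\<^sub>\<le>\<^sub>q \<Phi>\<^sub>j(u)\<^sup>2\<close>, integration by parts expresses
  all three traces through \<open>\<theta>\<^sub>q\<close>, and \<open>\<theta>\<^sub>q\<close> tends to \<open>0\<close> boundedly by Parseval's identity for
  the indicator of \<open>[t, u]\<close>.
\<close>

section \<open>Second moments of Gaussian forms\<close>

text \<open>Two products stand in the way. A product of mean-square limits need not converge in mean
  square, and the second-level integral is known only as such a limit, not as a form in increments.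
  Both are met alike: some subsequence converges almost everywhere, and Fatou's lemma carries a
  second-moment bound, valid along the approximations, over to the limit
  (\<open>Fatou_square\<close>). The diagonal value 1/2, which the trapezoidal rule produces
  (\<open>heavi\<close>), does the work of the Ito-Stratonovich correction: with it the kernel has
  the traces (T - x)/2, 0 and (x - t)/2, and these are the functions to which the traces of the
  Legendre expansion tend. Since a diagonal is a null set of the cube, convergence of the kernels in
  the cube says nothing about traces; they need their own estimates, and discretised kernels must
  converge at every point, diagonals included. That all traces reduce to \<open>\<theta> q\<close>
  rests on \<open>\<phi> 0\<close> being constant: the other \<phi>_j then integrate to 0 over
  [t, T] (\<open>Phi_T\<close>).\<close>

definition all_moments :: "'a measure \<Rightarrow> ('a \<Rightarrow> real) \<Rightarrow> bool" where
  "all_moments M f \<longleftrightarrow> f \<in> borel_measurable M \<and> (\<forall>k. integrable M (\<lambda>x. f x ^ k))"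

lemma all_moments_measurable [measurable_dest]: "all_moments M f \<Longrightarrow> f \<in> borel_measurable M"
  by (simp add: all_moments_def)

lemma all_moments_integrable_power: "all_moments M f \<Longrightarrow> integrable M (\<lambda>x. f x ^ k)"
  by (simp add: all_moments_def)

lemma all_moments_integrable: "all_moments M f \<Longrightarrow> integrable M f"
  using all_moments_integrable_power[of M f 1] by simp

lemma all_moments_const: "finite_measure M \<Longrightarrow> all_moments M (\<lambda>_. c)"
  by (simp add: all_moments_def finite_measure.integrable_const)

text \<open>Domination by f^(2i) + g^(2j) replaces any use of independence. It makes
  \<open>all_moments\<close> closed under products, so integrability of every polynomial in the
  increments becomes a matter of its syntax.\<close>

lemma all_moments_integrable_power_mult:
  assumes "all_moments M f" "all_moments M g"
  shows "integrable M (\<lambda>x. f x ^ i * g x ^ j)"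
proof (rule Bochner_Integration.integrable_bound)
  show "integrable M (\<lambda>x. f x ^ (2 * i) + g x ^ (2 * j))"
    using assms by (intro Bochner_Integration.integrable_add all_moments_integrable_power)
  show "(\<lambda>x. f x ^ i * g x ^ j) \<in> borel_measurable M"
    using assms[THEN all_moments_measurable] by measurable
  have "\<bar>f x ^ i * g x ^ j\<bar> \<le> f x ^ (2 * i) + g x ^ (2 * j)" for x
  proof -
    have "2 * \<bar>a * b\<bar> \<le> a\<^sup>2 + b\<^sup>2" for a b :: real
      using sum_squares_bound[of "\<bar>a\<bar>" "\<bar>b\<bar>"] by (simp add: abs_mult)
    from this[of "f x ^ i" "g x ^ j"] show ?thesis
      using zero_le_power2[of "f x ^ i"] zero_le_power2[of "g x ^ j"]
      by (simp add: power_mult[symmetric] mult.commute)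
  qed
  then show "AE x in M. norm (f x ^ i * g x ^ j) \<le> norm (f x ^ (2 * i) + g x ^ (2 * j))"
    by (auto intro!: AE_I2 order_trans[OF _ abs_ge_self])
qed

lemma all_moments_mult:
  assumes "all_moments M f" "all_moments M g"
  shows "all_moments M (\<lambda>x. f x * g x)"
  using assms[THEN all_moments_measurable] all_moments_integrable_power_mult[OF assms]
  by (simp add: all_moments_def power_mult_distrib)

lemma all_moments_add:
  assumes "all_moments M f" "all_moments M g"
  shows "all_moments M (\<lambda>x. f x + g x)"
  unfolding all_moments_def
proof (intro conjI allI)
  show "(\<lambda>x. f x + g x) \<in> borel_measurable M"
    using assms[THEN all_moments_measurable] by measurable
  fix k
  have "integrable M (\<lambda>x. of_nat (k choose i) * f x ^ i * g x ^ (k - i))" for i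
    using all_moments_integrable_power_mult[OF assms, of i "k - i"] by (simp add: mult.assoc)
  then show "integrable M (\<lambda>x. (f x + g x) ^ k)"
    unfolding binomial_ring by (intro Bochner_Integration.integrable_sum)
qed

lemma all_moments_cmult:
  assumes "all_moments M f" shows "all_moments M (\<lambda>x. c * f x)"
  using assms by (simp add: all_moments_def power_mult_distrib borel_measurable_times)

lemma all_moments_diff:
  assumes "all_moments M f" "all_moments M g"
  shows "all_moments M (\<lambda>x. f x - g x)"
  using all_moments_add[OF assms(1) all_moments_cmult[OF assms(2), of "-1"]] by simp

lemma all_moments_sum:
  assumes "finite_measure M" "\<And>i. i \<in> I \<Longrightarrow> all_moments M (f i)"
  shows "all_moments M (\<lambda>x. \<Sum>i\<in>I. f i x)"
  using assms(2)
  by (induction I rule: infinite_finite_induct)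
     (auto intro: all_moments_add all_moments_const[OF assms(1)])

lemma all_moments_power:
  assumes "finite_measure M" "all_moments M f" shows "all_moments M (\<lambda>x. f x ^ k)"
  by (induction k) (auto intro: all_moments_mult assms all_moments_const)

lemma all_moments_square_integrable: "all_moments M f \<Longrightarrow> integrable M (\<lambda>x. (f x)\<^sup>2)"
  by (rule all_moments_integrable_power)

section \<open>Hermite expansion in one Gaussian variable\<close>

context prob_space
begin

text \<open>Explicit values up to order six suffice, because the largest expression whose
  expectation is computed from them is the square of a cubic polynomial in X.\<close>

lemma normal_moments:
  assumes D: "distributed M lborel X (\<lambda>x. ennreal (normal_density 0 (sqrt v) x))" and v: "v > 0"
  shows "all_moments M X" "expectation X = 0" "expectation (\<lambda>x. X x ^ 2) = v"
    "expectation (\<lambda>x. X x ^ 3) = 0" "expectation (\<lambda>x. X x ^ 4) = 3 * v ^ 2"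
    "expectation (\<lambda>x. X x ^ 5) = 0" "expectation (\<lambda>x. X x ^ 6) = 15 * v ^ 3"
proof -
  have sv: "0 < sqrt v" using v by simp
  have [measurable]: "X \<in> borel_measurable M"
    using distributed_measurable[OF D] by simp
  have eq: "expectation (\<lambda>x. X x ^ k) = (\<integral>x. normal_density 0 (sqrt v) x * x ^ k \<partial>lborel)" for k
    using distributed_integral[OF D, of "\<lambda>x. x ^ k"] by simp
  have "integrable M (\<lambda>x. X x ^ k)" for k
    using distributed_integrable[OF D, of "\<lambda>x. x ^ k"] integrable_normal_moment[OF sv, of 0 k] by simp
  then show "all_moments M X" by (simp add: all_moments_def)
  have odd: "expectation (\<lambda>x. X x ^ (2 * k + 1)) = 0" for k
    unfolding eq using integral_normal_moment_odd[OF sv, of 0 k] by simp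
  show "expectation X = 0" "expectation (\<lambda>x. X x ^ 3) = 0" "expectation (\<lambda>x. X x ^ 5) = 0"
    using odd[of 0] odd[of 1] odd[of 2] by (simp_all add: eval_nat_numeral)
  have even: "expectation (\<lambda>x. X x ^ (2 * k)) = fact (2 * k) / ((2 / v) ^ k * fact k)" for k
    unfolding eq using integral_normal_moment_even[OF sv, of 0 k] v by simp
  show "expectation (\<lambda>x. X x ^ 2) = v" "expectation (\<lambda>x. X x ^ 4) = 3 * v ^ 2"
    "expectation (\<lambda>x. X x ^ 6) = 15 * v ^ 3"
    using even[of 1] even[of 2] even[of 3] v
    by (simp_all add: fact_numeral power_divide power2_eq_square power3_eq_cube field_simps)
qed

text \<open>The polynomials 1, X, X^2 - v, X^3 - 3 v X are the Hermite polynomials for variance v: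
  pairwise orthogonal with squared norms 1, v, 2 v^2, 6 v^3. Independence lets the expectation of a
  product of coefficients split off, so only the diagonal terms survive. The last coefficient is a
  number because in a cubic form nothing is left to multiply X^3.\<close>

lemma hermite_expansion_second_moment:
  assumes X: "distributed M lborel X (\<lambda>x. ennreal (normal_density 0 (sqrt v) x))" and v: "v > 0"
    and ind: "\<And>f g. f \<in> borel_measurable N \<Longrightarrow> g \<in> borel_measurable borel \<Longrightarrow>
      indep_var borel (\<lambda>\<omega>. f (Y \<omega>) :: real) borel (\<lambda>\<omega>. g (X \<omega>))"
    and meas: "u0 \<in> borel_measurable N" "u1 \<in> borel_measurable N" "u2 \<in> borel_measurable N"
    and mom: "all_moments M (\<lambda>\<omega>. u0 (Y \<omega>))" "all_moments M (\<lambda>\<omega>. u1 (Y \<omega>))" "all_moments M (\<lambda>\<omega>. u2 (Y \<omega>))"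
  shows "expectation (\<lambda>\<omega>. (u0 (Y \<omega>) + X \<omega> * u1 (Y \<omega>) + ((X \<omega>)\<^sup>2 - v) * u2 (Y \<omega>)
            + ((X \<omega>) ^ 3 - 3 * v * X \<omega>) * u3)\<^sup>2)
    = expectation (\<lambda>\<omega>. (u0 (Y \<omega>))\<^sup>2) + v * expectation (\<lambda>\<omega>. (u1 (Y \<omega>))\<^sup>2)
      + 2 * v\<^sup>2 * expectation (\<lambda>\<omega>. (u2 (Y \<omega>))\<^sup>2) + 6 * v ^ 3 * u3\<^sup>2"
proof -
  note nm = normal_moments[OF X v]
  have fin: "finite_measure M" by unfold_locales
  define H where "H k x = (if k = 0 then 1 else if k = 1 then x else if k = 2 then x\<^sup>2 - v else x ^ 3 - 3 * v * x)"
    for k :: nat and x :: real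
  define u where "u k = (if k = 0 then u0 else if k = 1 then u1 else if k = 2 then u2 else (\<lambda>_. u3))" for k :: nat
  have Hm [measurable]: "H k \<in> borel_measurable borel" for k by (cases "k = 0"; cases "k = 1"; cases "k = 2") (simp_all add: H_def[abs_def])
  have um [measurable]: "u k \<in> borel_measurable N" for k using meas by (simp add: u_def)
  have uM: "all_moments M (\<lambda>\<omega>. u k (Y \<omega>))" for k
    using mom by (simp add: u_def all_moments_const[OF fin])
  have HM: "all_moments M (\<lambda>\<omega>. H k (X \<omega>))" for k
    by (cases "k = 0"; cases "k = 1"; cases "k = 2")
       (auto simp: H_def intro!: all_moments_diff all_moments_power[OF fin] nm all_moments_cmult
        all_moments_const[OF fin])
  have prod: "expectation (\<lambda>\<omega>. (u i (Y \<omega>) * u j (Y \<omega>)) * (H i (X \<omega>) * H j (X \<omega>)))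
     = expectation (\<lambda>\<omega>. u i (Y \<omega>) * u j (Y \<omega>)) * expectation (\<lambda>\<omega>. H i (X \<omega>) * H j (X \<omega>))" for i j
  proof (rule indep_var_lebesgue_integral)
    show "integrable M (\<lambda>\<omega>. u i (Y \<omega>) * u j (Y \<omega>))" "integrable M (\<lambda>\<omega>. H i (X \<omega>) * H j (X \<omega>))"
      by (intro all_moments_integrable all_moments_mult uM HM)+
    show "indep_var borel (\<lambda>\<omega>. u i (Y \<omega>) * u j (Y \<omega>)) borel (\<lambda>\<omega>. H i (X \<omega>) * H j (X \<omega>))"
      by (rule ind) measurable
  qed
  have int: "integrable M (\<lambda>\<omega>. (u i (Y \<omega>) * u j (Y \<omega>)) * (H i (X \<omega>) * H j (X \<omega>)))" for i j
    by (intro all_moments_integrable all_moments_mult uM HM)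
  have ip: "integrable M (\<lambda>\<omega>. c * X \<omega> ^ k)" for k c
    using all_moments_integrable_power[OF nm(1)] by simp
  have ip1: "integrable M (\<lambda>\<omega>. c * X \<omega>)" for c
    using ip[of c 1] by simp
  \<comment> \<open>Nested to the right so that additivity peels off one monomial at a time. The
    moments of orders 0 to 6 are 1, 0, v, 0, 3 v^2, 0, 15 v^3.\<close>
  have E: "expectation (\<lambda>\<omega>. c0 + (c1 * X \<omega> + (c2 * X \<omega> ^ 2 + (c3 * X \<omega> ^ 3 + (c4 * X \<omega> ^ 4 + (c5 * X \<omega> ^ 5 + c6 * X \<omega> ^ 6))))))
     = c0 + c2 * v + 3 * c4 * v^2 + 15 * c6 * v^3" for c0 c1 c2 c3 c4 c5 c6
    by (subst Bochner_Integration.integral_add, (intro Bochner_Integration.integrable_add integrable_const ip ip1)+)+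
       (simp add: nm prob_space)
  have HH: "expectation (\<lambda>\<omega>. H i (X \<omega>) * H j (X \<omega>)) =
     (if i = j then (if i = 0 then 1 else if i = 1 then v else if i = 2 then 2 * v\<^sup>2 else 6 * v ^ 3) else 0)"
    if "i < 4" "j < 4" for i j
  proof -
    have ij: "(i = 0 \<or> i = 1 \<or> i = 2 \<or> i = 3) \<and> (j = 0 \<or> j = 1 \<or> j = 2 \<or> j = 3)" using that by auto
    \<comment> \<open>\<open>k i n\<close> is the coefficient of \<open>x ^ n\<close> in
      \<open>H i x\<close>; all ten products are thereby reduced to the single evaluation
      \<open>E\<close>.\<close>
    define k where "k i n = (if i = n then 1 else if i = 2 \<and> n = 0 then - v
        else if i = 3 \<and> n = 1 then - 3 * v else 0)" for i n :: nat
    have Hk: "H i x = k i 0 + k i 1 * x + k i 2 * x ^ 2 + k i 3 * x ^ 3" if "i = 0 \<or> i = 1 \<or> i = 2 \<or> i = 3" for i x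
      using that by (elim disjE) (simp_all add: H_def k_def)
    have "expectation (\<lambda>\<omega>. H i (X \<omega>) * H j (X \<omega>)) = expectation (\<lambda>\<omega>. k i 0 * k j 0
        + ((k i 0 * k j 1 + k i 1 * k j 0) * X \<omega>
        + ((k i 0 * k j 2 + k i 1 * k j 1 + k i 2 * k j 0) * X \<omega> ^ 2
        + ((k i 0 * k j 3 + k i 1 * k j 2 + k i 2 * k j 1 + k i 3 * k j 0) * X \<omega> ^ 3
        + ((k i 1 * k j 3 + k i 2 * k j 2 + k i 3 * k j 1) * X \<omega> ^ 4
        + ((k i 2 * k j 3 + k i 3 * k j 2) * X \<omega> ^ 5 + (k i 3 * k j 3) * X \<omega> ^ 6))))))"
      by (intro Bochner_Integration.integral_cong refl)
         (simp add: Hk[OF conjunct1[OF ij]] Hk[OF conjunct2[OF ij]] algebra_simps eval_nat_numeral)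
    also have "\<dots> = (if i = j then (if i = 0 then 1 else if i = 1 then v else if i = 2 then 2 * v\<^sup>2 else 6 * v ^ 3) else 0)"
      unfolding E using ij
      by (elim conjE disjE) (simp_all add: k_def algebra_simps power2_eq_square power3_eq_cube)
    finally show ?thesis .
  qed
  have expand: "(u0 (Y \<omega>) + X \<omega> * u1 (Y \<omega>) + ((X \<omega>)\<^sup>2 - v) * u2 (Y \<omega>) + ((X \<omega>) ^ 3 - 3 * v * X \<omega>) * u3)\<^sup>2
     = (\<Sum>i<4. \<Sum>j<4. (u i (Y \<omega>) * u j (Y \<omega>)) * (H i (X \<omega>) * H j (X \<omega>)))" for \<omega>
  proof -
    have "u0 (Y \<omega>) + X \<omega> * u1 (Y \<omega>) + ((X \<omega>)\<^sup>2 - v) * u2 (Y \<omega>) + ((X \<omega>) ^ 3 - 3 * v * X \<omega>) * u3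
       = (\<Sum>i<4. u i (Y \<omega>) * H i (X \<omega>))"
      by (simp add: u_def H_def numeral_eq_Suc algebra_simps)
    then show ?thesis
      by (simp add: power2_eq_square sum_product mult_ac)
  qed
  show ?thesis
    unfolding expand
    by (simp add: int prod HH sum.delta if_distrib[of "\<lambda>x. _ * x"] cong: if_cong)
      (simp add: numeral_eq_Suc u_def prob_space power2_eq_square algebra_simps)
qed

end

lemma sq_sum2_le: "(a + b)\<^sup>2 \<le> 2 * a\<^sup>2 + 2 * b\<^sup>2" for a b :: real
  using sum_squares_bound[of a b] by (simp add: power2_sum)

lemma sq_sum3_le: "(a + b + c)\<^sup>2 \<le> 3 * a\<^sup>2 + 3 * b\<^sup>2 + 3 * c\<^sup>2" for a b c :: real
  using sum_squares_bound[of a b] sum_squares_bound[of a c] sum_squares_bound[of b c]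
  by (simp add: power2_eq_square algebra_simps)

section \<open>Forms in finitely many independent Gaussian variables\<close>

locale gauss_family = prob_space M for M :: "'a measure" +
  fixes \<xi> :: "'i \<Rightarrow> 'a \<Rightarrow> real" and v :: "'i \<Rightarrow> real" and I :: "'i set"
  assumes finite_I: "finite I"
    and indep: "indep_vars (\<lambda>_. borel) \<xi> I"
    and distr: "\<And>a. a \<in> I \<Longrightarrow> distributed M lborel (\<xi> a) (\<lambda>x. ennreal (normal_density 0 (sqrt (v a)) x))"
    and v_pos: "\<And>a. a \<in> I \<Longrightarrow> v a > 0"
begin

lemma all_moments_xi: "a \<in> I \<Longrightarrow> all_moments M (\<xi> a)"
  using normal_moments(1)[OF distr v_pos] .

lemma all_moments_M_const: "all_moments M (\<lambda>_. c)"
  by (rule all_moments_const) unfold_locales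

lemma all_moments_M_sum: "(\<And>i. i \<in> J \<Longrightarrow> all_moments M (f i)) \<Longrightarrow> all_moments M (\<lambda>x. \<Sum>i\<in>J. f i x)"
  by (rule all_moments_sum) unfold_locales

lemmas mom_intros = all_moments_M_sum all_moments_add all_moments_mult all_moments_M_const all_moments_xi

text \<open>Supplies the independence hypothesis of \<open>hermite_expansion_second_moment\<close>
  when Y is the vector of the variables indexed by J.\<close>

lemma indep_var_rest:
  assumes "x \<in> I" "J \<subseteq> I" "x \<notin> J" and f: "f \<in> borel_measurable (PiM J (\<lambda>_. borel))"
    and g: "g \<in> borel_measurable borel"
  shows "indep_var borel (\<lambda>\<omega>. f (restrict (\<lambda>a. \<xi> a \<omega>) J)) borel (\<lambda>\<omega>. g (\<xi> x \<omega>))"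
proof -
  have "indep_var borel (f \<circ> (\<lambda>\<omega>. restrict (\<lambda>a. \<xi> a \<omega>) J))
     borel ((\<lambda>y. g (y x)) \<circ> (\<lambda>\<omega>. restrict (\<lambda>a. \<xi> a \<omega>) {x}))"
    by (rule indep_var_compose[OF indep_var_restrict[OF indep, of J "{x}"] f])
       (use assms in \<open>auto intro!: measurable_compose[OF _ g]\<close>)
  then show ?thesis by (simp add: comp_def)
qed

text \<open>The common induction step of the three moment computations below: x is the index split
  off, J the indices already treated.\<close>

lemma hermite_step:
  assumes x: "x \<in> I" "J \<subseteq> I" "x \<notin> J"
    and f: "\<And>\<omega>. f \<omega> = u0 (restrict (\<lambda>a. \<xi> a \<omega>) J) + \<xi> x \<omega> * u1 (restrict (\<lambda>a. \<xi> a \<omega>) J)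
      + ((\<xi> x \<omega>)\<^sup>2 - v x) * u2 (restrict (\<lambda>a. \<xi> a \<omega>) J) + (\<xi> x \<omega> ^ 3 - 3 * v x * \<xi> x \<omega>) * u3"
    and meas: "u0 \<in> borel_measurable (PiM J (\<lambda>_. borel))" "u1 \<in> borel_measurable (PiM J (\<lambda>_. borel))"
      "u2 \<in> borel_measurable (PiM J (\<lambda>_. borel))"
    and mom: "all_moments M (\<lambda>\<omega>. u0 (restrict (\<lambda>a. \<xi> a \<omega>) J))"
      "all_moments M (\<lambda>\<omega>. u1 (restrict (\<lambda>a. \<xi> a \<omega>) J))" "all_moments M (\<lambda>\<omega>. u2 (restrict (\<lambda>a. \<xi> a \<omega>) J))"
  shows "expectation (\<lambda>\<omega>. (f \<omega>)\<^sup>2)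
    = expectation (\<lambda>\<omega>. (u0 (restrict (\<lambda>a. \<xi> a \<omega>) J))\<^sup>2) + v x * expectation (\<lambda>\<omega>. (u1 (restrict (\<lambda>a. \<xi> a \<omega>) J))\<^sup>2)
      + 2 * (v x)\<^sup>2 * expectation (\<lambda>\<omega>. (u2 (restrict (\<lambda>a. \<xi> a \<omega>) J))\<^sup>2) + 6 * v x ^ 3 * u3\<^sup>2"
  unfolding f
  by (rule hermite_expansion_second_moment[OF distr[OF x(1)] v_pos[OF x(1)],
        where N = "PiM J (\<lambda>_. borel)" and Y = "\<lambda>\<omega>. restrict (\<lambda>a. \<xi> a \<omega>) J"])
     (fact meas mom | rule indep_var_rest[OF x], assumption, assumption)+

lemma linear_second_moment:
  assumes "J \<subseteq> I"
  shows "expectation (\<lambda>\<omega>. (\<Sum>a\<in>J. l a * \<xi> a \<omega>)\<^sup>2) = (\<Sum>a\<in>J. v a * (l a)\<^sup>2)"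
proof -
  have "finite J" using assms finite_I finite_subset by auto
  then show ?thesis using assms
  proof (induction J rule: finite_induct)
    case (insert x J)
    then have x: "x \<in> I" "J \<subseteq> I" "x \<notin> J" by auto
    have "expectation (\<lambda>\<omega>. (\<Sum>a\<in>insert x J. l a * \<xi> a \<omega>)\<^sup>2) =
       expectation (\<lambda>\<omega>. (\<Sum>a\<in>J. l a * restrict (\<lambda>a. \<xi> a \<omega>) J a)\<^sup>2) + v x * expectation (\<lambda>\<omega>. (l x)\<^sup>2)
         + 2 * (v x)\<^sup>2 * expectation (\<lambda>\<omega>. 0\<^sup>2) + 6 * v x ^ 3 * 0\<^sup>2"
      by (rule hermite_step[OF x, where ?u0.0 = "\<lambda>y. \<Sum>a\<in>J. l a * y a" and ?u1.0 = "\<lambda>_. l x" and ?u2.0 = "\<lambda>_. 0"])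
         (use insert.hyps x in \<open>auto simp: algebra_simps intro!: mom_intros all_moments_cmult\<close>)
    then show ?case using insert x by (simp add: prob_space)
  qed (simp add: prob_space)
qed

text \<open>Splitting off x writes the square of \<xi>_x as its Hermite part plus v x, and the
  second summand enlarges the constant; hence c is arbitrary in the induction. The expansion is
  exact up to the mixed coefficients \<open>q a x + q x a\<close>, whose squares are estimated by
  \<open>sq_sum2_le\<close>; this is why an inequality with factor 2 results.\<close>

lemma quadratic_second_moment:
  assumes "J \<subseteq> I"
  shows "expectation (\<lambda>\<omega>. ((\<Sum>a\<in>J. \<Sum>b\<in>J. q a b * \<xi> a \<omega> * \<xi> b \<omega>) + c)\<^sup>2)
    \<le> (c + (\<Sum>a\<in>J. v a * q a a))\<^sup>2 + 2 * (\<Sum>a\<in>J. \<Sum>b\<in>J. v a * v b * (q a b)\<^sup>2)"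
proof -
  have "finite J" using assms finite_I finite_subset by auto
  then show ?thesis using assms
  proof (induction J arbitrary: c rule: finite_induct)
    case (insert x J)
    then have x: "x \<in> I" "J \<subseteq> I" "x \<notin> J" by auto
    define l where "l a = q a x + q x a" for a
    have "expectation (\<lambda>\<omega>. ((\<Sum>a\<in>insert x J. \<Sum>b\<in>insert x J. q a b * \<xi> a \<omega> * \<xi> b \<omega>) + c)\<^sup>2) =
       expectation (\<lambda>\<omega>. ((\<Sum>a\<in>J. \<Sum>b\<in>J. q a b * restrict (\<lambda>a. \<xi> a \<omega>) J a * restrict (\<lambda>a. \<xi> a \<omega>) J b)
           + (c + v x * q x x))\<^sup>2)
         + v x * expectation (\<lambda>\<omega>. (\<Sum>a\<in>J. l a * restrict (\<lambda>a. \<xi> a \<omega>) J a)\<^sup>2)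
         + 2 * (v x)\<^sup>2 * expectation (\<lambda>\<omega>. (q x x)\<^sup>2) + 6 * v x ^ 3 * 0\<^sup>2"
      by (rule hermite_step[OF x, where ?u0.0 = "\<lambda>y. (\<Sum>a\<in>J. \<Sum>b\<in>J. q a b * y a * y b) + (c + v x * q x x)"
            and ?u1.0 = "\<lambda>y. \<Sum>a\<in>J. l a * y a" and ?u2.0 = "\<lambda>_. q x x"])
         (use insert.hyps x in \<open>auto simp: algebra_simps sum.distrib power2_eq_square sum_distrib_left l_def
            intro!: mom_intros all_moments_cmult\<close>)
    also have "\<dots> = expectation (\<lambda>\<omega>. ((\<Sum>a\<in>J. \<Sum>b\<in>J. q a b * \<xi> a \<omega> * \<xi> b \<omega>) + (c + v x * q x x))\<^sup>2)
         + v x * (\<Sum>a\<in>J. v a * (l a)\<^sup>2) + 2 * (v x)\<^sup>2 * (q x x)\<^sup>2"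
      using linear_second_moment[OF x(2), of l] by (simp add: prob_space)
    also have "\<dots> \<le> (c + v x * q x x + (\<Sum>a\<in>J. v a * q a a))\<^sup>2 + 2 * (\<Sum>a\<in>J. \<Sum>b\<in>J. v a * v b * (q a b)\<^sup>2)
        + v x * (\<Sum>a\<in>J. v a * (2 * ((q a x)\<^sup>2 + (q x a)\<^sup>2))) + 2 * (v x)\<^sup>2 * (q x x)\<^sup>2"
      using x v_pos[THEN less_imp_le]
      by (intro add_mono insert.IH mult_left_mono sum_mono order.refl) (auto simp: l_def sq_sum2_le subset_iff)
    also have "\<dots> = (c + (\<Sum>a\<in>insert x J. v a * q a a))\<^sup>2
       + 2 * (\<Sum>a\<in>insert x J. \<Sum>b\<in>insert x J. v a * v b * (q a b)\<^sup>2)"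
      using insert.hyps by (simp add: sum.distrib sum_distrib_left algebra_simps power2_eq_square)
    finally show ?case .
  qed (simp add: prob_space)
qed

text \<open>The linear form l has to be carried along: removing x turns terms with x in two slots
  into linear ones, by way of the expectation v x of the square. What accumulates in l are the three
  traces. The constant 6 is 2 times 3: the factor 2 of the quadratic case (and of the squared norm 2
  v^2), times the 3 of \<open>sq_sum3_le\<close>; for the pure cube it is the squared norm 6 v^3
  itself.\<close>

lemma cubic_second_moment:
  assumes "J \<subseteq> I"
  shows "expectation (\<lambda>\<omega>. ((\<Sum>a\<in>J. \<Sum>b\<in>J. \<Sum>c\<in>J. A a b c * \<xi> a \<omega> * \<xi> b \<omega> * \<xi> c \<omega>) + (\<Sum>a\<in>J. l a * \<xi> a \<omega>))\<^sup>2)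
    \<le> (\<Sum>a\<in>J. v a * (l a + (\<Sum>b\<in>J. v b * (A a b b + A b a b + A b b a)))\<^sup>2)
      + 6 * (\<Sum>a\<in>J. \<Sum>b\<in>J. \<Sum>c\<in>J. v a * v b * v c * (A a b c)\<^sup>2)"
proof -
  have "finite J" using assms finite_I finite_subset by auto
  then show ?thesis using assms
  proof (induction J arbitrary: l rule: finite_induct)
    case (insert x J)
    then have x: "x \<in> I" "J \<subseteq> I" "x \<notin> J" by auto
    \<comment> \<open>The coefficients q and r collect the terms in which x occupies exactly one,
      respectively exactly two, of the three slots.\<close>
    define q where "q a b = A a b x + A a x b + A x a b" for a b
    define r where "r a = A a x x + A x a x + A x x a" for a
    let ?y = "\<lambda>\<omega>. restrict (\<lambda>a. \<xi> a \<omega>) J"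
    have vnn: "v a \<ge> 0" if "a \<in> insert x J" for a
      using that insert.prems v_pos[of a] by (auto intro: less_imp_le)
    have "expectation (\<lambda>\<omega>. ((\<Sum>a\<in>insert x J. \<Sum>b\<in>insert x J. \<Sum>c\<in>insert x J. A a b c * \<xi> a \<omega> * \<xi> b \<omega> * \<xi> c \<omega>)
          + (\<Sum>a\<in>insert x J. l a * \<xi> a \<omega>))\<^sup>2) =
       expectation (\<lambda>\<omega>. ((\<Sum>a\<in>J. \<Sum>b\<in>J. \<Sum>c\<in>J. A a b c * ?y \<omega> a * ?y \<omega> b * ?y \<omega> c)
           + (\<Sum>a\<in>J. (l a + v x * r a) * ?y \<omega> a))\<^sup>2)
         + v x * expectation (\<lambda>\<omega>. ((\<Sum>a\<in>J. \<Sum>b\<in>J. q a b * ?y \<omega> a * ?y \<omega> b) + (l x + 3 * v x * A x x x))\<^sup>2)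
         + 2 * (v x)\<^sup>2 * expectation (\<lambda>\<omega>. (\<Sum>a\<in>J. r a * ?y \<omega> a)\<^sup>2) + 6 * v x ^ 3 * (A x x x)\<^sup>2"
      by (rule hermite_step[OF x, where ?u0.0 = "\<lambda>y. (\<Sum>a\<in>J. \<Sum>b\<in>J. \<Sum>c\<in>J. A a b c * y a * y b * y c)
            + (\<Sum>a\<in>J. (l a + v x * r a) * y a)"
            and ?u1.0 = "\<lambda>y. (\<Sum>a\<in>J. \<Sum>b\<in>J. q a b * y a * y b) + (l x + 3 * v x * A x x x)"
            and ?u2.0 = "\<lambda>y. \<Sum>a\<in>J. r a * y a"])
         (use insert.hyps x in \<open>auto simp: algebra_simps sum.distrib sum_subtractf power2_eq_square power3_eq_cube sum_distrib_left
            q_def r_def intro!: mom_intros all_moments_cmult\<close>)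
    also have "\<dots> = expectation (\<lambda>\<omega>. ((\<Sum>a\<in>J. \<Sum>b\<in>J. \<Sum>c\<in>J. A a b c * \<xi> a \<omega> * \<xi> b \<omega> * \<xi> c \<omega>)
           + (\<Sum>a\<in>J. (l a + v x * r a) * \<xi> a \<omega>))\<^sup>2)
         + v x * expectation (\<lambda>\<omega>. ((\<Sum>a\<in>J. \<Sum>b\<in>J. q a b * \<xi> a \<omega> * \<xi> b \<omega>) + (l x + 3 * v x * A x x x))\<^sup>2)
         + 2 * (v x)\<^sup>2 * (\<Sum>a\<in>J. v a * (r a)\<^sup>2) + 6 * v x ^ 3 * (A x x x)\<^sup>2"
      using linear_second_moment[OF x(2), of r] by (simp add: prob_space)
    \<comment> \<open>The induction hypothesis is used for the enlarged linear form
      \<open>l a + v x * r a\<close>, the quadratic bound for the coefficient of \<xi>_x. There the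
      cube contributes \<open>3 * v x * A x x x\<close>, because x^3 = (x^3 - 3 v x) + 3 v
      x.\<close>
    also have "\<dots> \<le> ((\<Sum>a\<in>J. v a * (l a + v x * r a + (\<Sum>b\<in>J. v b * (A a b b + A b a b + A b b a)))\<^sup>2)
      + 6 * (\<Sum>a\<in>J. \<Sum>b\<in>J. \<Sum>c\<in>J. v a * v b * v c * (A a b c)\<^sup>2))
      + v x * ((l x + 3 * v x * A x x x + (\<Sum>a\<in>J. v a * q a a))\<^sup>2
           + 2 * (\<Sum>a\<in>J. \<Sum>b\<in>J. v a * v b * (3 * ((A a b x)\<^sup>2 + (A a x b)\<^sup>2 + (A x a b)\<^sup>2))))
      + 2 * (v x)\<^sup>2 * (\<Sum>a\<in>J. v a * (3 * ((A a x x)\<^sup>2 + (A x a x)\<^sup>2 + (A x x a)\<^sup>2))) + 6 * v x ^ 3 * (A x x x)\<^sup>2"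
    proof (intro add_mono insert.IH mult_left_mono order.refl)
      show "expectation (\<lambda>\<omega>. ((\<Sum>a\<in>J. \<Sum>b\<in>J. q a b * \<xi> a \<omega> * \<xi> b \<omega>) + (l x + 3 * v x * A x x x))\<^sup>2)
        \<le> (l x + 3 * v x * A x x x + (\<Sum>a\<in>J. v a * q a a))\<^sup>2
           + 2 * (\<Sum>a\<in>J. \<Sum>b\<in>J. v a * v b * (3 * ((A a b x)\<^sup>2 + (A a x b)\<^sup>2 + (A x a b)\<^sup>2)))"
        by (rule order_trans[OF quadratic_second_moment[OF x(2)]], intro add_mono mult_left_mono sum_mono order.refl)
           (auto simp: q_def vnn sq_sum3_le)
      show "(\<Sum>a\<in>J. v a * (r a)\<^sup>2) \<le> (\<Sum>a\<in>J. v a * (3 * ((A a x x)\<^sup>2 + (A x a x)\<^sup>2 + (A x x a)\<^sup>2)))"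
        by (intro sum_mono mult_left_mono) (auto simp: r_def vnn sq_sum3_le)
    qed (use x vnn in auto)
    also have "\<dots> = (\<Sum>a\<in>insert x J. v a * (l a + (\<Sum>b\<in>insert x J. v b * (A a b b + A b a b + A b b a)))\<^sup>2)
      + 6 * (\<Sum>a\<in>insert x J. \<Sum>b\<in>insert x J. \<Sum>c\<in>insert x J. v a * v b * v c * (A a b c)\<^sup>2)"
    proof -
      have 1: "(\<Sum>a\<in>insert x J. v a * (l a + (\<Sum>b\<in>insert x J. v b * (A a b b + A b a b + A b b a)))\<^sup>2)
        = v x * (l x + 3 * v x * A x x x + (\<Sum>a\<in>J. v a * q a a))\<^sup>2
         + (\<Sum>a\<in>J. v a * (l a + v x * r a + (\<Sum>b\<in>J. v b * (A a b b + A b a b + A b b a)))\<^sup>2)"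
        using insert.hyps by (simp add: q_def r_def algebra_simps)
      have 2: "(\<Sum>a\<in>insert x J. \<Sum>b\<in>insert x J. \<Sum>c\<in>insert x J. v a * v b * v c * (A a b c)\<^sup>2)
        = (\<Sum>a\<in>J. \<Sum>b\<in>J. \<Sum>c\<in>J. v a * v b * v c * (A a b c)\<^sup>2)
         + v x * (\<Sum>a\<in>J. \<Sum>b\<in>J. v a * v b * ((A a b x)\<^sup>2 + (A a x b)\<^sup>2 + (A x a b)\<^sup>2))
         + (v x)\<^sup>2 * (\<Sum>a\<in>J. v a * ((A a x x)\<^sup>2 + (A x a x)\<^sup>2 + (A x x a)\<^sup>2)) + v x ^ 3 * (A x x x)\<^sup>2"
        using insert.hyps
        by (simp add: sum.distrib sum_distrib_left algebra_simps power2_eq_square power3_eq_cube)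
      show ?thesis
        unfolding 1 2 by (simp add: sum_distrib_left algebra_simps)
    qed
    finally show ?case .
  qed (simp add: prob_space)
qed

end

section \<open>Partitions\<close>

text \<open>Partitions are point sets instead of increasing sequences: a common refinement is then a
  plain union, and no indices need to be matched.\<close>

definition partition_of :: "real \<Rightarrow> real \<Rightarrow> real set \<Rightarrow> bool" where
  "partition_of a b P \<longleftrightarrow> finite P \<and> a \<in> P \<and> b \<in> P \<and> P \<subseteq> {a..b}"

text \<open>\<open>lo P x\<close> and \<open>hi P x\<close> are the ends of the half-open cell
  containing x. At the right end b, \<open>hi\<close> is the minimum of an empty set; sums over
  cells therefore run over the left ends \<open>P - {b}\<close>.\<close>

definition lo :: "real set \<Rightarrow> real \<Rightarrow> real" where "lo P x = Max {w\<in>P. w \<le> x}"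

definition hi :: "real set \<Rightarrow> real \<Rightarrow> real" where "hi P x = Min {w\<in>P. x < w}"

definition mesh_below :: "real \<Rightarrow> real set \<Rightarrow> real \<Rightarrow> bool" where
  "mesh_below b P d \<longleftrightarrow> (\<forall>u\<in>P - {b}. hi P u - u < d)"

lemma partition_finite [simp]: "partition_of a b P \<Longrightarrow> finite P"
  by (simp add: partition_of_def)

lemma partition_Un: "partition_of a b P \<Longrightarrow> partition_of a b Q \<Longrightarrow> partition_of a b (P \<union> Q)"
  by (auto simp: partition_of_def)

lemma partition_le: "partition_of a b P \<Longrightarrow> a \<le> b"
  by (auto simp: partition_of_def)

lemma partition_cell: "partition_of a b P \<Longrightarrow> x \<in> P - {b} \<Longrightarrow> x \<in> {a..<b}"
  by (auto simp: partition_of_def subset_iff less_le)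

context
  fixes a b x :: real and P :: "real set"
  assumes P: "partition_of a b P" and x: "x \<in> {a..<b}"
begin

lemma lo_mem: "lo P x \<in> P" and lo_le: "lo P x \<le> x"
proof -
  have "lo P x \<in> {w\<in>P. w \<le> x}"
    unfolding lo_def using P x by (intro Max_in) (auto simp: partition_of_def)
  then show "lo P x \<in> P" "lo P x \<le> x" by auto
qed

lemma hi_mem: "hi P x \<in> P" and less_hi: "x < hi P x"
proof -
  have "hi P x \<in> {w\<in>P. x < w}"
    unfolding hi_def using P x by (intro Min_in) (auto simp: partition_of_def)
  then show "hi P x \<in> P" "x < hi P x" by auto
qed

lemma le_lo_iff: "w \<in> P \<Longrightarrow> w \<le> lo P x \<longleftrightarrow> w \<le> x"
  using lo_le P by (auto simp: lo_def partition_of_def intro!: Max_ge)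

lemma hi_le_iff: "w \<in> P \<Longrightarrow> hi P x \<le> w \<longleftrightarrow> x < w"
  using less_hi P by (auto simp: hi_def partition_of_def intro!: Min_le)

lemma lo_less_b: "lo P x \<in> P - {b}" "lo P x \<in> {a..<b}"
  using lo_mem lo_le x P by (auto simp: partition_of_def)

lemma hi_bounds: "a < hi P x" "hi P x \<le> b"
  using hi_mem less_hi x P by (auto simp: partition_of_def)

end

lemma lo_same: "partition_of a b P \<Longrightarrow> x \<in> P - {b} \<Longrightarrow> lo P x = x"
  using le_lo_iff[of a b P x x] lo_le[of a b P x] partition_cell[of a b P x] by auto

lemma hi_lo:
  assumes P: "partition_of a b P" and x: "x \<in> {a..<b}"
  shows "hi P (lo P x) = hi P x"
proof -
  have "{w\<in>P. lo P x < w} = {w\<in>P. x < w}"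
    using le_lo_iff[OF P x] by (auto simp: not_le[symmetric])
  then show ?thesis by (simp add: hi_def)
qed

lemma lo_eq_iff:
  assumes P: "partition_of a b P" and x: "x \<in> {a..<b}" and u: "u \<in> P - {b}"
  shows "lo P x = u \<longleftrightarrow> u \<le> x \<and> x < hi P u"
proof
  assume "lo P x = u" then show "u \<le> x \<and> x < hi P u"
    using lo_le[OF P x] hi_lo[OF P x] less_hi[OF P x] by auto
next
  assume *: "u \<le> x \<and> x < hi P u"
  then have "u \<le> lo P x" using le_lo_iff[OF P x] u by auto
  moreover have "\<not> u < lo P x"
    using hi_le_iff[OF P partition_cell[OF P u], of "lo P x"] lo_mem[OF P x] lo_le[OF P x] * by auto
  ultimately show "lo P x = u" by simp
qed

lemma lo_lo_subset:
  assumes P: "partition_of a b P" and R: "partition_of a b R" and "P \<subseteq> R" and x: "x \<in> {a..<b}"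
  shows "lo P (lo R x) = lo P x"
proof -
  have "{w\<in>P. w \<le> lo R x} = {w\<in>P. w \<le> x}"
    using le_lo_iff[OF R x] \<open>P \<subseteq> R\<close> by auto
  then show ?thesis by (simp add: lo_def)
qed

lemma hi_mono_subset:
  assumes P: "partition_of a b P" and R: "partition_of a b R" and "P \<subseteq> R" and x: "x \<in> {a..<b}"
  shows "hi R x \<le> hi P x"
  using hi_le_iff[OF R x, of "hi P x"] hi_mem[OF P x] less_hi[OF P x] \<open>P \<subseteq> R\<close> by auto

lemma mesh_below_subset:
  assumes P: "partition_of a b P" and R: "partition_of a b R" and "P \<subseteq> R" and m: "mesh_below b P d"
  shows "mesh_below b R d"
  unfolding mesh_below_def
proof
  fix u assume u: "u \<in> R - {b}"
  have x: "u \<in> {a..<b}" using partition_cell[OF R u] .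
  have "hi R u \<le> hi P (lo P u)" using hi_mono_subset[OF P R \<open>P \<subseteq> R\<close> x] hi_lo[OF P x] by simp
  moreover have "hi P (lo P u) - lo P u < d" using m lo_less_b[OF P x] by (auto simp: mesh_below_def)
  ultimately show "hi R u - u < d" using lo_le[OF P x] by simp
qed

lemma mesh_below_mono: "mesh_below b P d \<Longrightarrow> d \<le> e \<Longrightarrow> mesh_below b P e"
  by (auto simp: mesh_below_def intro: less_le_trans)

lemma mesh_cell:
  assumes "partition_of a b P" "x \<in> {a..<b}" "mesh_below b P d"
  shows "hi P x - lo P x < d"
  using bspec[OF assms(3)[unfolded mesh_below_def] lo_less_b(1)[OF assms(1,2)]] hi_lo[OF assms(1,2)] by simp

text \<open>Induction on the number of partition points in [u, v): the first cell is split off and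
  the rest starts at \<open>hi R u\<close>.\<close>

lemma sum_telescope:
  assumes R: "partition_of a b R" and "u \<in> R" "v \<in> R" "u \<le> v"
  shows "(\<Sum>r | r \<in> R \<and> u \<le> r \<and> r < v. B (hi R r) - B r) = (B v - B u :: real)"
  using \<open>u \<in> R\<close> \<open>u \<le> v\<close>
proof (induction "card {r\<in>R. u \<le> r \<and> r < v}" arbitrary: u rule: less_induct)
  case less
  show ?case
  proof (cases "u = v")
    case True then have "{r\<in>R. u \<le> r \<and> r < v} = {}" by auto
    then show ?thesis using True by (simp only: sum.empty)
  next
    case False
    with less.prems have uv: "u < v" by simp
    have u: "u \<in> {a..<b}" using less.prems uv assms by (auto simp: partition_of_def)
    have eq: "{r\<in>R. u \<le> r \<and> r < v} = insert u {r\<in>R. hi R u \<le> r \<and> r < v}"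
      using hi_le_iff[OF R u] less.prems uv by auto
    have nin: "u \<notin> {r\<in>R. hi R u \<le> r \<and> r < v}" using less_hi[OF R u] by auto
    have fin: "finite {r\<in>R. hi R u \<le> r \<and> r < v}" using R by simp
    have "(\<Sum>r | r \<in> R \<and> hi R u \<le> r \<and> r < v. B (hi R r) - B r) = B v - B (hi R u)"
    proof (rule less.hyps)
      show "card {r\<in>R. hi R u \<le> r \<and> r < v} < card {r\<in>R. u \<le> r \<and> r < v}"
        unfolding eq using nin fin by simp
      show "hi R u \<in> R" "hi R u \<le> v" using hi_mem[OF R u] hi_le_iff[OF R u, of v] uv \<open>v \<in> R\<close> by auto
    qed
    then show ?thesis unfolding eq using nin fin by simp
  qed
qed

text \<open>Telescoping written with a cut-off factor, so that the value of a path at a partition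
  point becomes a linear form with a step kernel.\<close>

lemma sum_telescope_from_left:
  assumes R: "partition_of a b R" and "v \<in> R"
  shows "(\<Sum>r\<in>R - {b}. (if r < v then 1 else 0) * (B (hi R r) - B r)) = (B v - B a :: real)"
proof -
  have "(\<Sum>r\<in>R - {b}. (if r < v then 1 else 0) * (B (hi R r) - B r)) =
     (\<Sum>r | r \<in> R \<and> a \<le> r \<and> r < v. (if r < v then 1 else 0) * (B (hi R r) - B r))"
    using assms by (intro sum.mono_neutral_right) (auto simp: partition_of_def)
  also have "\<dots> = (\<Sum>r | r \<in> R \<and> a \<le> r \<and> r < v. B (hi R r) - B r)"
    by (intro sum.cong) auto
  also have "\<dots> = B v - B a"
    using assms by (intro sum_telescope[OF R, of a v B]) (auto simp: partition_of_def)
  finally show ?thesis .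
qed

lemma sum_cell:
  assumes P: "partition_of a b P" and R: "partition_of a b R" and "P \<subseteq> R" and u: "u \<in> P - {b}"
  shows "(\<Sum>r | r \<in> R - {b} \<and> lo P r = u. B (hi R r) - B r) = (B (hi P u) - B u :: real)"
proof -
  have u': "u \<in> {a..<b}" using partition_cell[OF P u] .
  have "{r. r \<in> R - {b} \<and> lo P r = u} = {r. r \<in> R \<and> u \<le> r \<and> r < hi P u}"
    using lo_eq_iff[OF P partition_cell[OF R] u] hi_bounds[OF P u'] by (auto simp: partition_of_def)
  then show ?thesis
    using sum_telescope[OF R, of u "hi P u" B] u hi_mem[OF P u'] less_hi[OF P u'] \<open>P \<subseteq> R\<close> by auto
qed

text \<open>A sum over P keeps its value on a refinement when the weight is evaluated at the left
  end of the P-cell. This is how sums over different partitions become forms in the same independent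
  increments.\<close>

lemma sum_refine:
  assumes P: "partition_of a b P" and R: "partition_of a b R" and "P \<subseteq> R"
  shows "(\<Sum>u\<in>P - {b}. g u * (B (hi P u) - B u)) = (\<Sum>r\<in>R - {b}. g (lo P r) * (B (hi R r) - B r) :: real)"
proof -
  have "(\<Sum>r\<in>R - {b}. g (lo P r) * (B (hi R r) - B r))
    = (\<Sum>u\<in>P - {b}. \<Sum>r | r \<in> R - {b} \<and> lo P r = u. g (lo P r) * (B (hi R r) - B r))"
    using P R lo_less_b[OF P partition_cell[OF R]] by (intro sum.group[symmetric]) auto
  also have "\<dots> = (\<Sum>u\<in>P - {b}. \<Sum>r | r \<in> R - {b} \<and> lo P r = u. g u * (B (hi R r) - B r))"
    by (intro sum.cong) auto
  also have "\<dots> = (\<Sum>u\<in>P - {b}. g u * (B (hi P u) - B u))"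
    using sum_cell[OF P R \<open>P \<subseteq> R\<close>] by (simp add: sum_distrib_left[symmetric])
  finally show ?thesis by simp
qed

lemma sum_cell_lengths: "partition_of a b R \<Longrightarrow> (\<Sum>r\<in>R - {b}. hi R r - r) = b - a"
proof -
  assume R: "partition_of a b R"
  have "(\<Sum>r\<in>R - {b}. hi R r - r) = (\<Sum>r\<in>R - {b}. (if r < b then 1 else 0) * (hi R r - r))"
    using partition_cell[OF R] by (intro sum.cong) auto
  then show ?thesis using sum_telescope_from_left[OF R, of b "\<lambda>x. x"] R by (simp add: partition_of_def)
qed

lemma cell_length_pos: "partition_of a b R \<Longrightarrow> r \<in> R - {b} \<Longrightarrow> hi R r - r > 0"
  using less_hi partition_cell by fastforce

text \<open>The cells of R inside one cell of P add up to the length of that cell. Kernels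
  concentrated near the diagonal are estimated through this.\<close>

lemma sum_same_cell:
  assumes P: "partition_of a b P" and R: "partition_of a b R" and "P \<subseteq> R" and x: "x \<in> {a..<b}"
    and "mesh_below b P d"
  shows "(\<Sum>r\<in>R - {b}. (hi R r - r) * (if lo P r = lo P x then 1 else 0)) < d"
proof -
  have "(\<Sum>r\<in>R - {b}. (hi R r - r) * (if lo P r = lo P x then 1 else 0))
     = (\<Sum>r | r \<in> R - {b} \<and> lo P r = lo P x. hi R r - r)"
    using R by (intro sum.mono_neutral_cong_right) auto
  also have "\<dots> = hi P x - lo P x"
    using sum_cell[OF P R \<open>P \<subseteq> R\<close> lo_less_b(1)[OF P x], of "\<lambda>x. x"] hi_lo[OF P x] by simp
  finally show ?thesis using mesh_cell[OF P x] assms by simp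
qed

text \<open>The trapezoidal rule replaces the Heaviside kernel by this one.\<close>

definition trapez :: "real set \<Rightarrow> real \<Rightarrow> real \<Rightarrow> real" where
  "trapez P x y = ((if x < lo P y then 1 else 0) + (if x < hi P y then 1 else 0)) / 2"

text \<open>The value 1/2 at x = y is forced: it is what the trapezoidal kernel of a partition takes
  at coinciding cells, see \<open>trapez_eq_heavi\<close>.\<close>

definition heavi :: "real \<Rightarrow> real \<Rightarrow> real" where
  "heavi x y = (if x < y then 1 else if x = y then 1 / 2 else 0)"

lemma trapez_diag: "partition_of a b P \<Longrightarrow> x \<in> {a..<b} \<Longrightarrow> trapez P x x = 1 / 2"
  using lo_le[of a b P x] less_hi[of a b P x] by (auto simp: trapez_def)

lemma heavi_diag [simp]: "heavi x x = 1 / 2" by (simp add: heavi_def)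

lemma trapez_eq_heavi:
  assumes R: "partition_of a b R" and "x \<in> R - {b}" "y \<in> R - {b}"
  shows "trapez R x y = heavi x y"
  using assms lo_same[OF R, of y] hi_le_iff[OF R partition_cell[OF R], of y x] less_hi[OF R partition_cell[OF R], of y]
  by (auto simp: trapez_def heavi_def)

lemma trapez_cells:
  assumes P: "partition_of a b P" and x: "x \<in> {a..<b}" and y: "y \<in> {a..<b}"
  shows "lo P x < lo P y \<Longrightarrow> trapez P x y = 1 \<and> x < y"
    and "lo P y < lo P x \<Longrightarrow> trapez P x y = 0 \<and> y < x"
    and "lo P x = lo P y \<Longrightarrow> trapez P x y = 1 / 2"
proof -
  note f = lo_le[OF P x] lo_le[OF P y] less_hi[OF P x] less_hi[OF P y] lo_mem[OF P x] lo_mem[OF P y]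
    le_lo_iff[OF P x, of "lo P y"] le_lo_iff[OF P y, of "lo P x"]
    hi_le_iff[OF P x, of "lo P y"] hi_le_iff[OF P y, of "lo P x"] hi_lo[OF P x] hi_lo[OF P y]
  show "lo P x < lo P y \<Longrightarrow> trapez P x y = 1 \<and> x < y" using f by (auto simp: trapez_def)
  show "lo P y < lo P x \<Longrightarrow> trapez P x y = 0 \<and> y < x" using f by (auto simp: trapez_def)
  show "lo P x = lo P y \<Longrightarrow> trapez P x y = 1 / 2" using f by (auto simp: trapez_def)
qed

text \<open>For points in different cells both kernels see only the order of the cells. Inside one
  cell \<open>trapez\<close> is 1/2 while \<open>heavi\<close> is 0, 1/2 or 1.\<close>

lemma trapez_heavi_diff:
  assumes P: "partition_of a b P" and x: "x \<in> {a..<b}" and y: "y \<in> {a..<b}"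
  shows "\<bar>trapez P x y - heavi x y\<bar> \<le> (if lo P x = lo P y then 1 / 2 else 0)"
  using trapez_cells[OF assms] by (cases "lo P x" "lo P y" rule: linorder_cases) (auto simp: heavi_def)

lemma trapez_bounds: "0 \<le> trapez P x y" "trapez P x y \<le> 1"
  by (auto simp: trapez_def)

lemma heavi_bounds: "0 \<le> heavi x y" "heavi x y \<le> 1"
  by (auto simp: heavi_def)

section \<open>Wiener increments\<close>

locale wiener = prob_space M for M :: "'a measure" +
  fixes F :: "real \<Rightarrow> 'a measure" and m :: nat and T :: real and W :: "nat \<Rightarrow> real \<Rightarrow> 'a \<Rightarrow> real"
  assumes filt: "filtered_complete_prob_space M F T"
    and wiener: "wiener_process M F m T W"
begin

definition dW :: "nat \<Rightarrow> real set \<Rightarrow> real \<Rightarrow> 'a \<Rightarrow> real" where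
  "dW i R r \<omega> = W i (hi R r) \<omega> - W i r \<omega>"

lemma space_F: "space (F s) = space M" and sets_F: "sets (F s) \<subseteq> sets M"
  and sets_F_mono: "s \<le> u \<Longrightarrow> sets (F s) \<subseteq> sets (F u)"
  using filt by (auto simp: filtered_complete_prob_space_def subalgebra_def filtration_def)

lemma W_measurable_F: "i \<in> {1..m} \<Longrightarrow> s \<in> {0..T} \<Longrightarrow> s \<le> u \<Longrightarrow> W i s \<in> borel_measurable (F u)"
  using wiener sets_F_mono[of s u] space_F
  by (force simp: wiener_process_def measurable_def)

lemma W_measurable [measurable]: "i \<in> {1..m} \<Longrightarrow> s \<in> {0..T} \<Longrightarrow> W i s \<in> borel_measurable M"
  using W_measurable_F[of i s s] sets_F[of s] space_F by (force simp: measurable_def)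

lemma increment_distributed:
  "i \<in> {1..m} \<Longrightarrow> 0 \<le> s \<Longrightarrow> s < u \<Longrightarrow> u \<le> T \<Longrightarrow>
    distributed M lborel (\<lambda>\<omega>. W i u \<omega> - W i s \<omega>) (\<lambda>x. ennreal (normal_density 0 (sqrt (u - s)) x))"
  using wiener by (simp add: wiener_process_def)

lemma prob_increment_vector:
  assumes s: "0 \<le> s" "s < u" "u \<le> T" and S: "\<And>i. i \<in> {1..m} \<Longrightarrow> S i \<in> sets borel"
  shows "prob {\<omega>\<in>space M. \<forall>i\<in>{1..m}. W i u \<omega> - W i s \<omega> \<in> S i}
    = (\<Prod>i\<in>{1..m}. prob {\<omega>\<in>space M. W i u \<omega> - W i s \<omega> \<in> S i})"
\<comment> \<open>Without components the intersection formed below would be \<open>UNIV\<close> and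
  not \<open>space M\<close>.\<close>
proof (cases "m = 0")
  case True then show ?thesis by (simp add: prob_space)
next
  case False
  have "indep_vars (\<lambda>_. Pi\<^sub>M {0..T} (\<lambda>_. borel)) (\<lambda>i \<omega>. \<lambda>s\<in>{0..T}. W i s \<omega>) {1..m}"
    using wiener by (simp add: wiener_process_def)
  then have "indep_vars (\<lambda>_. borel) (\<lambda>i \<omega>. (\<lambda>s\<in>{0..T}. W i s \<omega>) u - (\<lambda>s\<in>{0..T}. W i s \<omega>) s) {1..m}"
    by (rule indep_vars_compose2[where Y = "\<lambda>i f. f u - f s"]) (use s in \<open>auto intro!: borel_measurable_diff measurable_component_singleton\<close>)
  then have "indep_vars (\<lambda>_. borel) (\<lambda>i \<omega>. W i u \<omega> - W i s \<omega>) {1..m}"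
    using s by simp
  from indep_varsD_finite[OF this, of S] S False
  have "prob (\<Inter>i\<in>{1..m}. (\<lambda>\<omega>. W i u \<omega> - W i s \<omega>) -` S i \<inter> space M)
    = (\<Prod>i\<in>{1..m}. prob ((\<lambda>\<omega>. W i u \<omega> - W i s \<omega>) -` S i \<inter> space M))" by auto
  moreover have "(\<Inter>i\<in>{1..m}. (\<lambda>\<omega>. W i u \<omega> - W i s \<omega>) -` S i \<inter> space M)
     = {\<omega>\<in>space M. \<forall>i\<in>{1..m}. W i u \<omega> - W i s \<omega> \<in> S i}"
    using False by (auto simp: Ball_def)
  moreover have "(\<lambda>\<omega>. W i u \<omega> - W i s \<omega>) -` S i \<inter> space M = {\<omega>\<in>space M. W i u \<omega> - W i s \<omega> \<in> S i}" for i
    by auto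
  ultimately show ?thesis by simp
qed

text \<open>Cells are added from left to right. The event about the earlier cells lies in
  \<open>F r\<close>, since each of them ends at or before r, and the vector of increments over the
  new cell is independent of \<open>F r\<close>; within that vector the components factor by
  \<open>prob_increment_vector\<close>.\<close>

lemma prob_increments:
  assumes R: "partition_of a b R" and ab: "0 \<le> a" "b \<le> T"
    and "finite Q" "Q \<subseteq> R - {b}" and S: "\<And>i r. S i r \<in> sets borel"
  shows "prob {\<omega>\<in>space M. \<forall>r\<in>Q. \<forall>i\<in>{1..m}. dW i R r \<omega> \<in> S i r}
    = (\<Prod>r\<in>Q. \<Prod>i\<in>{1..m}. prob {\<omega>\<in>space M. dW i R r \<omega> \<in> S i r})"
  using \<open>finite Q\<close> \<open>Q \<subseteq> R - {b}\<close>
proof (induction Q rule: finite_linorder_max_induct)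
  case empty then show ?case by (simp add: prob_space)
next
  case (insert r Q)
  have r: "r \<in> {a..<b}" "r \<in> R" using partition_cell[OF R] insert.prems by auto
  have r0: "0 \<le> r" "r < hi R r" "hi R r \<le> T" using r less_hi[OF R r(1)] hi_bounds[OF R r(1)] ab by auto
  let ?E = "{\<omega>\<in>space M. \<forall>q\<in>Q. \<forall>i\<in>{1..m}. dW i R q \<omega> \<in> S i q}"
  let ?V = "{\<omega>\<in>space M. \<forall>i\<in>{1..m}. dW i R r \<omega> \<in> S i r}"
  have "?E \<in> sets (F r)"
  proof -
    have "dW i R q \<in> borel_measurable (F r)" if "q \<in> Q" "i \<in> {1..m}" for q i
    proof -
      have q: "q \<in> {a..<b}" "q < r" using partition_cell[OF R] insert.prems insert.hyps that by auto
      have "hi R q \<le> r" using hi_le_iff[OF R q(1) r(2)] q by auto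
      then show ?thesis
        unfolding dW_def[abs_def] using q r ab that(2) hi_bounds[OF R q(1)]
        by (intro borel_measurable_diff W_measurable_F) auto
    qed
    note [measurable] = this
    have [measurable]: "S i q \<in> sets borel" for i q by (rule S)
    have "{\<omega>\<in>space (F r). \<forall>q\<in>Q. \<forall>i\<in>{1..m}. dW i R q \<omega> \<in> S i q} \<in> sets (F r)"
      using insert.hyps by measurable
    then show ?thesis by (simp add: space_F)
  qed
  moreover have "?V \<in> sets (vimage_algebra (space M) (\<lambda>\<omega>. \<lambda>i\<in>{1..m}. W i (hi R r) \<omega> - W i r \<omega>)
             (Pi\<^sub>M {1..m} (\<lambda>_. borel)))"
  proof -
    have "?V = (\<lambda>\<omega>. \<lambda>i\<in>{1..m}. W i (hi R r) \<omega> - W i r \<omega>) -` (\<Pi>\<^sub>E i\<in>{1..m}. S i r) \<inter> space M"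
      by (auto simp: dW_def PiE_iff)
    also have "\<dots> \<in> sets (vimage_algebra (space M) (\<lambda>\<omega>. \<lambda>i\<in>{1..m}. W i (hi R r) \<omega> - W i r \<omega>)
             (Pi\<^sub>M {1..m} (\<lambda>_. borel)))"
      using S by (intro in_vimage_algebra sets_PiM_I_finite) auto
    finally show ?thesis .
  qed
  moreover have "indep_set (sets (F r)) (sets (vimage_algebra (space M) (\<lambda>\<omega>. \<lambda>i\<in>{1..m}. W i (hi R r) \<omega> - W i r \<omega>)
             (Pi\<^sub>M {1..m} (\<lambda>_. borel))))"
    using wiener r0 by (simp add: wiener_process_def)
  ultimately have "prob (?E \<inter> ?V) = prob ?E * prob ?V" by (intro indep_setD)
  moreover have "?E \<inter> ?V = {\<omega>\<in>space M. \<forall>q\<in>insert r Q. \<forall>i\<in>{1..m}. dW i R q \<omega> \<in> S i q}" by auto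
  moreover have "prob ?V = (\<Prod>i\<in>{1..m}. prob {\<omega>\<in>space M. dW i R r \<omega> \<in> S i r})"
    unfolding dW_def by (rule prob_increment_vector[OF r0]) (rule S)
  ultimately show ?case using insert by (auto simp: mult.commute)
qed

text \<open>Component and cell together form the index. Coincidences among the components of a form
  then become mere coincidences of indices, and the moment bounds cover all cases at once.\<close>

lemma gauss_increments:
  assumes R: "partition_of a b R" and ab: "0 \<le> a" "b \<le> T"
  shows "gauss_family M (\<lambda>(i, r). dW i R r) (\<lambda>(i, r). hi R r - r) ({1..m} \<times> (R - {b}))"
proof unfold_locales
  let ?I = "{1..m} \<times> (R - {b})"
  show "finite ?I" using R by simp
  have cell: "0 \<le> r \<and> r < hi R r \<and> hi R r \<le> T \<and> r \<le> T" if "r \<in> R - {b}" for r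
    using partition_cell[OF R that] less_hi[OF R] hi_bounds[OF R] ab by fastforce
  show "distributed M lborel (case x of (i, r) \<Rightarrow> dW i R r)
      (\<lambda>y. ennreal (normal_density 0 (sqrt (case x of (i, r) \<Rightarrow> hi R r - r)) y))" if "x \<in> ?I" for x
    using that cell unfolding dW_def[abs_def] by (auto intro!: increment_distributed)
  show "(case x of (i, r) \<Rightarrow> hi R r - r) > 0" if "x \<in> ?I" for x
    using that cell[of "snd x"] unfolding case_prod_beta mem_Times_iff by simp
  have meas [measurable]: "dW i R r \<in> borel_measurable M" if "i \<in> {1..m}" "r \<in> R - {b}" for i r
    using that cell[of r] unfolding dW_def[abs_def] by (intro borel_measurable_diff W_measurable) auto
  show "indep_vars (\<lambda>_. borel) (\<lambda>(i, r). dW i R r) ?I"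
  proof (cases "?I = {}")
    case True then show ?thesis unfolding True by (simp add: indep_vars_def2 indep_sets_def)
  next
    case False
    let ?X = "\<lambda>(i, r). dW i R r"
    have "indep_sets (\<lambda>x. {?X x -` A \<inter> space M | A. A \<in> sets borel}) ?I"
    proof (subst indep_sets_finite)
      show "?I \<noteq> {}" "finite ?I" using False R by auto
      show "{?X x -` A \<inter> space M | A. A \<in> sets borel} \<subseteq> events" if "x \<in> ?I" for x
        using that meas by (auto intro!: measurable_sets)
      \<comment> \<open>As \<open>space M\<close> belongs to every class, the product formula for
        the full index set already contains the formulas for all its subfamilies.\<close>
      show "space M \<in> {?X x -` A \<inter> space M | A. A \<in> sets borel}" for x
        by (rule CollectI, rule exI[of _ UNIV]) auto
      show "\<forall>A\<in>\<Pi> x\<in>?I. {?X x -` A \<inter> space M | A. A \<in> sets borel}. prob (\<Inter>x\<in>?I. A x) = (\<Prod>x\<in>?I. prob (A x))"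
      proof
        fix A assume "A \<in> (\<Pi> x\<in>?I. {?X x -` A \<inter> space M | A. A \<in> sets borel})"
        then have "\<forall>x\<in>?I. \<exists>S. S \<in> sets borel \<and> A x = ?X x -` S \<inter> space M"
          unfolding Pi_iff by blast
        then obtain S0 where S0: "\<And>x. x \<in> ?I \<Longrightarrow> S0 x \<in> sets borel \<and> A x = ?X x -` S0 x \<inter> space M" by metis
        \<comment> \<open>Extended by \<open>UNIV\<close> outside the index set because
          \<open>prob_increments\<close> asks for a Borel set at every index.\<close>
        define S where "S i r = (if (i, r) \<in> ?I then S0 (i, r) else UNIV)" for i r
        have S: "S i r \<in> sets borel" for i r using S0 by (auto simp: S_def)
        have A: "A (i, r) = {\<omega>\<in>space M. dW i R r \<omega> \<in> S i r}" if "(i, r) \<in> ?I" for i r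
          using S0[OF that] that by (auto simp: S_def)
        have "(\<Inter>x\<in>?I. A x) = {\<omega>\<in>space M. \<forall>r\<in>R - {b}. \<forall>i\<in>{1..m}. dW i R r \<omega> \<in> S i r}"
        proof -
          have "(\<Inter>x\<in>?I. A x) = (\<Inter>x\<in>?I. {\<omega>\<in>space M. dW (fst x) R (snd x) \<omega> \<in> S (fst x) (snd x)})"
            using A by (intro INF_cong) (auto simp: mem_Times_iff)
          also have "\<dots> = {\<omega>\<in>space M. \<forall>r\<in>R - {b}. \<forall>i\<in>{1..m}. dW i R r \<omega> \<in> S i r}"
            using False by fastforce
          finally show ?thesis .
        qed
        then have "prob (\<Inter>x\<in>?I. A x) = (\<Prod>r\<in>R - {b}. \<Prod>i\<in>{1..m}. prob {\<omega>\<in>space M. dW i R r \<omega> \<in> S i r})"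
          using prob_increments[OF R ab _ _ S, of "R - {b}"] R by auto
        also have "\<dots> = (\<Prod>x\<in>?I. prob {\<omega>\<in>space M. dW (fst x) R (snd x) \<omega> \<in> S (fst x) (snd x)})"
          by (subst prod.swap) (simp add: prod.cartesian_product case_prod_beta)
        also have "\<dots> = (\<Prod>x\<in>?I. prob (A x))"
          using A by (intro prod.cong refl arg_cong[where f = prob]) (metis prod.collapse)
        finally show "prob (\<Inter>x\<in>?I. A x) = (\<Prod>x\<in>?I. prob (A x))" .
      qed
    qed
    then show ?thesis using meas by (auto simp: indep_vars_def2)
  qed
qed

section \<open>Forms in increments of prescribed components, as forms over all pairs (component,
  cell)\<close>

lemma sum_component:
  assumes "i \<in> {1..m}" "finite X"
  shows "(\<Sum>x\<in>{1..m} \<times> X. if fst x = i then f (snd x) else 0) = (\<Sum>r\<in>X. f r :: real)"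
proof -
  have "(\<Sum>x\<in>{1..m} \<times> X. if fst x = i then f (snd x) else 0) = (\<Sum>j\<in>{1..m}. \<Sum>r\<in>X. if j = i then f r else 0)"
    by (simp add: sum.cartesian_product case_prod_beta)
  also have "\<dots> = (\<Sum>r\<in>X. \<Sum>j\<in>{1..m}. if j = i then f r else 0)" by (rule sum.swap)
  also have "\<dots> = (\<Sum>r\<in>X. f r)" using assms by (simp add: sum.delta)
  finally show ?thesis .
qed

lemma sum_component2:
  assumes "i \<in> {1..m}" "j \<in> {1..m}" "finite X"
  shows "(\<Sum>x\<in>{1..m} \<times> X. \<Sum>y\<in>{1..m} \<times> X. if fst x = i \<and> fst y = j then f (snd x) (snd y) else 0)
    = (\<Sum>r\<in>X. \<Sum>s\<in>X. f r s :: real)"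
proof -
  have "(\<Sum>x\<in>{1..m} \<times> X. \<Sum>y\<in>{1..m} \<times> X. if fst x = i \<and> fst y = j then f (snd x) (snd y) else 0)
     = (\<Sum>x\<in>{1..m} \<times> X. if fst x = i then (\<Sum>y\<in>{1..m} \<times> X. if fst y = j then f (snd x) (snd y) else 0) else 0)"
    by (intro sum.cong refl) auto
  then show ?thesis by (simp only: sum_component[OF assms(2,3)] sum_component[OF assms(1,3), of "\<lambda>r. \<Sum>s\<in>X. f r s"])
qed

lemma sum_component3:
  assumes "i \<in> {1..m}" "j \<in> {1..m}" "k \<in> {1..m}" "finite X"
  shows "(\<Sum>x\<in>{1..m} \<times> X. \<Sum>y\<in>{1..m} \<times> X. \<Sum>z\<in>{1..m} \<times> X.
      if fst x = i \<and> fst y = j \<and> fst z = k then f (snd x) (snd y) (snd z) else 0)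
    = (\<Sum>r\<in>X. \<Sum>s\<in>X. \<Sum>u\<in>X. f r s u :: real)"
proof -
  have "(\<Sum>x\<in>{1..m} \<times> X. \<Sum>y\<in>{1..m} \<times> X. \<Sum>z\<in>{1..m} \<times> X.
      if fst x = i \<and> fst y = j \<and> fst z = k then f (snd x) (snd y) (snd z) else 0)
     = (\<Sum>x\<in>{1..m} \<times> X. if fst x = i then (\<Sum>y\<in>{1..m} \<times> X. \<Sum>z\<in>{1..m} \<times> X.
         if fst y = j \<and> fst z = k then f (snd x) (snd y) (snd z) else 0) else 0)"
    by (intro sum.cong refl) auto
  then show ?thesis by (simp only: sum_component2[OF assms(2,3,4)] sum_component[OF assms(1,4), of "\<lambda>r. \<Sum>s\<in>X. \<Sum>u\<in>X. f r s u"])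
qed

context
  fixes a b :: real and R :: "real set"
  assumes R: "partition_of a b R" and ab: "0 \<le> a" "b \<le> T"
begin

interpretation G: gauss_family M "\<lambda>(i, r). dW i R r" "\<lambda>(i, r). hi R r - r" "{1..m} \<times> (R - {b})"
  by (rule gauss_increments[OF R ab])

lemma all_moments_dW: "i \<in> {1..m} \<Longrightarrow> r \<in> R - {b} \<Longrightarrow> all_moments M (dW i R r)"
  using G.all_moments_xi[of "(i, r)"] by simp

lemma finite_cells: "finite (R - {b})" using R by simp

lemma linear_form_moment:
  assumes i: "i \<in> {1..m}"
  shows "expectation (\<lambda>\<omega>. (\<Sum>x\<in>R - {b}. l x * dW i R x \<omega>)\<^sup>2) = (\<Sum>x\<in>R - {b}. (hi R x - x) * (l x)\<^sup>2)"
proof -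
  have 1: "(\<Sum>x\<in>{1..m} \<times> (R - {b}). (if fst x = i then l (snd x) else 0) * (case x of (i, r) \<Rightarrow> dW i R r) \<omega>)
     = (\<Sum>x\<in>R - {b}. l x * dW i R x \<omega>)" for \<omega>
    by (subst sum_component[OF i finite_cells, symmetric]) (intro sum.cong refl, simp add: case_prod_beta)
  have 2: "(\<Sum>x\<in>{1..m} \<times> (R - {b}). (case x of (i, r) \<Rightarrow> hi R r - r) * (if fst x = i then l (snd x) else 0)\<^sup>2)
     = (\<Sum>x\<in>R - {b}. (hi R x - x) * (l x)\<^sup>2)"
    by (subst sum_component[OF i finite_cells, symmetric]) (intro sum.cong refl, simp add: case_prod_beta)
  show ?thesis
    using G.linear_second_moment[OF order.refl, of "\<lambda>x. if fst x = i then l (snd x) else 0"] unfolding 1 2 .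
qed

text \<open>The diagonal sum contributes only when i = j. Being a square, it may stay in the bound
  in any case, which makes the estimate the same for all i and j.\<close>

lemma quadratic_form_moment:
  assumes i: "i \<in> {1..m}" and j: "j \<in> {1..m}"
  shows "expectation (\<lambda>\<omega>. (\<Sum>x\<in>R - {b}. \<Sum>y\<in>R - {b}. q x y * dW i R x \<omega> * dW j R y \<omega>)\<^sup>2)
    \<le> (\<Sum>x\<in>R - {b}. (hi R x - x) * q x x)\<^sup>2
      + 2 * (\<Sum>x\<in>R - {b}. \<Sum>y\<in>R - {b}. (hi R x - x) * (hi R y - y) * (q x y)\<^sup>2)"
proof -
  let ?I = "{1..m} \<times> (R - {b})" let ?\<xi> = "\<lambda>x. case x of (i, r) \<Rightarrow> dW i R r" let ?v = "\<lambda>x. case x of (i, r) \<Rightarrow> hi R r - r"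
  define Q where "Q x y = (if fst x = i \<and> fst y = j then q (snd x) (snd y) else 0)" for x y :: "nat \<times> real"
  have 1: "(\<Sum>x\<in>?I. \<Sum>y\<in>?I. Q x y * ?\<xi> x \<omega> * ?\<xi> y \<omega>)
     = (\<Sum>x\<in>R - {b}. \<Sum>y\<in>R - {b}. q x y * dW i R x \<omega> * dW j R y \<omega>)" for \<omega>
    by (subst sum_component2[OF i j finite_cells, symmetric])
       (intro sum.cong refl, simp add: Q_def case_prod_beta)
  have 2: "(\<Sum>x\<in>?I. \<Sum>y\<in>?I. ?v x * ?v y * (Q x y)\<^sup>2)
     = (\<Sum>x\<in>R - {b}. \<Sum>y\<in>R - {b}. (hi R x - x) * (hi R y - y) * (q x y)\<^sup>2)"
    by (subst sum_component2[OF i j finite_cells, symmetric])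
       (intro sum.cong refl, simp add: Q_def case_prod_beta)
  have 3: "(\<Sum>x\<in>?I. ?v x * Q x x) = (if i = j then (\<Sum>x\<in>R - {b}. (hi R x - x) * q x x) else 0)"
  proof -
    have "(\<Sum>x\<in>?I. ?v x * Q x x) = (\<Sum>r\<in>R - {b}. if i = j then (hi R r - r) * q r r else 0)"
      by (subst sum_component[OF i finite_cells, symmetric], intro sum.cong refl) (auto simp: Q_def case_prod_beta)
    then show ?thesis by simp
  qed
  have "expectation (\<lambda>\<omega>. (\<Sum>x\<in>R - {b}. \<Sum>y\<in>R - {b}. q x y * dW i R x \<omega> * dW j R y \<omega>)\<^sup>2)
    \<le> (if i = j then (\<Sum>x\<in>R - {b}. (hi R x - x) * q x x) else 0)\<^sup>2
      + 2 * (\<Sum>x\<in>R - {b}. \<Sum>y\<in>R - {b}. (hi R x - x) * (hi R y - y) * (q x y)\<^sup>2)"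
    using G.quadratic_second_moment[OF order.refl, of Q 0] unfolding 1 2 3 by simp
  then show ?thesis by (cases "i = j") (auto intro: order_trans)
qed

text \<open>Each trace is present only if the two components concerned agree. The traces are
  separated by \<open>sq_sum3_le\<close> and then bounded by their unconditional squares, so the
  result does not depend on which of i, j, k coincide.\<close>

lemma cubic_form_moment:
  assumes i: "i \<in> {1..m}" and j: "j \<in> {1..m}" and k: "k \<in> {1..m}"
  shows "expectation (\<lambda>\<omega>. (\<Sum>x\<in>R - {b}. \<Sum>y\<in>R - {b}. \<Sum>z\<in>R - {b}.
      A x y z * dW i R x \<omega> * dW j R y \<omega> * dW k R z \<omega>)\<^sup>2)
    \<le> 3 * (\<Sum>x\<in>R - {b}. (hi R x - x) * (\<Sum>y\<in>R - {b}. (hi R y - y) * A x y y)\<^sup>2)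
      + 3 * (\<Sum>x\<in>R - {b}. (hi R x - x) * (\<Sum>y\<in>R - {b}. (hi R y - y) * A y x y)\<^sup>2)
      + 3 * (\<Sum>x\<in>R - {b}. (hi R x - x) * (\<Sum>y\<in>R - {b}. (hi R y - y) * A y y x)\<^sup>2)
      + 6 * (\<Sum>x\<in>R - {b}. \<Sum>y\<in>R - {b}. \<Sum>z\<in>R - {b}. (hi R x - x) * (hi R y - y) * (hi R z - z) * (A x y z)\<^sup>2)"
proof -
  let ?I = "{1..m} \<times> (R - {b})" let ?\<xi> = "\<lambda>x. case x of (i, r) \<Rightarrow> dW i R r" let ?v = "\<lambda>x. case x of (i, r) \<Rightarrow> hi R r - r"
  define Q where "Q x y z = (if fst x = i \<and> fst y = j \<and> fst z = k then A (snd x) (snd y) (snd z) else 0)"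
    for x y z :: "nat \<times> real"
  have 1: "(\<Sum>x\<in>?I. \<Sum>y\<in>?I. \<Sum>z\<in>?I. Q x y z * ?\<xi> x \<omega> * ?\<xi> y \<omega> * ?\<xi> z \<omega>)
     = (\<Sum>x\<in>R - {b}. \<Sum>y\<in>R - {b}. \<Sum>z\<in>R - {b}. A x y z * dW i R x \<omega> * dW j R y \<omega> * dW k R z \<omega>)" for \<omega>
    by (subst sum_component3[OF i j k finite_cells, symmetric])
       (intro sum.cong refl, simp add: Q_def case_prod_beta)
  have 2: "(\<Sum>x\<in>?I. \<Sum>y\<in>?I. \<Sum>z\<in>?I. ?v x * ?v y * ?v z * (Q x y z)\<^sup>2)
     = (\<Sum>x\<in>R - {b}. \<Sum>y\<in>R - {b}. \<Sum>z\<in>R - {b}. (hi R x - x) * (hi R y - y) * (hi R z - z) * (A x y z)\<^sup>2)"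
    by (subst sum_component3[OF i j k finite_cells, symmetric])
       (intro sum.cong refl, simp add: Q_def case_prod_beta)
  define t1 t2 t3 where "t1 x = (\<Sum>y\<in>R - {b}. (hi R y - y) * A x y y)"
    and "t2 x = (\<Sum>y\<in>R - {b}. (hi R y - y) * A y x y)" and "t3 x = (\<Sum>y\<in>R - {b}. (hi R y - y) * A y y x)" for x
  define s1 s2 s3 where "s1 x = (\<Sum>y\<in>?I. ?v y * Q x y y)" and "s2 x = (\<Sum>y\<in>?I. ?v y * Q y x y)"
    and "s3 x = (\<Sum>y\<in>?I. ?v y * Q y y x)" for x
  have s1: "s1 x = (if fst x = i then if j = k then t1 (snd x) else 0 else 0)" for x
  proof -
    have "s1 x = (\<Sum>r\<in>R - {b}. if fst x = i \<and> j = k then (hi R r - r) * A (snd x) r r else 0)"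
      unfolding s1_def
      by (subst sum_component[OF j finite_cells, symmetric], intro sum.cong refl) (auto simp: Q_def case_prod_beta)
    then show ?thesis by (simp add: t1_def)
  qed
  have s2: "s2 x = (if fst x = j then if i = k then t2 (snd x) else 0 else 0)" for x
  proof -
    have "s2 x = (\<Sum>r\<in>R - {b}. if fst x = j \<and> i = k then (hi R r - r) * A r (snd x) r else 0)"
      unfolding s2_def
      by (subst sum_component[OF i finite_cells, symmetric], intro sum.cong refl) (auto simp: Q_def case_prod_beta)
    then show ?thesis by (simp add: t2_def)
  qed
  have s3: "s3 x = (if fst x = k then if i = j then t3 (snd x) else 0 else 0)" for x
  proof -
    have "s3 x = (\<Sum>r\<in>R - {b}. if fst x = k \<and> i = j then (hi R r - r) * A r r (snd x) else 0)"
      unfolding s3_def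
      by (subst sum_component[OF i finite_cells, symmetric], intro sum.cong refl) (auto simp: Q_def case_prod_beta)
    then show ?thesis by (simp add: t3_def)
  qed
  have vnn: "0 \<le> ?v x" if "x \<in> ?I" for x using G.v_pos[OF that] by simp
  \<comment> \<open>c says that the free index has the right component, d that the two contracted
    components agree; d is given up here.\<close>
  have sq: "(if c then if d then y else 0 else 0)\<^sup>2 \<le> (if c then y\<^sup>2 else 0)" for c d and y :: real by simp
  have "(\<Sum>x\<in>?I. ?v x * (\<Sum>y\<in>?I. ?v y * (Q x y y + Q y x y + Q y y x))\<^sup>2)
    = (\<Sum>x\<in>?I. ?v x * (s1 x + s2 x + s3 x)\<^sup>2)"
    by (simp add: s1_def s2_def s3_def sum.distrib distrib_left)
  also have "\<dots> \<le> (\<Sum>x\<in>?I. ?v x * (3 * (if fst x = i then (t1 (snd x))\<^sup>2 else 0) + 3 * (if fst x = j then (t2 (snd x))\<^sup>2 else 0)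
       + 3 * (if fst x = k then (t3 (snd x))\<^sup>2 else 0)))"
    unfolding s1 s2 s3
    by (intro sum_mono mult_left_mono vnn order_trans[OF sq_sum3_le] add_mono sq) auto
  also have "\<dots> = 3 * (\<Sum>x\<in>?I. if fst x = i then (hi R (snd x) - snd x) * (t1 (snd x))\<^sup>2 else 0)
     + 3 * (\<Sum>x\<in>?I. if fst x = j then (hi R (snd x) - snd x) * (t2 (snd x))\<^sup>2 else 0)
     + 3 * (\<Sum>x\<in>?I. if fst x = k then (hi R (snd x) - snd x) * (t3 (snd x))\<^sup>2 else 0)"
    unfolding sum_distrib_left sum.distrib[symmetric] by (intro sum.cong) (auto simp: algebra_simps)
  also have "\<dots> = 3 * (\<Sum>x\<in>R - {b}. (hi R x - x) * (t1 x)\<^sup>2) + 3 * (\<Sum>x\<in>R - {b}. (hi R x - x) * (t2 x)\<^sup>2)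
     + 3 * (\<Sum>x\<in>R - {b}. (hi R x - x) * (t3 x)\<^sup>2)"
    by (simp only: sum_component[OF i finite_cells, of "\<lambda>x. (hi R x - x) * (t1 x)\<^sup>2"]
        sum_component[OF j finite_cells, of "\<lambda>x. (hi R x - x) * (t2 x)\<^sup>2"] sum_component[OF k finite_cells, of "\<lambda>x. (hi R x - x) * (t3 x)\<^sup>2"])
  finally have tr: "(\<Sum>x\<in>?I. ?v x * (\<Sum>y\<in>?I. ?v y * (Q x y y + Q y x y + Q y y x))\<^sup>2) \<le> \<dots>" .
  have "expectation (\<lambda>\<omega>. (\<Sum>x\<in>R - {b}. \<Sum>y\<in>R - {b}. \<Sum>z\<in>R - {b}.
      A x y z * dW i R x \<omega> * dW j R y \<omega> * dW k R z \<omega>)\<^sup>2)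
    \<le> (\<Sum>x\<in>?I. ?v x * (\<Sum>y\<in>?I. ?v y * (Q x y y + Q y x y + Q y y x))\<^sup>2)
     + 6 * (\<Sum>x\<in>R - {b}. \<Sum>y\<in>R - {b}. \<Sum>z\<in>R - {b}. (hi R x - x) * (hi R y - y) * (hi R z - z) * (A x y z)\<^sup>2)"
    using G.cubic_second_moment[OF order.refl, of Q "\<lambda>_. 0"] unfolding 1 2 by simp
  with tr show ?thesis unfolding t1_def t2_def t3_def by linarith
qed

end

end

section \<open>Mean-square limits along partitions\<close>

text \<open>The triangle inequality in squared form, with factor 2 in place of roots. It speaks of
  differences only, since for the limits below nothing but their distance to approximations is known
  at first.\<close>

lemma square_dist_triangle:
  fixes f g h :: "'a \<Rightarrow> real"
  assumes "f \<in> borel_measurable M" "h \<in> borel_measurable M"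
    and fg: "integrable M (\<lambda>x. (f x - g x)\<^sup>2)" and gh: "integrable M (\<lambda>x. (g x - h x)\<^sup>2)"
  shows "integrable M (\<lambda>x. (f x - h x)\<^sup>2)"
    and "(\<integral>x. (f x - h x)\<^sup>2 \<partial>M) \<le> 2 * (\<integral>x. (f x - g x)\<^sup>2 \<partial>M) + 2 * (\<integral>x. (g x - h x)\<^sup>2 \<partial>M)"
proof -
  have le: "(f x - h x)\<^sup>2 \<le> 2 * (f x - g x)\<^sup>2 + 2 * (g x - h x)\<^sup>2" for x
    using sum_squares_bound[of "f x - g x" "g x - h x"] by (simp add: power2_eq_square algebra_simps)
  have int: "integrable M (\<lambda>x. 2 * (f x - g x)\<^sup>2 + 2 * (g x - h x)\<^sup>2)"
    using fg gh by simp
  show I: "integrable M (\<lambda>x. (f x - h x)\<^sup>2)"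
    by (rule Bochner_Integration.integrable_bound[OF int]) (use assms(1,2) le in \<open>auto intro!: AE_I2\<close>)
  have "(\<integral>x. (f x - h x)\<^sup>2 \<partial>M) \<le> (\<integral>x. 2 * (f x - g x)\<^sup>2 + 2 * (g x - h x)\<^sup>2 \<partial>M)"
    by (rule integral_mono[OF I int le])
  then show "(\<integral>x. (f x - h x)\<^sup>2 \<partial>M) \<le> 2 * (\<integral>x. (f x - g x)\<^sup>2 \<partial>M) + 2 * (\<integral>x. (g x - h x)\<^sup>2 \<partial>M)"
    using fg gh by simp
qed

lemma square_dist_commute: "(\<lambda>x. (f x - g x :: real)\<^sup>2) = (\<lambda>x. (g x - f x)\<^sup>2)"
  by (simp add: power2_commute)

text \<open>Replaces mean-square convergence where only almost everywhere convergence is at hand,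
  notably for products: a bound on second moments still passes to the limit.\<close>

lemma Fatou_square:
  fixes f :: "nat \<Rightarrow> 'a \<Rightarrow> real"
  assumes [measurable]: "\<And>n. f n \<in> borel_measurable M" "g \<in> borel_measurable M"
    and lim: "AE x in M. (\<lambda>n. f n x) \<longlonglongrightarrow> g x"
    and int: "\<And>n. integrable M (\<lambda>x. (f n x)\<^sup>2)" and le: "\<And>n. (\<integral>x. (f n x)\<^sup>2 \<partial>M) \<le> c n" and c: "c \<longlonglongrightarrow> C"
  shows "integrable M (\<lambda>x. (g x)\<^sup>2)" and "(\<integral>x. (g x)\<^sup>2 \<partial>M) \<le> C"
proof -
  have c0: "0 \<le> c n" for n using le[of n] by (rule order_trans[rotated]) simp
  have C0: "0 \<le> C" using c c0 by (meson LIMSEQ_le_const)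
  have "(\<integral>\<^sup>+x. ennreal ((g x)\<^sup>2) \<partial>M) = (\<integral>\<^sup>+x. liminf (\<lambda>n. ennreal ((f n x)\<^sup>2)) \<partial>M)"
  proof (rule nn_integral_cong_AE, use lim in eventually_elim)
    fix x assume "(\<lambda>n. f n x) \<longlonglongrightarrow> g x"
    then have "(\<lambda>n. ennreal ((f n x)\<^sup>2)) \<longlonglongrightarrow> ennreal ((g x)\<^sup>2)" by (intro tendsto_intros)
    then show "ennreal ((g x)\<^sup>2) = liminf (\<lambda>n. ennreal ((f n x)\<^sup>2))"
      by (intro lim_imp_Liminf[symmetric]) auto
  qed
  also have "\<dots> \<le> liminf (\<lambda>n. \<integral>\<^sup>+x. ennreal ((f n x)\<^sup>2) \<partial>M)"
    by (rule nn_integral_liminf) measurable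
  also have "\<dots> \<le> liminf (\<lambda>n. ennreal (c n))"
    by (intro Liminf_mono always_eventually allI) (simp add: nn_integral_eq_integral[OF int] ennreal_leI le)
  also have "\<dots> = ennreal C"
    using c by (intro lim_imp_Liminf) (auto intro!: tendsto_intros)
  finally have *: "(\<integral>\<^sup>+x. ennreal ((g x)\<^sup>2) \<partial>M) \<le> ennreal C" .
  then show I: "integrable M (\<lambda>x. (g x)\<^sup>2)"
    by (intro integrableI_nonneg) (auto simp: less_top[symmetric] top_unique)
  show "(\<integral>x. (g x)\<^sup>2 \<partial>M) \<le> C"
    using * C0 by (simp add: nn_integral_eq_integral[OF I])
qed

text \<open>The sum of the finitely many squared errors tends to 0 in L1, so one subsequence serves
  all indices simultaneously.\<close>

lemma L2_AE_subseq:
  fixes X :: "nat \<Rightarrow> 'i \<Rightarrow> 'a \<Rightarrow> real"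
  assumes "finite I" and int: "\<And>n i. i \<in> I \<Longrightarrow> integrable M (\<lambda>x. (X n i x - Y i x)\<^sup>2)"
    and lim: "\<And>i. i \<in> I \<Longrightarrow> (\<lambda>n. \<integral>x. (X n i x - Y i x)\<^sup>2 \<partial>M) \<longlonglongrightarrow> 0"
  obtains r :: "nat \<Rightarrow> nat" where "strict_mono r" "AE x in M. \<forall>i\<in>I. (\<lambda>n. X (r n) i x) \<longlonglongrightarrow> Y i x"
proof -
  define u where "u n x = (\<Sum>i\<in>I. (X n i x - Y i x)\<^sup>2)" for n x
  have u0: "0 \<le> u n x" for n x by (simp add: u_def sum_nonneg)
  have "\<exists>r::nat\<Rightarrow>nat. strict_mono r \<and> (AE x in M. (\<lambda>n. u (r n) x) \<longlonglongrightarrow> 0)"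
  proof (rule tendsto_L1_AE_subseq)
    show "integrable M (u n)" for n unfolding u_def using int by (intro Bochner_Integration.integrable_sum)
    have "(\<integral>x. norm (u n x) \<partial>M) = (\<Sum>i\<in>I. \<integral>x. (X n i x - Y i x)\<^sup>2 \<partial>M)" for n
      using u0 int by (simp add: u_def Bochner_Integration.integral_sum sum_nonneg)
    then show "(\<lambda>n. \<integral>x. norm (u n x) \<partial>M) \<longlonglongrightarrow> 0"
      using tendsto_sum[of I "\<lambda>i n. \<integral>x. (X n i x - Y i x)\<^sup>2 \<partial>M" "\<lambda>_. 0"] lim by simp
  qed
  then obtain r :: "nat \<Rightarrow> nat" where r: "strict_mono r" and AE: "AE x in M. (\<lambda>n. u (r n) x) \<longlonglongrightarrow> 0" by blast
  have "AE x in M. \<forall>i\<in>I. (\<lambda>n. X (r n) i x) \<longlonglongrightarrow> Y i x"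
    using AE
  proof eventually_elim
    fix x assume *: "(\<lambda>n. u (r n) x) \<longlonglongrightarrow> 0"
    show "\<forall>i\<in>I. (\<lambda>n. X (r n) i x) \<longlonglongrightarrow> Y i x"
    proof
      fix i assume i: "i \<in> I"
      have "(\<lambda>n. (X (r n) i x - Y i x)\<^sup>2) \<longlonglongrightarrow> 0"
        by (rule tendsto_sandwich[OF _ _ tendsto_const *])
           (use \<open>finite I\<close> i in \<open>auto simp: u_def intro!: always_eventually member_le_sum\<close>)
      then have "(\<lambda>n. sqrt ((X (r n) i x - Y i x)\<^sup>2)) \<longlonglongrightarrow> sqrt 0" by (intro tendsto_intros)
      then have "(\<lambda>n. X (r n) i x - Y i x) \<longlonglongrightarrow> 0" by (simp add: tendsto_rabs_zero_iff)
      then show "(\<lambda>n. X (r n) i x) \<longlonglongrightarrow> Y i x" by (rule LIM_zero_cancel)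
    qed
  qed
  with r show ?thesis using that by blast
qed

text \<open>The Riesz-Fischer argument. On a probability space the sequence is Cauchy in L1 as well,
  which yields a limit along a subsequence almost everywhere; Fatou turns the Cauchy bound into a
  bound on the distance to that limit.\<close>

lemma (in prob_space) L2_complete:
  fixes X :: "nat \<Rightarrow> 'a \<Rightarrow> real"
  assumes sq: "\<And>n. all_moments M (X n)"
    and cauchy: "\<And>e. e > 0 \<Longrightarrow> \<exists>N. \<forall>i\<ge>N. \<forall>j\<ge>N. (\<integral>x. (X i x - X j x)\<^sup>2 \<partial>M) < e"
  obtains Y where "Y \<in> borel_measurable M" "\<And>n. integrable M (\<lambda>x. (X n x - Y x)\<^sup>2)"
    "(\<lambda>n. \<integral>x. (X n x - Y x)\<^sup>2 \<partial>M) \<longlonglongrightarrow> 0"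
proof -
  have [measurable]: "X n \<in> borel_measurable M" for n using sq by (rule all_moments_measurable)
  have intd: "integrable M (\<lambda>x. (X i x - X j x)\<^sup>2)" "integrable M (\<lambda>x. X i x - X j x)" for i j
    by (intro all_moments_square_integrable all_moments_integrable all_moments_diff sq)+
  have L1: "\<exists>N. \<forall>i\<ge>N. \<forall>j\<ge>N. (\<integral>x. norm (X i x - X j x) \<partial>M) < e" if "e > 0" for e :: real
  proof -
    obtain N where N: "\<And>i j. i \<ge> N \<Longrightarrow> j \<ge> N \<Longrightarrow> (\<integral>x. (X i x - X j x)\<^sup>2 \<partial>M) < e\<^sup>2"
      using cauchy[OF zero_less_power[OF \<open>e > 0\<close>, of 2]] by blast
    have "(\<integral>x. norm (X i x - X j x) \<partial>M) < e" if ij: "i \<ge> N" "j \<ge> N" for i j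
    proof -
      \<comment> \<open>Young's inequality \<bar>d\<bar> \<le> (e + d^2 / e) / 2 instead of
        Cauchy-Schwarz; with the threshold e^2 for the squared distance it gives exactly e.\<close>
      have "(\<integral>x. norm (X i x - X j x) \<partial>M) \<le> (\<integral>x. (e + (X i x - X j x)\<^sup>2 / e) / 2 \<partial>M)"
      proof (rule integral_mono)
        show "norm (X i x - X j x) \<le> (e + (X i x - X j x)\<^sup>2 / e) / 2" for x
          using sum_squares_bound[of e "\<bar>X i x - X j x\<bar>"] \<open>e > 0\<close> by (simp add: field_simps power2_eq_square)
      qed (use intd in auto)
      also have "\<dots> = (e + (\<integral>x. (X i x - X j x)\<^sup>2 \<partial>M) / e) / 2"
        using intd by (simp add: prob_space)
      also have "\<dots> < (e + e\<^sup>2 / e) / 2"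
        using N[OF ij] \<open>e > 0\<close> by (intro divide_strict_right_mono add_strict_left_mono) auto
      also have "\<dots> = e" using \<open>e > 0\<close> by (simp add: power2_eq_square)
      finally show ?thesis .
    qed
    then show ?thesis by blast
  qed
  obtain r :: "nat \<Rightarrow> nat" where r: "strict_mono r" and AE: "AE x in M. Cauchy (\<lambda>i. X (r i) x)"
    by (rule cauchy_L1_AE_cauchy_subseq[of M X]) (use sq L1 in \<open>auto intro: all_moments_integrable\<close>)
  define Y where "Y x = lim (\<lambda>i. X (r i) x)" for x
  have Ym [measurable]: "Y \<in> borel_measurable M" unfolding Y_def[abs_def] by measurable
  have lim: "AE x in M. (\<lambda>i. X (r i) x) \<longlonglongrightarrow> Y x"
    using AE by eventually_elim (simp add: Y_def Cauchy_convergent_iff convergent_LIMSEQ_iff)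
  have key: "integrable M (\<lambda>x. (X n x - Y x)\<^sup>2) \<and> (\<integral>x. (X n x - Y x)\<^sup>2 \<partial>M) \<le> e"
    if "\<And>j. j \<ge> N \<Longrightarrow> (\<integral>x. (X n x - X j x)\<^sup>2 \<partial>M) \<le> e" for n N e
  proof -
    have rN: "r (i + N) \<ge> N" for i using seq_suble[OF r, of "i + N"] by simp
    have "AE x in M. (\<lambda>i. X n x - X (r (i + N)) x) \<longlonglongrightarrow> X n x - Y x"
      using lim by eventually_elim (intro tendsto_intros LIMSEQ_ignore_initial_segment)
    from Fatou_square[OF _ _ this intd(1), of "\<lambda>_. e" e] that[OF rN] show ?thesis by auto
  qed
  show ?thesis
  proof (rule that[OF Ym])
    have *: "\<exists>N. \<forall>n\<ge>N. (\<integral>x. (X n x - Y x)\<^sup>2 \<partial>M) \<le> e \<and> integrable M (\<lambda>x. (X n x - Y x)\<^sup>2)" if "e > 0" for e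
    proof -
      obtain N where "\<forall>i\<ge>N. \<forall>j\<ge>N. (\<integral>x. (X i x - X j x)\<^sup>2 \<partial>M) < e" using cauchy[OF \<open>e > 0\<close>] by blast
      then show ?thesis by (intro exI[of _ N] allI impI conjI conjunct1[OF key] conjunct2[OF key]) (auto intro: less_imp_le)
    qed
    obtain N where N: "integrable M (\<lambda>x. (X N x - Y x)\<^sup>2)" using *[of 1] by auto
    show "integrable M (\<lambda>x. (X n x - Y x)\<^sup>2)" for n
      by (rule square_dist_triangle(1)[OF _ _ intd(1) N]) measurable
    show "(\<lambda>n. \<integral>x. (X n x - Y x)\<^sup>2 \<partial>M) \<longlonglongrightarrow> 0"
    proof (rule LIMSEQ_I)
      fix e :: real assume "e > 0"
      then obtain N where "\<forall>n\<ge>N. (\<integral>x. (X n x - Y x)\<^sup>2 \<partial>M) \<le> e / 2" using *[of "e / 2"] by auto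
      then show "\<exists>N. \<forall>n\<ge>N. norm ((\<integral>x. (X n x - Y x)\<^sup>2 \<partial>M) - 0) < e"
        using \<open>e > 0\<close> by (intro exI[of _ N]) force
    qed
  qed
qed

section \<open>Partitions of small mesh, as sets and as sequences\<close>

definition uniform_partition :: "real \<Rightarrow> real \<Rightarrow> nat \<Rightarrow> real set" where
  "uniform_partition a b n = (\<lambda>k. a + real k * (b - a) / real (Suc n)) ` {..Suc n}"

lemma uniform_partition_of: "a \<le> b \<Longrightarrow> partition_of a b (uniform_partition a b n)"
proof -
  assume ab: "a \<le> b"
  define h where "h = (b - a) / real (Suc n)"
  have h: "0 \<le> h" "real (Suc n) * h = b - a" using ab by (simp_all add: h_def)
  have U: "uniform_partition a b n = (\<lambda>k. a + real k * h) ` {..Suc n}"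
    by (simp add: uniform_partition_def h_def)
  have le: "real k * h \<le> b - a" if "k \<le> Suc n" for k
    using mult_right_mono[of "real k" "real (Suc n)" h] that h by simp
  have "a \<in> uniform_partition a b n" unfolding U by (rule image_eqI[of _ _ 0]) auto
  moreover have "b \<in> uniform_partition a b n" unfolding U by (rule image_eqI[of _ _ "Suc n"]) (use h in auto)
  moreover have "uniform_partition a b n \<subseteq> {a..b}"
    unfolding U using h(1) le by (force simp del: of_nat_Suc)
  ultimately show ?thesis by (simp add: partition_of_def uniform_partition_def)
qed

lemma uniform_partition_mesh:
  assumes "a \<le> b" "(b - a) / real (Suc n) < d"
  shows "mesh_below b (uniform_partition a b n) d"
  unfolding mesh_below_def
proof
  let ?P = "uniform_partition a b n"
  fix u assume u: "u \<in> ?P - {b}"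
  then obtain k where k: "k \<le> Suc n" "u = a + real k * (b - a) / real (Suc n)" by (auto simp: uniform_partition_def)
  note P = uniform_partition_of[OF assms(1), of n]
  have uc: "u \<in> {a..<b}" using partition_cell[OF P u] .
  have "k \<noteq> Suc n" using k u by auto
  then have "a + real (Suc k) * (b - a) / real (Suc n) \<in> ?P"
    using k by (auto simp: uniform_partition_def simp del: of_nat_Suc)
  moreover have eq: "a + real (Suc k) * (b - a) / real (Suc n) = u + (b - a) / real (Suc n)"
    using k by (simp add: field_simps)
  moreover have "b - a > 0" using uc by auto
  ultimately have "hi ?P u \<le> u + (b - a) / real (Suc n)"
    using hi_le_iff[OF P uc] by (auto simp del: of_nat_Suc)
  then show "hi ?P u - u < d" using assms by simp
qed

lemma uniform_partition_eventually:
  assumes "a \<le> b" "d > 0"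
  shows "\<forall>\<^sub>F n in sequentially. mesh_below b (uniform_partition a b n) d"
proof -
  have "(\<lambda>n. (b - a) / real (Suc n)) \<longlonglongrightarrow> 0"
    using tendsto_mult[OF tendsto_const[of "b - a"] LIMSEQ_inverse_real_of_nat] by (simp add: divide_inverse)
  from order_tendstoD(2)[OF this assms(2)] show ?thesis
    by eventually_elim (rule uniform_partition_mesh[OF assms(1)])
qed

lemma fine_partition_less:
  assumes "fine_partition a b \<delta> n \<tau>" "j < k" "k \<le> n"
  shows "\<tau> j < \<tau> k"
  using assms(2,3)
proof (induction k)
  case (Suc k)
  have "\<tau> k < \<tau> (Suc k)" using assms(1) Suc.prems by (auto simp: fine_partition_def)
  then show ?case using Suc by (cases "j = k") auto
qed simp

text \<open>The bridge from the indexed partitions in the definition of the integrals to point sets: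
  mesh and sums carry over.\<close>

lemma fine_partition_set:
  assumes \<tau>: "fine_partition a b \<delta> n \<tau>"
  defines "P \<equiv> \<tau> ` {..n}"
  shows "partition_of a b P" "mesh_below b P \<delta>"
    "(\<Sum>k<n. f (\<tau> k) (\<tau> (Suc k))) = (\<Sum>u\<in>P - {b}. f u (hi P u) :: real)"
proof -
  note less = fine_partition_less[OF \<tau>]
  have le: "\<tau> j \<le> \<tau> k" if "j \<le> k" "k \<le> n" for j k using less[of j k] that by (cases "j = k") auto
  have ends: "\<tau> 0 = a" "\<tau> n = b" using \<tau> by (auto simp: fine_partition_def)
  show "partition_of a b P"
    using le[of 0] le[of _ n] ends by (auto simp: partition_of_def P_def)
  have inj: "inj_on \<tau> {..n}"
    by (rule inj_onI) (metis atMost_iff less less_irrefl linorder_neqE_nat)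
  have hi: "hi P (\<tau> k) = \<tau> (Suc k)" if "k < n" for k
    unfolding hi_def
  proof (rule Min_eqI)
    show "finite {w \<in> P. \<tau> k < w}" by (simp add: P_def)
    show "\<tau> (Suc k) \<in> {w \<in> P. \<tau> k < w}" using that less[of k "Suc k"] by (auto simp: P_def)
    fix w assume "w \<in> {w \<in> P. \<tau> k < w}"
    then obtain j where j: "j \<le> n" "w = \<tau> j" "\<tau> k < \<tau> j" by (auto simp: P_def)
    then have "k < j" using le[of j k] that by (cases "k < j") auto
    then show "\<tau> (Suc k) \<le> w" using le[of "Suc k" j] j by auto
  qed
  have Pb: "P - {b} = \<tau> ` {..<n}"
  proof -
    have "{..n} = insert n {..<n}" by auto
    then show ?thesis using less[of _ n] ends by (fastforce simp: P_def)
  qed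
  show "mesh_below b P \<delta>"
    using \<tau> hi by (auto simp: mesh_below_def Pb fine_partition_def)
  show "(\<Sum>k<n. f (\<tau> k) (\<tau> (Suc k))) = (\<Sum>u\<in>P - {b}. f u (hi P u) :: real)"
    unfolding Pb using inj hi by (subst sum.reindex) (auto intro: inj_on_subset)
qed

text \<open>Keeps the mesh limits from being vacuous, which their uniqueness depends on. In the
  degenerate case a = b the partition has no cell.\<close>

lemma fine_partition_exists:
  assumes "a \<le> b" "\<delta> > 0"
  shows "\<exists>n \<tau>. fine_partition a b \<delta> n \<tau>"
proof (cases "a = b")
  case True then show ?thesis
    by (intro exI[of _ 0] exI[of _ "\<lambda>_. a"]) (simp add: fine_partition_def)
next
  case False
  then have ab: "a < b" using assms by simp
  obtain n where n: "(b - a) / \<delta> < real n" using reals_Archimedean2 by blast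
  then have n0: "n > 0" using ab \<open>\<delta> > 0\<close> by (cases n) (auto simp: field_simps dest: less_trans)
  define h where "h = (b - a) / real n"
  have h: "0 < h" "h < \<delta>" "real n * h = b - a" using n n0 ab \<open>\<delta> > 0\<close> by (simp_all add: h_def field_simps)
  show ?thesis
    by (intro exI[of _ n] exI[of _ "\<lambda>k. a + real k * h"]) (use h in \<open>auto simp: fine_partition_def distrib_right\<close>)
qed

text \<open>The counterpart of \<open>is_mesh_limit\<close> in which partitions are point
  sets.\<close>

definition net_limit :: "'a measure \<Rightarrow> real \<Rightarrow> real \<Rightarrow> (real set \<Rightarrow> 'a \<Rightarrow> real) \<Rightarrow> ('a \<Rightarrow> real) \<Rightarrow> bool" where
  "net_limit M a b S I \<longleftrightarrow> I \<in> borel_measurable M \<and>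
     (\<forall>\<epsilon>>0. \<exists>\<delta>>0. \<forall>P. partition_of a b P \<longrightarrow> mesh_below b P \<delta> \<longrightarrow>
        integrable M (\<lambda>\<omega>. (S P \<omega> - I \<omega>)\<^sup>2) \<and> (LINT \<omega>|M. (S P \<omega> - I \<omega>)\<^sup>2) < \<epsilon>)"

lemma net_limitD:
  assumes "net_limit M a b S I" "\<epsilon> > 0"
  obtains \<delta> where "\<delta> > 0" "\<And>P. partition_of a b P \<Longrightarrow> mesh_below b P \<delta> \<Longrightarrow>
     integrable M (\<lambda>\<omega>. (S P \<omega> - I \<omega>)\<^sup>2) \<and> (LINT \<omega>|M. (S P \<omega> - I \<omega>)\<^sup>2) < \<epsilon>"
proof -
  obtain \<delta> where "\<delta> > 0 \<and> (\<forall>P. partition_of a b P \<longrightarrow> mesh_below b P \<delta> \<longrightarrow>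
     integrable M (\<lambda>\<omega>. (S P \<omega> - I \<omega>)\<^sup>2) \<and> (LINT \<omega>|M. (S P \<omega> - I \<omega>)\<^sup>2) < \<epsilon>)"
    using assms(1)[unfolded net_limit_def, THEN conjunct2, rule_format, OF assms(2)] by blast
  then show ?thesis by (intro that[of \<delta>]) auto
qed

text \<open>It is enough to compare a partition with its refinements: two fine partitions are linked
  through their union. The limit is taken along uniform partitions and then shown to be approached
  by all fine ones.\<close>

lemma (in prob_space) net_limit_exists:
  assumes ab: "a \<le> b" and mom: "\<And>P. partition_of a b P \<Longrightarrow> all_moments M (S P)"
    and cauchy: "\<And>e. e > 0 \<Longrightarrow> \<exists>d>0. \<forall>P R. partition_of a b P \<longrightarrow> partition_of a b R \<longrightarrow> P \<subseteq> R \<longrightarrow>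
       mesh_below b P d \<longrightarrow> (LINT \<omega>|M. (S P \<omega> - S R \<omega>)\<^sup>2) < e"
  shows "\<exists>I. net_limit M a b S I"
proof -
  let ?U = "uniform_partition a b"
  note U = uniform_partition_of[OF ab]
  have int: "integrable M (\<lambda>\<omega>. (S P \<omega> - S R \<omega>)\<^sup>2)" if "partition_of a b P" "partition_of a b R" for P R
    by (intro all_moments_square_integrable all_moments_diff mom that)
  have meas: "S P \<in> borel_measurable M" if "partition_of a b P" for P
    using mom[OF that] by (rule all_moments_measurable)
  have close: "\<exists>d>0. \<forall>P Q. partition_of a b P \<longrightarrow> partition_of a b Q \<longrightarrow> mesh_below b P d \<longrightarrow>
     mesh_below b Q d \<longrightarrow> (LINT \<omega>|M. (S P \<omega> - S Q \<omega>)\<^sup>2) < e" if "e > 0" for e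
  proof -
    \<comment> \<open>Two comparisons at e / 4, each doubled by the squared triangle inequality, add
      up to e.\<close>
    obtain d where d: "d > 0" "\<And>P R. partition_of a b P \<Longrightarrow> partition_of a b R \<Longrightarrow> P \<subseteq> R \<Longrightarrow>
       mesh_below b P d \<Longrightarrow> (LINT \<omega>|M. (S P \<omega> - S R \<omega>)\<^sup>2) < e / 4" using cauchy[of "e / 4", OF divide_pos_pos[OF \<open>e > 0\<close>]]
      by auto
    have "(LINT \<omega>|M. (S P \<omega> - S Q \<omega>)\<^sup>2) < e"
      if P: "partition_of a b P" "mesh_below b P d" and Q: "partition_of a b Q" "mesh_below b Q d" for P Q
    proof -
      have R: "partition_of a b (P \<union> Q)" using P Q by (intro partition_Un)
      have "(LINT \<omega>|M. (S P \<omega> - S Q \<omega>)\<^sup>2) \<le> 2 * (LINT \<omega>|M. (S P \<omega> - S (P \<union> Q) \<omega>)\<^sup>2)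
         + 2 * (LINT \<omega>|M. (S (P \<union> Q) \<omega> - S Q \<omega>)\<^sup>2)"
        using P Q R by (intro square_dist_triangle(2) int meas)
      also have "(LINT \<omega>|M. (S (P \<union> Q) \<omega> - S Q \<omega>)\<^sup>2) = (LINT \<omega>|M. (S Q \<omega> - S (P \<union> Q) \<omega>)\<^sup>2)"
        by (subst square_dist_commute) simp
      finally show ?thesis using d(2)[OF P(1) R _ P(2)] d(2)[OF Q(1) R _ Q(2)] by auto
    qed
    then show ?thesis using d(1) by blast
  qed
  have "\<exists>N. \<forall>i\<ge>N. \<forall>j\<ge>N. (LINT \<omega>|M. (S (?U i) \<omega> - S (?U j) \<omega>)\<^sup>2) < e" if "e > 0" for e
  proof -
    obtain d where d: "d > 0" "\<And>P Q. partition_of a b P \<Longrightarrow> partition_of a b Q \<Longrightarrow> mesh_below b P d \<Longrightarrow>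
       mesh_below b Q d \<Longrightarrow> (LINT \<omega>|M. (S P \<omega> - S Q \<omega>)\<^sup>2) < e" using close[OF \<open>e > 0\<close>] by blast
    obtain N where "\<And>n. n \<ge> N \<Longrightarrow> mesh_below b (?U n) d"
      using uniform_partition_eventually[OF ab d(1)] by (auto simp: eventually_sequentially)
    then show ?thesis by (intro exI[of _ N] allI impI d(2) U)
  qed
  then obtain Y where Y: "Y \<in> borel_measurable M" "\<And>n. integrable M (\<lambda>x. (S (?U n) x - Y x)\<^sup>2)"
    "(\<lambda>n. LINT x|M. (S (?U n) x - Y x)\<^sup>2) \<longlonglongrightarrow> 0"
    by (rule L2_complete[of "\<lambda>n. S (?U n)", OF mom[OF U]]) blast+
  have "net_limit M a b S Y"
    unfolding net_limit_def
  proof (intro conjI allI impI Y(1))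
    fix e :: real assume "e > 0"
    obtain d where d: "d > 0" "\<And>P Q. partition_of a b P \<Longrightarrow> partition_of a b Q \<Longrightarrow> mesh_below b P d \<Longrightarrow>
       mesh_below b Q d \<Longrightarrow> (LINT \<omega>|M. (S P \<omega> - S Q \<omega>)\<^sup>2) < e / 4" using close[of "e / 4", OF divide_pos_pos[OF \<open>e > 0\<close>]] by auto
    have "\<forall>\<^sub>F n in sequentially. mesh_below b (?U n) d \<and> (LINT x|M. (S (?U n) x - Y x)\<^sup>2) < e / 4"
      using uniform_partition_eventually[OF ab d(1)] order_tendstoD(2)[OF Y(3), of "e / 4"] \<open>e > 0\<close>
      by (auto simp: eventually_conj_iff)
    then obtain n where n: "mesh_below b (?U n) d" "(LINT x|M. (S (?U n) x - Y x)\<^sup>2) < e / 4"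
      by (auto simp: eventually_sequentially)
    show "\<exists>\<delta>>0. \<forall>P. partition_of a b P \<longrightarrow> mesh_below b P \<delta> \<longrightarrow>
        integrable M (\<lambda>\<omega>. (S P \<omega> - Y \<omega>)\<^sup>2) \<and> (LINT \<omega>|M. (S P \<omega> - Y \<omega>)\<^sup>2) < e"
    proof (intro exI[of _ d] conjI allI impI d(1))
      fix P assume P: "partition_of a b P" "mesh_below b P d"
      show "integrable M (\<lambda>\<omega>. (S P \<omega> - Y \<omega>)\<^sup>2)"
        by (rule square_dist_triangle(1)[OF meas[OF P(1)] Y(1) int[OF P(1) U] Y(2)])
      show "(LINT \<omega>|M. (S P \<omega> - Y \<omega>)\<^sup>2) < e"
        using square_dist_triangle(2)[OF meas[OF P(1)] Y(1) int[OF P(1) U] Y(2)[of n]] n(2)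
          d(2)[OF P(1) U P(2) n(1)] by linarith
    qed
  qed
  then show ?thesis by blast
qed

lemma AE_eq_if_square_dist_zero:
  fixes f g :: "'a \<Rightarrow> real"
  assumes "integrable M (\<lambda>x. (f x - g x)\<^sup>2)" "\<And>e. e > 0 \<Longrightarrow> (LINT x|M. (f x - g x)\<^sup>2) \<le> e"
  shows "AE x in M. f x = g x"
proof -
  have "(LINT x|M. (f x - g x)\<^sup>2) \<le> 0" by (rule field_le_epsilon) (use assms in auto)
  moreover have "0 \<le> (LINT x|M. (f x - g x)\<^sup>2)" by simp
  ultimately have "(LINT x|M. (f x - g x)\<^sup>2) = 0" by simp
  then have "AE x in M. (f x - g x)\<^sup>2 = 0" using integral_nonneg_eq_0_iff_AE[OF assms(1)] by simp
  then show ?thesis by eventually_elim simp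
qed

text \<open>One partition fine enough for both limits makes their squared distance arbitrarily
  small. Equality almost everywhere is all that a mean-square limit can have, and all that later
  steps use about the chosen version.\<close>

lemma mesh_limit_unique:
  assumes "a \<le> b" "is_mesh_limit M a b S I" "is_mesh_limit M a b S J"
  shows "AE x in M. I x = J x"
proof -
  have meas: "I \<in> borel_measurable M" "J \<in> borel_measurable M" using assms by (auto simp: is_mesh_limit_def)
  have *: "integrable M (\<lambda>x. (I x - J x)\<^sup>2) \<and> (LINT x|M. (I x - J x)\<^sup>2) \<le> e" if "e > 0" for e
  proof -
    have e4: "e / 4 > 0" using that by simp
    obtain d1 where d1: "d1 > 0" "\<forall>n \<tau>. fine_partition a b d1 n \<tau> \<longrightarrow>
        integrable M (\<lambda>\<omega>. (S n \<tau> \<omega> - I \<omega>)\<^sup>2) \<and> (LINT \<omega>|M. (S n \<tau> \<omega> - I \<omega>)\<^sup>2) < e / 4"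
      using assms(2) e4 unfolding is_mesh_limit_def by blast
    obtain d2 where d2: "d2 > 0" "\<forall>n \<tau>. fine_partition a b d2 n \<tau> \<longrightarrow>
        integrable M (\<lambda>\<omega>. (S n \<tau> \<omega> - J \<omega>)\<^sup>2) \<and> (LINT \<omega>|M. (S n \<tau> \<omega> - J \<omega>)\<^sup>2) < e / 4"
      using assms(3) e4 unfolding is_mesh_limit_def by blast
    obtain n \<tau> where "fine_partition a b (min d1 d2) n \<tau>"
      using fine_partition_exists[OF assms(1), of "min d1 d2"] d1 d2 by auto
    then have f: "fine_partition a b d1 n \<tau>" "fine_partition a b d2 n \<tau>" by (auto simp: fine_partition_def)
    have 1: "integrable M (\<lambda>\<omega>. (I \<omega> - S n \<tau> \<omega>)\<^sup>2)" "(LINT \<omega>|M. (I \<omega> - S n \<tau> \<omega>)\<^sup>2) < e / 4"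
      using d1(2) f(1) square_dist_commute[of I "S n \<tau>"] by simp_all
    have 2: "integrable M (\<lambda>\<omega>. (S n \<tau> \<omega> - J \<omega>)\<^sup>2)" "(LINT \<omega>|M. (S n \<tau> \<omega> - J \<omega>)\<^sup>2) < e / 4"
      using d2(2) f(2) by auto
    show ?thesis using square_dist_triangle[OF meas 1(1) 2(1)] 1 2 by linarith
  qed
  show ?thesis by (rule AE_eq_if_square_dist_zero) (use *[of 1] * in auto)
qed

text \<open>Identifies the chosen version with a limit known to exist. The sums S' need to agree
  with S only almost everywhere, because in an iterated integral their integrands are themselves
  chosen versions.\<close>

lemma net_limit_SOME:
  assumes ab: "a \<le> b" and lim: "net_limit M a b S I"
    and meas: "\<And>\<delta> n \<tau>. fine_partition a b \<delta> n \<tau> \<Longrightarrow> S' n \<tau> \<in> borel_measurable M"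
    and eq: "\<And>\<delta> n \<tau>. fine_partition a b \<delta> n \<tau> \<Longrightarrow> AE \<omega> in M. S' n \<tau> \<omega> = S (\<tau> ` {..n}) \<omega>"
    and measS: "\<And>P. partition_of a b P \<Longrightarrow> S P \<in> borel_measurable M"
  shows "(SOME I. is_mesh_limit M a b S' I) \<in> borel_measurable M"
    and "AE \<omega> in M. (SOME I. is_mesh_limit M a b S' I) \<omega> = I \<omega>"
proof -
  have Im: "I \<in> borel_measurable M" using lim by (simp add: net_limit_def)
  have L: "is_mesh_limit M a b S' I"
    unfolding is_mesh_limit_def
  proof (intro conjI allI impI Im)
    fix e :: real assume "e > 0"
    then obtain d where d: "d > 0" "\<And>P. partition_of a b P \<Longrightarrow> mesh_below b P d \<Longrightarrow>
       integrable M (\<lambda>\<omega>. (S P \<omega> - I \<omega>)\<^sup>2) \<and> (LINT \<omega>|M. (S P \<omega> - I \<omega>)\<^sup>2) < e"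
      using net_limitD[OF lim] by blast
    show "\<exists>\<delta>>0. \<forall>n \<tau>. fine_partition a b \<delta> n \<tau> \<longrightarrow>
        integrable M (\<lambda>\<omega>. (S' n \<tau> \<omega> - I \<omega>)\<^sup>2) \<and> (LINT \<omega>|M. (S' n \<tau> \<omega> - I \<omega>)\<^sup>2) < e"
    proof (intro exI[of _ d] conjI allI impI d(1))
      fix n \<tau> assume f: "fine_partition a b d n \<tau>"
      note p = fine_partition_set(1,2)[OF f]
      have [measurable]: "S' n \<tau> \<in> borel_measurable M" "S (\<tau> ` {..n}) \<in> borel_measurable M" "I \<in> borel_measurable M"
        using meas[OF f] measS[OF p(1)] Im by auto
      have AE: "AE \<omega> in M. (S' n \<tau> \<omega> - I \<omega>)\<^sup>2 = (S (\<tau> ` {..n}) \<omega> - I \<omega>)\<^sup>2"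
        using eq[OF f] by eventually_elim simp
      show "integrable M (\<lambda>\<omega>. (S' n \<tau> \<omega> - I \<omega>)\<^sup>2)"
        using integrable_cong_AE[OF _ _ AE] d(2)[OF p] by simp
      show "(LINT \<omega>|M. (S' n \<tau> \<omega> - I \<omega>)\<^sup>2) < e"
        using integral_cong_AE[OF _ _ AE] d(2)[OF p] by simp
    qed
  qed
  have "is_mesh_limit M a b S' (SOME I. is_mesh_limit M a b S' I)" by (rule someI[of "is_mesh_limit M a b S'", OF L])
  then show "(SOME I. is_mesh_limit M a b S' I) \<in> borel_measurable M"
    "AE \<omega> in M. (SOME I. is_mesh_limit M a b S' I) \<omega> = I \<omega>"
    using mesh_limit_unique[OF ab _ L] by (auto simp: is_mesh_limit_def)
qed

section \<open>Discretised stochastic integrals\<close>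

lemma net_limit_cong_AE:
  assumes lim: "net_limit M a b S I" and AE: "AE \<omega> in M. I \<omega> = J \<omega>" and J: "J \<in> borel_measurable M"
    and S: "\<And>P. partition_of a b P \<Longrightarrow> S P \<in> borel_measurable M"
  shows "net_limit M a b S J"
  unfolding net_limit_def
proof (intro conjI allI impI J)
  fix e :: real assume "e > 0"
  then obtain d where d: "d > 0" "\<And>P. partition_of a b P \<Longrightarrow> mesh_below b P d \<Longrightarrow>
       integrable M (\<lambda>\<omega>. (S P \<omega> - I \<omega>)\<^sup>2) \<and> (LINT \<omega>|M. (S P \<omega> - I \<omega>)\<^sup>2) < e"
    using net_limitD[OF lim] by blast
  have I: "I \<in> borel_measurable M" using lim by (simp add: net_limit_def)
  show "\<exists>\<delta>>0. \<forall>P. partition_of a b P \<longrightarrow> mesh_below b P \<delta> \<longrightarrow>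
        integrable M (\<lambda>\<omega>. (S P \<omega> - J \<omega>)\<^sup>2) \<and> (LINT \<omega>|M. (S P \<omega> - J \<omega>)\<^sup>2) < e"
  proof (intro exI[of _ d] conjI allI impI d(1))
    fix P assume P: "partition_of a b P" "mesh_below b P d"
    have [measurable]: "S P \<in> borel_measurable M" "I \<in> borel_measurable M" "J \<in> borel_measurable M"
      using S[OF P(1)] I J by auto
    have AE': "AE \<omega> in M. (S P \<omega> - J \<omega>)\<^sup>2 = (S P \<omega> - I \<omega>)\<^sup>2"
      using AE by eventually_elim simp
    show "integrable M (\<lambda>\<omega>. (S P \<omega> - J \<omega>)\<^sup>2)"
      using integrable_cong_AE[OF _ _ AE'] d(2)[OF P] by simp
    show "(LINT \<omega>|M. (S P \<omega> - J \<omega>)\<^sup>2) < e"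
      using integral_cong_AE[OF _ _ AE'] d(2)[OF P] by simp
  qed
qed

lemma net_limit_uniform:
  assumes lim: "net_limit M a b S I" and "a \<le> b"
  shows "\<forall>\<^sub>F n in sequentially. integrable M (\<lambda>\<omega>. (S (uniform_partition a b n) \<omega> - I \<omega>)\<^sup>2)"
    and "(\<lambda>n. LINT \<omega>|M. (S (uniform_partition a b n) \<omega> - I \<omega>)\<^sup>2) \<longlonglongrightarrow> 0"
proof -
  have *: "\<forall>\<^sub>F n in sequentially. integrable M (\<lambda>\<omega>. (S (uniform_partition a b n) \<omega> - I \<omega>)\<^sup>2) \<and>
     (LINT \<omega>|M. (S (uniform_partition a b n) \<omega> - I \<omega>)\<^sup>2) < e" if e: "e > 0" for e
  proof -
    obtain d where d: "d > 0" "\<And>P. partition_of a b P \<Longrightarrow> mesh_below b P d \<Longrightarrow>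
       integrable M (\<lambda>\<omega>. (S P \<omega> - I \<omega>)\<^sup>2) \<and> (LINT \<omega>|M. (S P \<omega> - I \<omega>)\<^sup>2) < e"
      using net_limitD[OF lim e] by blast
    show ?thesis using uniform_partition_eventually[OF \<open>a \<le> b\<close> d(1)]
      by eventually_elim (rule d(2)[OF uniform_partition_of[OF \<open>a \<le> b\<close>]])
  qed
  show "\<forall>\<^sub>F n in sequentially. integrable M (\<lambda>\<omega>. (S (uniform_partition a b n) \<omega> - I \<omega>)\<^sup>2)"
    using *[of 1] by (auto elim: eventually_mono)
  show "(\<lambda>n. LINT \<omega>|M. (S (uniform_partition a b n) \<omega> - I \<omega>)\<^sup>2) \<longlonglongrightarrow> 0"
  proof (rule order_tendstoI)
    show "\<forall>\<^sub>F n in sequentially. e < (LINT \<omega>|M. (S (uniform_partition a b n) \<omega> - I \<omega>)\<^sup>2)" if "e < 0" for e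
      using that by (intro always_eventually allI) (auto intro: less_le_trans)
    show "\<forall>\<^sub>F n in sequentially. (LINT \<omega>|M. (S (uniform_partition a b n) \<omega> - I \<omega>)\<^sup>2) < e" if "0 < e" for e
      using *[OF that] by (auto elim: eventually_mono)
  qed
qed

text \<open>An integral up to a partition point v is approximated with the part of the partition
  left of v, which keeps the cells and the mesh.\<close>

lemma partition_restrict:
  assumes P: "partition_of a b P" and v: "v \<in> P"
  shows "partition_of a v (P \<inter> {..v})"
    and "P \<inter> {..v} - {v} = {w\<in>P - {b}. w < v}"
    and "w \<in> P \<Longrightarrow> w < v \<Longrightarrow> hi (P \<inter> {..v}) w = hi P w"
    and "mesh_below b P d \<Longrightarrow> mesh_below v (P \<inter> {..v}) d"
proof -
  show 1: "partition_of a v (P \<inter> {..v})" using assms by (auto simp: partition_of_def)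
  show 2: "P \<inter> {..v} - {v} = {w\<in>P - {b}. w < v}" using assms by (auto simp: partition_of_def)
  show 3: "hi (P \<inter> {..v}) w = hi P w" if w: "w \<in> P" "w < v" for w
  proof (rule antisym)
    have c: "w \<in> {a..<b}" "w \<in> {a..<v}" using w assms by (auto simp: partition_of_def)
    have "hi P w \<le> v" using hi_le_iff[OF P c(1) v] w by simp
    then show "hi (P \<inter> {..v}) w \<le> hi P w"
      using hi_le_iff[OF 1 c(2), of "hi P w"] hi_mem[OF P c(1)] less_hi[OF P c(1)] by auto
    show "hi P w \<le> hi (P \<inter> {..v}) w"
      using hi_le_iff[OF P c(1), of "hi (P \<inter> {..v}) w"] hi_mem[OF 1 c(2)] less_hi[OF 1 c(2)] by auto
  qed
  show "mesh_below b P d \<Longrightarrow> mesh_below v (P \<inter> {..v}) d"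
    unfolding mesh_below_def 2 using 3 by auto
qed

context wiener
begin

lemma all_moments_prob_const: "all_moments M (\<lambda>_. c)"
  by (rule all_moments_const) unfold_locales

lemma all_moments_prob_sum: "(\<And>i. i \<in> J \<Longrightarrow> all_moments M (f i)) \<Longrightarrow> all_moments M (\<lambda>x. \<Sum>i\<in>J. f i x)"
  by (rule all_moments_sum) unfold_locales

lemmas moments_intros = all_moments_prob_sum all_moments_mult all_moments_cmult all_moments_dW all_moments_prob_const

section \<open>First-level integrals: deterministic integrands and the constant integrand\<close>

definition ito_sum :: "(real \<Rightarrow> real) \<Rightarrow> nat \<Rightarrow> real \<Rightarrow> real set \<Rightarrow> 'a \<Rightarrow> real" where
  "ito_sum g i b P \<omega> = (\<Sum>u\<in>P - {b}. g u * dW i P u \<omega>)"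

lemma ito_sum_refine:
  assumes "partition_of a b P" "partition_of a b R" "P \<subseteq> R"
  shows "ito_sum g i b P \<omega> = (\<Sum>r\<in>R - {b}. g (lo P r) * dW i R r \<omega>)"
  using sum_refine[OF assms, of g "\<lambda>s. W i s \<omega>"] by (simp add: ito_sum_def dW_def)

lemma all_moments_ito_sum:
  assumes "partition_of a b P" "0 \<le> a" "b \<le> T" "i \<in> {1..m}"
  shows "all_moments M (ito_sum g i b P)"
  unfolding ito_sum_def[abs_def] using assms by (intro moments_intros)

text \<open>By \<open>linear_form_moment\<close>, refining a partition changes the sum by the
  weighted squares of g at the left cell end minus g; uniform continuity makes this small.\<close>

lemma ito_net_limit:
  assumes ab: "0 \<le> a" "a < b" "b \<le> T" and i: "i \<in> {1..m}" and g: "continuous_on {a..b} g"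
  shows "net_limit M a b (ito_sum g i b) (ito_integral M g (W i) a b)"
proof -
  have mom: "all_moments M (ito_sum g i b P)" if "partition_of a b P" for P
    using all_moments_ito_sum[OF that ab(1,3) i] .
  have "\<exists>I. net_limit M a b (ito_sum g i b) I"
  proof (rule net_limit_exists[OF less_imp_le[OF ab(2)] mom])
    fix e :: real assume "e > 0"
    \<comment> \<open>Chosen such that an oscillation below \<eta> costs at most \<eta>^2 (b - a) =
      e / 2.\<close>
    define \<eta> where "\<eta> = sqrt (e / (2 * (b - a)))"
    have "\<eta>\<^sup>2 = e / 2 / (b - a)" using \<open>e > 0\<close> ab by (simp add: \<eta>_def)
    then have "\<eta>\<^sup>2 * (b - a) = e / 2" using ab by (subst (asm) nonzero_eq_divide_eq) auto
    then have eta: "\<eta> > 0" "\<eta>\<^sup>2 * (b - a) < e" using \<open>e > 0\<close> ab by (simp_all only: \<eta>_def) auto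
    have "uniformly_continuous_on {a..b} g" by (rule compact_uniformly_continuous[OF g]) simp
    then obtain d where d: "d > 0" "\<And>x y. x \<in> {a..b} \<Longrightarrow> y \<in> {a..b} \<Longrightarrow> dist y x < d \<Longrightarrow> dist (g y) (g x) < \<eta>"
      using eta(1) unfolding uniformly_continuous_on_def by metis
    show "\<exists>d>0. \<forall>P R. partition_of a b P \<longrightarrow> partition_of a b R \<longrightarrow> P \<subseteq> R \<longrightarrow> mesh_below b P d \<longrightarrow>
       expectation (\<lambda>\<omega>. (ito_sum g i b P \<omega> - ito_sum g i b R \<omega>)\<^sup>2) < e"
    proof (intro exI[of _ d] conjI allI impI d(1))
      fix P R assume P: "partition_of a b P" and R: "partition_of a b R" and PR: "P \<subseteq> R" and m: "mesh_below b P d"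
      have "ito_sum g i b P \<omega> - ito_sum g i b R \<omega> = (\<Sum>r\<in>R - {b}. (g (lo P r) - g r) * dW i R r \<omega>)" for \<omega>
        unfolding ito_sum_refine[OF P R PR] by (simp add: ito_sum_def sum_subtractf left_diff_distrib)
      then have "expectation (\<lambda>\<omega>. (ito_sum g i b P \<omega> - ito_sum g i b R \<omega>)\<^sup>2)
         = (\<Sum>r\<in>R - {b}. (hi R r - r) * (g (lo P r) - g r)\<^sup>2)"
        using linear_form_moment[OF R ab(1,3) i] by simp
      also have "\<dots> \<le> (\<Sum>r\<in>R - {b}. (hi R r - r) * \<eta>\<^sup>2)"
      proof (intro sum_mono mult_left_mono)
        fix r assume r: "r \<in> R - {b}"
        have rc: "r \<in> {a..<b}" using partition_cell[OF R r] .
        have "dist (lo P r) r < d" using lo_le[OF P rc] less_hi[OF P rc] mesh_cell[OF P rc m] by (simp add: dist_real_def)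
        then have "dist (g (lo P r)) (g r) < \<eta>" using d(2)[of r "lo P r"] rc lo_less_b(2)[OF P rc] by auto
        then show "(g (lo P r) - g r)\<^sup>2 \<le> \<eta>\<^sup>2"
          by (simp add: dist_real_def abs_le_square_iff[symmetric])
        show "0 \<le> hi R r - r" using cell_length_pos[OF R r] by simp
      qed
      also have "\<dots> = \<eta>\<^sup>2 * (b - a)"
        using sum_cell_lengths[OF R] by (simp add: sum_distrib_right[symmetric])
      also have "\<dots> < e" by (rule eta(2))
      finally show "expectation (\<lambda>\<omega>. (ito_sum g i b P \<omega> - ito_sum g i b R \<omega>)\<^sup>2) < e" .
    qed
  qed
  then obtain I where I: "net_limit M a b (ito_sum g i b) I" by blast
  have meas: "ito_sum g i b P \<in> borel_measurable M" if "partition_of a b P" for P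
    using mom[OF that] by (rule all_moments_measurable)
  have eq: "(\<Sum>k<n. g (\<tau> k) * (W i (\<tau> (Suc k)) \<omega> - W i (\<tau> k) \<omega>)) = ito_sum g i b (\<tau> ` {..n}) \<omega>"
    if "fine_partition a b \<delta> n \<tau>" for \<delta> n \<tau> \<omega>
    using fine_partition_set(3)[OF that, of "\<lambda>u v. g u * (W i v \<omega> - W i u \<omega>)"] by (simp add: ito_sum_def dW_def)
  have *: "ito_integral M g (W i) a b \<in> borel_measurable M" "AE \<omega> in M. ito_integral M g (W i) a b \<omega> = I \<omega>"
    unfolding ito_integral_def
    by (rule net_limit_SOME[OF less_imp_le[OF ab(2)] I]; simp add: eq meas fine_partition_set(1) cong: measurable_cong)+
  show ?thesis
    by (rule net_limit_cong_AE[OF I _ *(1) meas]) (use *(2) in auto)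
qed

text \<open>With integrand 1 every sum telescopes to the same increment, so there is nothing to
  converge.\<close>

lemma strat_const:
  assumes "0 \<le> a" "a \<le> s" "s \<le> T" and i: "i \<in> {1..m}"
  shows "strat_integral M (\<lambda>_ _. 1) (W i) a s \<in> borel_measurable M"
    and "AE \<omega> in M. strat_integral M (\<lambda>_ _. 1) (W i) a s \<omega> = W i s \<omega> - W i a \<omega>"
proof -
  let ?S = "\<lambda>(P::real set) \<omega>. W i s \<omega> - W i a \<omega>"
  have m: "(\<lambda>\<omega>. W i s \<omega> - W i a \<omega>) \<in> borel_measurable M"
    using assms by (intro borel_measurable_diff W_measurable) auto
  have lim: "net_limit M a s ?S (\<lambda>\<omega>. W i s \<omega> - W i a \<omega>)"
    using m by (auto simp: net_limit_def)
  have eq: "(\<Sum>k<n. (1 + 1) / 2 * (W i (\<tau> (Suc k)) \<omega> - W i (\<tau> k) \<omega>)) = W i s \<omega> - W i a \<omega>"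
    if "fine_partition a s \<delta> n \<tau>" for \<delta> n \<tau> \<omega>
    using that sum_lessThan_telescope[of "\<lambda>k. W i (\<tau> k) \<omega>" n] by (simp add: fine_partition_def)
  show "strat_integral M (\<lambda>_ _. 1) (W i) a s \<in> borel_measurable M"
    "AE \<omega> in M. strat_integral M (\<lambda>_ _. 1) (W i) a s \<omega> = W i s \<omega> - W i a \<omega>"
    unfolding strat_integral_def
    by (rule net_limit_SOME[OF assms(2) lim]; simp add: eq[simplified] m cong: measurable_cong)+
qed

text \<open>The trapezoidal sum of the second level, with the inner integral already replaced by the
  increment to which it is equal almost everywhere.\<close>

definition strat_sum2 :: "nat \<Rightarrow> nat \<Rightarrow> real \<Rightarrow> real \<Rightarrow> real set \<Rightarrow> 'a \<Rightarrow> real" where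
  "strat_sum2 i j a b P \<omega> = (\<Sum>u\<in>P - {b}. ((W i u \<omega> + W i (hi P u) \<omega>) / 2 - W i a \<omega>) * dW j P u \<omega>)"

text \<open>The origin of \<open>trapez\<close>: the two end values of a cell are telescoping sums
  with cut-off at \<open>lo P y\<close> and \<open>hi P y\<close>, and the trapezoidal rule averages
  the cut-offs.\<close>

lemma midpoint_expand:
  assumes P: "partition_of a b P" and R: "partition_of a b R" and PR: "P \<subseteq> R" and y: "y \<in> {a..<b}"
  shows "(W i (lo P y) \<omega> + W i (hi P y) \<omega>) / 2 - W i a \<omega> = (\<Sum>x\<in>R - {b}. trapez P x y * dW i R x \<omega>)"
proof -
  have sum: "(\<Sum>x\<in>R - {b}. trapez P x y * dW i R x \<omega>) =
    ((\<Sum>x\<in>R - {b}. (if x < lo P y then 1 else 0) * dW i R x \<omega>) + (\<Sum>x\<in>R - {b}. (if x < hi P y then 1 else 0) * dW i R x \<omega>)) / 2"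
    by (simp add: trapez_def sum.distrib[symmetric] sum_divide_distrib add_divide_distrib distrib_right)
  have "(\<Sum>x\<in>R - {b}. (if x < v then 1 else 0) * dW i R x \<omega>) = W i v \<omega> - W i a \<omega>" if "v \<in> P" for v
    using sum_telescope_from_left[OF R, of v "\<lambda>s. W i s \<omega>"] that PR unfolding dW_def by blast
  from this[OF lo_mem[OF P y]] this[OF hi_mem[OF P y]] show ?thesis unfolding sum by (simp add: field_simps)
qed

lemma strat_sum2_refine:
  assumes P: "partition_of a b P" and R: "partition_of a b R" and PR: "P \<subseteq> R"
  shows "strat_sum2 i j a b P \<omega> = (\<Sum>x\<in>R - {b}. \<Sum>y\<in>R - {b}. trapez P x y * dW i R x \<omega> * dW j R y \<omega>)"
proof -
  have "strat_sum2 i j a b P \<omega> = (\<Sum>y\<in>R - {b}. ((W i (lo P y) \<omega> + W i (hi P (lo P y)) \<omega>) / 2 - W i a \<omega>) * dW j R y \<omega>)"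
    using sum_refine[OF assms, of "\<lambda>u. (W i u \<omega> + W i (hi P u) \<omega>) / 2 - W i a \<omega>" "\<lambda>s. W j s \<omega>"]
    by (simp add: strat_sum2_def dW_def)
  also have "\<dots> = (\<Sum>y\<in>R - {b}. \<Sum>x\<in>R - {b}. trapez P x y * dW i R x \<omega> * dW j R y \<omega>)"
  proof (rule sum.cong[OF refl])
    fix y assume y: "y \<in> R - {b}"
    have yc: "y \<in> {a..<b}" using partition_cell[OF R y] .
    show "((W i (lo P y) \<omega> + W i (hi P (lo P y)) \<omega>) / 2 - W i a \<omega>) * dW j R y \<omega>
       = (\<Sum>x\<in>R - {b}. trapez P x y * dW i R x \<omega> * dW j R y \<omega>)"
      unfolding hi_lo[OF P yc] midpoint_expand[OF P R PR yc] sum_distrib_right ..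
  qed
  also have "\<dots> = (\<Sum>x\<in>R - {b}. \<Sum>y\<in>R - {b}. trapez P x y * dW i R x \<omega> * dW j R y \<omega>)" by (rule sum.swap)
  finally show ?thesis .
qed

lemma all_moments_strat_sum2:
  assumes P: "partition_of a b P" and "0 \<le> a" "b \<le> T" "i \<in> {1..m}" "j \<in> {1..m}"
  shows "all_moments M (strat_sum2 i j a b P)"
proof -
  have "strat_sum2 i j a b P = (\<lambda>\<omega>. \<Sum>x\<in>P - {b}. \<Sum>y\<in>P - {b}. trapez P x y * dW i P x \<omega> * dW j P y \<omega>)"
    using strat_sum2_refine[OF P P order.refl] by auto
  then show ?thesis using assms by (auto intro!: moments_intros)
qed

text \<open>The kernels for P and R differ by at most 1/2, and only where both variables share a
  P-cell. On the diagonal they agree, both being 1/2, so the trace term of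
  \<open>quadratic_form_moment\<close> vanishes and only the norm of a thin strip remains.\<close>

lemma strat_sum2_dist:
  assumes P: "partition_of a b P" and R: "partition_of a b R" and PR: "P \<subseteq> R" and m: "mesh_below b P d"
    and ab: "0 \<le> a" "b \<le> T" and i: "i \<in> {1..m}" and j: "j \<in> {1..m}"
  shows "expectation (\<lambda>\<omega>. (strat_sum2 i j a b P \<omega> - strat_sum2 i j a b R \<omega>)\<^sup>2) \<le> (b - a) * d"
proof -
  define q where "q x y = trapez P x y - heavi x y" for x y
  have "strat_sum2 i j a b P \<omega> - strat_sum2 i j a b R \<omega> = (\<Sum>x\<in>R - {b}. \<Sum>y\<in>R - {b}. q x y * dW i R x \<omega> * dW j R y \<omega>)" for \<omega>
    unfolding strat_sum2_refine[OF P R PR] strat_sum2_refine[OF R R order.refl]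
    unfolding sum_subtractf[symmetric] q_def
    by (intro sum.cong refl) (simp add: left_diff_distrib trapez_eq_heavi[OF R])
  then have "expectation (\<lambda>\<omega>. (strat_sum2 i j a b P \<omega> - strat_sum2 i j a b R \<omega>)\<^sup>2)
    \<le> (\<Sum>x\<in>R - {b}. (hi R x - x) * q x x)\<^sup>2
      + 2 * (\<Sum>x\<in>R - {b}. \<Sum>y\<in>R - {b}. (hi R x - x) * (hi R y - y) * (q x y)\<^sup>2)"
    using quadratic_form_moment[OF R ab i j, of q] by simp
  also have "(\<Sum>x\<in>R - {b}. (hi R x - x) * q x x) = 0"
    using trapez_diag[OF P partition_cell[OF R]] by (intro sum.neutral) (auto simp: q_def)
  also have "(\<Sum>x\<in>R - {b}. \<Sum>y\<in>R - {b}. (hi R x - x) * (hi R y - y) * (q x y)\<^sup>2)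
     \<le> (\<Sum>x\<in>R - {b}. (hi R x - x) * (1 / 4 * d))"
  proof (rule sum_mono)
    fix x assume x: "x \<in> R - {b}"
    have xc: "x \<in> {a..<b}" using partition_cell[OF R x] .
    have "(\<Sum>y\<in>R - {b}. (hi R x - x) * (hi R y - y) * (q x y)\<^sup>2)
       \<le> (\<Sum>y\<in>R - {b}. (hi R x - x) * (1 / 4 * ((hi R y - y) * (if lo P y = lo P x then 1 else 0))))"
    proof (rule sum_mono)
      fix y assume y: "y \<in> R - {b}"
      have "\<bar>q x y\<bar> \<le> (if lo P x = lo P y then 1 / 2 else 0)"
        unfolding q_def using trapez_heavi_diff[OF P xc partition_cell[OF R y]] .
      then have "(q x y)\<^sup>2 \<le> (if lo P x = lo P y then 1 / 2 else 0)\<^sup>2"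
        by (metis abs_ge_zero abs_le_square_iff abs_of_nonneg order_trans)
      then have "(q x y)\<^sup>2 \<le> 1 / 4 * (if lo P y = lo P x then 1 else 0)"
        by (auto simp: power_divide split: if_splits)
      then show "(hi R x - x) * (hi R y - y) * (q x y)\<^sup>2
         \<le> (hi R x - x) * (1 / 4 * ((hi R y - y) * (if lo P y = lo P x then 1 else 0)))"
        using cell_length_pos[OF R x] cell_length_pos[OF R y]
        mult_left_mono[of "(q x y)\<^sup>2" "1 / 4 * (if lo P y = lo P x then 1 else 0)" "(hi R x - x) * (hi R y - y)"]
        by (simp add: mult_ac)
    qed
    also have "\<dots> = (hi R x - x) * (1 / 4 * (\<Sum>y\<in>R - {b}. (hi R y - y) * (if lo P y = lo P x then 1 else 0)))"
      by (simp add: sum_distrib_left)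
    also have "\<dots> \<le> (hi R x - x) * (1 / 4 * d)"
      using sum_same_cell[OF P R PR xc m] cell_length_pos[OF R x] by (intro mult_left_mono) auto
    finally show "(\<Sum>y\<in>R - {b}. (hi R x - x) * (hi R y - y) * (q x y)\<^sup>2) \<le> (hi R x - x) * (1 / 4 * d)" .
  qed
  also have "(\<Sum>x\<in>R - {b}. (hi R x - x) * (1 / 4 * d)) = (b - a) * d / 4"
    unfolding sum_distrib_right[symmetric] sum_cell_lengths[OF R] by simp
  finally have "expectation (\<lambda>\<omega>. (strat_sum2 i j a b P \<omega> - strat_sum2 i j a b R \<omega>)\<^sup>2) \<le> (b - a) * d / 2" by (simp add: mult.commute)
  \<comment> \<open>That d is positive has to be inferred from the existence of a cell, which
    requires a < b.\<close>
  moreover have "0 \<le> (b - a) * d"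
  proof (cases "a = b")
    case False
    then have "a \<in> {a..<b}" using partition_le[OF P] by auto
    then show ?thesis using mesh_cell[OF P _ m, of a] lo_le[OF P] less_hi[OF P, of a] partition_le[OF P]
      by (intro mult_nonneg_nonneg) fastforce+
  qed simp
  ultimately show ?thesis by linarith
qed

abbreviation strat2 :: "nat \<Rightarrow> nat \<Rightarrow> real \<Rightarrow> real \<Rightarrow> 'a \<Rightarrow> real" where
  "strat2 i j a s \<equiv> strat_integral M (\<lambda>t2. strat_integral M (\<lambda>_ _. 1) (W i) a t2) (W j) a s"

lemma strat2_net_limit:
  assumes ab: "0 \<le> a" "a \<le> b" "b \<le> T" and i: "i \<in> {1..m}" and j: "j \<in> {1..m}"
  shows "net_limit M a b (strat_sum2 i j a b) (strat2 i j a b)"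
proof -
  have mom: "all_moments M (strat_sum2 i j a b P)" if "partition_of a b P" for P
    using all_moments_strat_sum2[OF that ab(1,3) i j] .
  have "\<exists>I. net_limit M a b (strat_sum2 i j a b) I"
  proof (rule net_limit_exists[OF ab(2) mom])
    fix e :: real assume "e > 0"
    \<comment> \<open>The summand 1 keeps the denominator positive when a = b.\<close>
    define d where "d = e / (2 * (b - a) + 1)"
    have d: "d > 0" "(b - a) * d < e"
    proof -
      have 1: "2 * (b - a) + 1 > 0" using ab by simp
      then show "d > 0" using \<open>e > 0\<close> by (simp add: d_def)
      have "(b - a) * d < (2 * (b - a) + 1) * d" using \<open>d > 0\<close> ab by (intro mult_strict_right_mono) auto
      then show "(b - a) * d < e" using 1 by (simp add: d_def)
    qed
    show "\<exists>d>0. \<forall>P R. partition_of a b P \<longrightarrow> partition_of a b R \<longrightarrow> P \<subseteq> R \<longrightarrow> mesh_below b P d \<longrightarrow>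
       expectation (\<lambda>\<omega>. (strat_sum2 i j a b P \<omega> - strat_sum2 i j a b R \<omega>)\<^sup>2) < e"
      by (intro exI[of _ d] conjI allI impI d(1) le_less_trans[OF strat_sum2_dist[OF _ _ _ _ ab(1,3) i j] d(2)])
  qed
  then obtain I where I: "net_limit M a b (strat_sum2 i j a b) I" by blast
  have meas: "strat_sum2 i j a b P \<in> borel_measurable M" if "partition_of a b P" for P
    using mom[OF that] by (rule all_moments_measurable)
  let ?J = "\<lambda>s. strat_integral M (\<lambda>_ _. 1) (W i) a s"
  let ?S' = "\<lambda>n \<tau> \<omega>. \<Sum>k<n. (?J (\<tau> k) \<omega> + ?J (\<tau> (Suc k)) \<omega>) / 2 * (W j (\<tau> (Suc k)) \<omega> - W j (\<tau> k) \<omega>)"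
  have fine: "?S' n \<tau> \<in> borel_measurable M" "AE \<omega> in M. ?S' n \<tau> \<omega> = strat_sum2 i j a b (\<tau> ` {..n}) \<omega>"
    if f: "fine_partition a b \<delta> n \<tau>" for \<delta> n \<tau>
  proof -
    have \<tau>: "a \<le> \<tau> k" "\<tau> k \<le> b" if "k \<le> n" for k
      using fine_partition_set(1)[OF f] that by (auto simp: partition_of_def)
    have Jm: "?J (\<tau> k) \<in> borel_measurable M" "W j (\<tau> k) \<in> borel_measurable M" if "k \<le> n" for k
      using strat_const(1)[OF ab(1) \<tau>(1)[OF that] _ i] \<tau>[OF that] ab j by auto
    show "?S' n \<tau> \<in> borel_measurable M"
      by (intro borel_measurable_sum borel_measurable_times borel_measurable_divide borel_measurable_add
          borel_measurable_diff borel_measurable_const Jm) auto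
    \<comment> \<open>Each inner integral has its own null set; only finitely many nodes
      occur.\<close>
    have "AE \<omega> in M. \<forall>k\<in>{..n}. ?J (\<tau> k) \<omega> = W i (\<tau> k) \<omega> - W i a \<omega>"
      by (intro AE_finite_allI strat_const(2)[OF ab(1) _ _ i]) (use \<tau> ab in \<open>auto intro: order_trans\<close>)
    then show "AE \<omega> in M. ?S' n \<tau> \<omega> = strat_sum2 i j a b (\<tau> ` {..n}) \<omega>"
    proof eventually_elim
      fix \<omega> assume *: "\<forall>k\<in>{..n}. ?J (\<tau> k) \<omega> = W i (\<tau> k) \<omega> - W i a \<omega>"
      have "?S' n \<tau> \<omega> = (\<Sum>k<n. ((W i (\<tau> k) \<omega> + W i (\<tau> (Suc k)) \<omega>) / 2 - W i a \<omega>) * (W j (\<tau> (Suc k)) \<omega> - W j (\<tau> k) \<omega>))"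
      proof (intro sum.cong refl arg_cong2[where f = "(*)"])
        fix k assume "k \<in> {..<n}"
        then have J: "?J (\<tau> k) \<omega> = W i (\<tau> k) \<omega> - W i a \<omega>" "?J (\<tau> (Suc k)) \<omega> = W i (\<tau> (Suc k)) \<omega> - W i a \<omega>"
          using * by auto
        show "(?J (\<tau> k) \<omega> + ?J (\<tau> (Suc k)) \<omega>) / 2 = (W i (\<tau> k) \<omega> + W i (\<tau> (Suc k)) \<omega>) / 2 - W i a \<omega>"
          unfolding J by (simp add: field_simps)
      qed
      also have "\<dots> = strat_sum2 i j a b (\<tau> ` {..n}) \<omega>"
        using fine_partition_set(3)[OF f, of "\<lambda>u v. ((W i u \<omega> + W i v \<omega>) / 2 - W i a \<omega>) * (W j v \<omega> - W j u \<omega>)"]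
        by (simp add: strat_sum2_def dW_def)
      finally show "?S' n \<tau> \<omega> = strat_sum2 i j a b (\<tau> ` {..n}) \<omega>" .
    qed
  qed
  have *: "strat2 i j a b \<in> borel_measurable M" "AE \<omega> in M. strat2 i j a b \<omega> = I \<omega>"
    unfolding strat_integral_def[of M ?J] by (rule net_limit_SOME[OF ab(2) I fine meas]; assumption)+
  show ?thesis
    by (rule net_limit_cong_AE[OF I _ *(1) meas]) (use *(2) in auto)
qed

text \<open>One partition \<sigma> serves all upper limits v in it, so the second-level sums at
  different nodes are forms in the same increments.\<close>

definition strat_sum2_at :: "nat \<Rightarrow> nat \<Rightarrow> real \<Rightarrow> real \<Rightarrow> real set \<Rightarrow> real \<Rightarrow> 'a \<Rightarrow> real" where
  "strat_sum2_at i j a b \<sigma> v \<omega> = strat_sum2 i j a v (\<sigma> \<inter> {..v}) \<omega>"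

text \<open>As v is a point of \<sigma>, cutting off at v means the same for y as for the left end
  of its \<sigma>-cell.\<close>

lemma strat_sum2_at_refine:
  assumes P: "partition_of a b \<sigma>" and R: "partition_of a b R" and PR: "\<sigma> \<subseteq> R" and v: "v \<in> \<sigma>"
  shows "strat_sum2_at i j a b \<sigma> v \<omega> =
    (\<Sum>y\<in>R - {b}. (if y < v then 1 else 0) * ((\<Sum>x\<in>R - {b}. trapez \<sigma> x y * dW i R x \<omega>) * dW j R y \<omega>))"
proof -
  let ?G = "\<lambda>u. (W i u \<omega> + W i (hi \<sigma> u) \<omega>) / 2 - W i a \<omega>"
  note res = partition_restrict[OF P v]
  have "strat_sum2_at i j a b \<sigma> v \<omega> = (\<Sum>u\<in>{w\<in>\<sigma> - {b}. w < v}. ?G u * dW j \<sigma> u \<omega>)"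
    unfolding strat_sum2_at_def strat_sum2_def res(2) dW_def using res(3) by (intro sum.cong refl) auto
  also have "\<dots> = (\<Sum>u\<in>\<sigma> - {b}. ((if u < v then 1 else 0) * ?G u) * dW j \<sigma> u \<omega>)"
    using P by (intro sum.mono_neutral_cong_left) auto
  also have "\<dots> = (\<Sum>y\<in>R - {b}. ((if lo \<sigma> y < v then 1 else 0) * ?G (lo \<sigma> y)) * dW j R y \<omega>)"
    using sum_refine[OF P R PR, of "\<lambda>u. (if u < v then 1 else 0) * ?G u" "\<lambda>s. W j s \<omega>"] unfolding dW_def .
  also have "\<dots> = (\<Sum>y\<in>R - {b}. (if y < v then 1 else 0) * ((\<Sum>x\<in>R - {b}. trapez \<sigma> x y * dW i R x \<omega>) * dW j R y \<omega>))"
  proof (rule sum.cong[OF refl])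
    fix y assume y: "y \<in> R - {b}"
    have yc: "y \<in> {a..<b}" using partition_cell[OF R y] .
    have "lo \<sigma> y < v \<longleftrightarrow> y < v" using le_lo_iff[OF P yc v] by auto
    then show "((if lo \<sigma> y < v then 1 else 0) * ?G (lo \<sigma> y)) * dW j R y \<omega> =
       (if y < v then 1 else 0) * ((\<Sum>x\<in>R - {b}. trapez \<sigma> x y * dW i R x \<omega>) * dW j R y \<omega>)"
      using midpoint_expand[OF P R PR yc, of i \<omega>] hi_lo[OF P yc] by simp
  qed
  finally show ?thesis .
qed

text \<open>Two partitions are needed: the outer sum stays on \<tau> while \<sigma> is refined,
  which drives the second-level sums to the true second-level integrals.\<close>

definition strat_sum3 :: "nat \<Rightarrow> nat \<Rightarrow> nat \<Rightarrow> real \<Rightarrow> real \<Rightarrow> real set \<Rightarrow> real set \<Rightarrow> 'a \<Rightarrow> real" where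
  "strat_sum3 i j k a b \<tau> \<sigma> \<omega> =
     (\<Sum>u\<in>\<tau> - {b}. (strat_sum2_at i j a b \<sigma> u \<omega> + strat_sum2_at i j a b \<sigma> (hi \<tau> u) \<omega>) / 2 * dW k \<tau> u \<omega>)"

lemma strat_sum3_refine:
  assumes \<tau>: "partition_of a b \<tau>" and \<sigma>: "partition_of a b \<sigma>" and R: "partition_of a b R"
    and sub: "\<tau> \<subseteq> \<sigma>" "\<sigma> \<subseteq> R"
  shows "strat_sum3 i j k a b \<tau> \<sigma> \<omega> =
    (\<Sum>x\<in>R - {b}. \<Sum>y\<in>R - {b}. \<Sum>z\<in>R - {b}. trapez \<sigma> x y * trapez \<tau> y z * dW i R x \<omega> * dW j R y \<omega> * dW k R z \<omega>)"
proof -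
  let ?S = "\<lambda>v. strat_sum2_at i j a b \<sigma> v \<omega>"
  let ?f = "\<lambda>x y z. trapez \<sigma> x y * trapez \<tau> y z * dW i R x \<omega> * dW j R y \<omega> * dW k R z \<omega>"
  have "strat_sum3 i j k a b \<tau> \<sigma> \<omega> = (\<Sum>z\<in>R - {b}. (?S (lo \<tau> z) + ?S (hi \<tau> (lo \<tau> z))) / 2 * dW k R z \<omega>)"
    using sum_refine[OF \<tau> R, of "\<lambda>u. (?S u + ?S (hi \<tau> u)) / 2" "\<lambda>s. W k s \<omega>"] sub
    unfolding strat_sum3_def dW_def by blast
  also have "\<dots> = (\<Sum>z\<in>R - {b}. \<Sum>y\<in>R - {b}. \<Sum>x\<in>R - {b}. ?f x y z)"
  proof (rule sum.cong[OF refl])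
    fix z assume z: "z \<in> R - {b}"
    have zc: "z \<in> {a..<b}" using partition_cell[OF R z] .
    have v: "lo \<tau> z \<in> \<sigma>" "hi \<tau> z \<in> \<sigma>" using lo_mem[OF \<tau> zc] hi_mem[OF \<tau> zc] sub by auto
    have "(?S (lo \<tau> z) + ?S (hi \<tau> (lo \<tau> z))) / 2
       = (\<Sum>y\<in>R - {b}. trapez \<tau> y z * ((\<Sum>x\<in>R - {b}. trapez \<sigma> x y * dW i R x \<omega>) * dW j R y \<omega>))"
      unfolding hi_lo[OF \<tau> zc] strat_sum2_at_refine[OF \<sigma> R sub(2) v(1)] strat_sum2_at_refine[OF \<sigma> R sub(2) v(2)]
        sum.distrib[symmetric] sum_divide_distrib
      by (intro sum.cong refl) (simp add: trapez_def)
    then show "(?S (lo \<tau> z) + ?S (hi \<tau> (lo \<tau> z))) / 2 * dW k R z \<omega> = (\<Sum>y\<in>R - {b}. \<Sum>x\<in>R - {b}. ?f x y z)"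
      by (simp only: sum_distrib_left sum_distrib_right mult_ac)
  qed
  also have "\<dots> = (\<Sum>y\<in>R - {b}. \<Sum>z\<in>R - {b}. \<Sum>x\<in>R - {b}. ?f x y z)" by (rule sum.swap)
  also have "\<dots> = (\<Sum>y\<in>R - {b}. \<Sum>x\<in>R - {b}. \<Sum>z\<in>R - {b}. ?f x y z)"
    by (rule sum.cong[OF refl], rule sum.swap)
  also have "\<dots> = (\<Sum>x\<in>R - {b}. \<Sum>y\<in>R - {b}. \<Sum>z\<in>R - {b}. ?f x y z)" by (rule sum.swap)
  finally show ?thesis .
qed

lemma strat_sum3_diag:
  assumes R: "partition_of a b R"
  shows "strat_sum3 i j k a b R R \<omega> =
    (\<Sum>x\<in>R - {b}. \<Sum>y\<in>R - {b}. \<Sum>z\<in>R - {b}. heavi x y * heavi y z * dW i R x \<omega> * dW j R y \<omega> * dW k R z \<omega>)"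
  unfolding strat_sum3_refine[OF R R R order.refl order.refl]
  by (intro sum.cong refl) (simp add: trapez_eq_heavi[OF R])

lemma all_moments_strat_sum3:
  assumes "partition_of a b \<tau>" "partition_of a b \<sigma>" "\<tau> \<subseteq> \<sigma>" "0 \<le> a" "b \<le> T" "i \<in> {1..m}" "j \<in> {1..m}" "k \<in> {1..m}"
  shows "all_moments M (strat_sum3 i j k a b \<tau> \<sigma>)"
proof -
  have "strat_sum3 i j k a b \<tau> \<sigma> = (\<lambda>\<omega>. \<Sum>x\<in>\<sigma> - {b}. \<Sum>y\<in>\<sigma> - {b}. \<Sum>z\<in>\<sigma> - {b}.
      trapez \<sigma> x y * trapez \<tau> y z * dW i \<sigma> x \<omega> * dW j \<sigma> y \<omega> * dW k \<sigma> z \<omega>)"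
    using strat_sum3_refine[OF assms(1,2,2,3) order.refl] by auto
  then show ?thesis using assms by (auto intro!: moments_intros)
qed

text \<open>Only the mesh of \<tau> enters, because points sharing a \<sigma>-cell share a
  \<tau>-cell. Each trace of the kernel difference is dominated by the indicator of the \<tau>-cell,
  giving three times 3 (b - a) d^2; the difference itself lives where x, y or y, z share a cell,
  giving 6 (b - a)^2 d.\<close>

lemma strat_sum3_dist:
  assumes \<tau>: "partition_of a b \<tau>" and \<sigma>: "partition_of a b \<sigma>" and R: "partition_of a b R"
    and sub: "\<tau> \<subseteq> \<sigma>" "\<sigma> \<subseteq> R" and m: "mesh_below b \<tau> d"
    and ab: "0 \<le> a" "b \<le> T" and i: "i \<in> {1..m}" and j: "j \<in> {1..m}" and k: "k \<in> {1..m}"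
  shows "expectation (\<lambda>\<omega>. (strat_sum3 i j k a b \<tau> \<sigma> \<omega> - strat_sum3 i j k a b R R \<omega>)\<^sup>2)
    \<le> 9 * ((b - a) * d\<^sup>2) + 6 * ((b - a)\<^sup>2 * d)"
proof -
  define A where "A x y z = trapez \<sigma> x y * trapez \<tau> y z - heavi x y * heavi y z" for x y z
  define s where "s x y = (if lo \<tau> x = lo \<tau> y then 1 else 0 :: real)" for x y
  let ?X = "R - {b}" let ?\<delta> = "\<lambda>x. hi R x - x"
  have sR: "\<tau> \<subseteq> R" using sub by auto
  have cell: "x \<in> {a..<b}" if "x \<in> ?X" for x using partition_cell[OF R that] .
  have pos: "0 \<le> ?\<delta> x" if "x \<in> ?X" for x using cell_length_pos[OF R that] by simp
  have s01: "0 \<le> s x y" "s x y \<le> 1" "s x y = s y x" for x y by (auto simp: s_def)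
  have ssum: "(\<Sum>y\<in>?X. ?\<delta> y * s y x) \<le> d" if "x \<in> ?X" for x
    using sum_same_cell[OF \<tau> R sR cell[OF that] m] by (simp add: s_def)
  have d\<tau>: "\<bar>trapez \<tau> x y - heavi x y\<bar> \<le> s x y / 2" if "x \<in> ?X" "y \<in> ?X" for x y
    using trapez_heavi_diff[OF \<tau> cell[OF that(1)] cell[OF that(2)]] by (auto simp: s_def split: if_splits)
  have same: "lo \<sigma> x = lo \<sigma> y \<Longrightarrow> lo \<tau> x = lo \<tau> y" if "x \<in> ?X" "y \<in> ?X" for x y
    using lo_lo_subset[OF \<tau> \<sigma> sub(1) cell[OF that(1)]] lo_lo_subset[OF \<tau> \<sigma> sub(1) cell[OF that(2)]] by metis
  have d\<sigma>: "\<bar>trapez \<sigma> x y - heavi x y\<bar> \<le> s x y / 2" if "x \<in> ?X" "y \<in> ?X" for x y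
    using trapez_heavi_diff[OF \<sigma> cell[OF that(1)] cell[OF that(2)]] same[OF that] by (auto simp: s_def split: if_splits)
  have Aeq: "A x y z = (trapez \<sigma> x y - heavi x y) * trapez \<tau> y z + heavi x y * (trapez \<tau> y z - heavi y z)" for x y z
    by (simp add: A_def algebra_simps)
  have Ab: "\<bar>A x y z\<bar> \<le> s x y / 2 + s y z / 2" if "x \<in> ?X" "y \<in> ?X" "z \<in> ?X" for x y z
    unfolding Aeq
  proof (rule order_trans[OF abs_triangle_ineq add_mono])
    have "\<bar>trapez \<sigma> x y - heavi x y\<bar> * \<bar>trapez \<tau> y z\<bar> \<le> s x y / 2 * 1"
      using trapez_bounds[of \<tau> y z] by (intro mult_mono d\<sigma> that) (auto simp: s01)
    then show "\<bar>(trapez \<sigma> x y - heavi x y) * trapez \<tau> y z\<bar> \<le> s x y / 2" by (simp add: abs_mult)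
    have "\<bar>heavi x y\<bar> * \<bar>trapez \<tau> y z - heavi y z\<bar> \<le> 1 * (s y z / 2)"
      using heavi_bounds[of x y] by (intro mult_mono d\<tau> that) (auto simp: s01)
    then show "\<bar>heavi x y * (trapez \<tau> y z - heavi y z)\<bar> \<le> s y z / 2" by (simp add: abs_mult)
  qed
  have Asq: "(A x y z)\<^sup>2 \<le> s x y / 2 + s y z / 2" if "x \<in> ?X" "y \<in> ?X" "z \<in> ?X" for x y z
  proof -
    \<comment> \<open>The bound lies between 0 and 1, so squaring does not enlarge it; this keeps
      the norm estimate linear in s.\<close>
    have "(A x y z)\<^sup>2 \<le> (s x y / 2 + s y z / 2)\<^sup>2" using Ab[OF that] by (intro power2_le_iff_abs_le[THEN iffD2]) (auto simp: s01)
    also have "\<dots> \<le> s x y / 2 + s y z / 2" by (auto simp: s_def power2_eq_square)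
    finally show ?thesis .
  qed
  have tr: "(\<Sum>x\<in>?X. ?\<delta> x * (\<Sum>y\<in>?X. ?\<delta> y * B x y)\<^sup>2) \<le> (b - a) * d\<^sup>2"
    if B: "\<And>x y. x \<in> ?X \<Longrightarrow> y \<in> ?X \<Longrightarrow> \<bar>B x y\<bar> \<le> s y x" for B
  proof -
    have "(\<Sum>x\<in>?X. ?\<delta> x * (\<Sum>y\<in>?X. ?\<delta> y * B x y)\<^sup>2) \<le> (\<Sum>x\<in>?X. ?\<delta> x * d\<^sup>2)"
    proof (intro sum_mono mult_left_mono pos)
      fix x assume x: "x \<in> ?X"
      have "\<bar>\<Sum>y\<in>?X. ?\<delta> y * B x y\<bar> \<le> (\<Sum>y\<in>?X. ?\<delta> y * s y x)"
        using B[OF x] pos by (intro order_trans[OF sum_abs] sum_mono) (auto simp: abs_mult intro!: mult_mono)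
      also note ssum[OF x]
      also note abs_ge_self
      finally show "(\<Sum>y\<in>?X. ?\<delta> y * B x y)\<^sup>2 \<le> d\<^sup>2"
        by (rule abs_le_square_iff[THEN iffD1])
    qed
    also have "\<dots> = (b - a) * d\<^sup>2"
      using sum_cell_lengths[OF R] by (simp add: sum_distrib_right[symmetric])
    finally show ?thesis .
  qed
  have t1: "\<bar>A x y y\<bar> \<le> s y x" if "x \<in> ?X" "y \<in> ?X" for x y
  proof -
    have "A x y y = (trapez \<sigma> x y - heavi x y) / 2"
      using trapez_diag[OF \<tau> cell[OF that(2)]] by (simp add: A_def)
    then show ?thesis using d\<sigma>[OF that] s01(1)[of x y] s01(3)[of x y] by (simp add: abs_if split: if_splits)
  qed
  have t3: "\<bar>A y y x\<bar> \<le> s y x" if "x \<in> ?X" "y \<in> ?X" for x y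
  proof -
    have "A y y x = (trapez \<tau> y x - heavi y x) / 2"
      using trapez_diag[OF \<sigma> cell[OF that(2)]] by (simp add: A_def)
    then show ?thesis using d\<tau>[OF that(2,1)] s01(1)[of y x] by (simp add: abs_if split: if_splits)
  qed
  have t2: "\<bar>A y x y\<bar> \<le> s y x" if "x \<in> ?X" "y \<in> ?X" for x y
  proof (cases "lo \<tau> y = lo \<tau> x")
    case True
    then show ?thesis using Ab[OF that(2,1,2)] by (simp add: s_def)
  next
    case False
    \<comment> \<open>One factor requires y before x, the other x before y. In different
      \<tau>-cells one of them fails, also across the two partitions.\<close>
    have "trapez \<sigma> y x * trapez \<tau> x y = 0"
    proof (cases "lo \<tau> x < lo \<tau> y")
      case True
      have "lo \<sigma> x \<le> x" using lo_le[OF \<sigma> cell[OF that(1)]] .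
      also have "x < lo \<tau> y"
        using True le_lo_iff[OF \<tau> cell[OF that(1)] lo_mem[OF \<tau> cell[OF that(2)]]] by simp
      also have "lo \<tau> y \<le> lo \<sigma> y"
        using le_lo_iff[OF \<sigma> cell[OF that(2)], of "lo \<tau> y"] lo_mem[OF \<tau> cell[OF that(2)]]
          lo_le[OF \<tau> cell[OF that(2)]] sub by auto
      finally have "lo \<sigma> x < lo \<sigma> y" .
      then show ?thesis using trapez_cells(2)[OF \<sigma> cell[OF that(2)] cell[OF that(1)]] by simp
    next
      case F: False
      then have "lo \<tau> y < lo \<tau> x" using False by simp
      then show ?thesis using trapez_cells(2)[OF \<tau> cell[OF that(1)] cell[OF that(2)]] by simp
    qed
    moreover have "heavi y x * heavi x y = 0"
      using False by (auto simp: heavi_def)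
    ultimately have "A y x y = 0" unfolding A_def by linarith
    then show ?thesis by (simp add: s01)
  qed
  have "strat_sum3 i j k a b \<tau> \<sigma> \<omega> - strat_sum3 i j k a b R R \<omega>
     = (\<Sum>x\<in>?X. \<Sum>y\<in>?X. \<Sum>z\<in>?X. A x y z * dW i R x \<omega> * dW j R y \<omega> * dW k R z \<omega>)" for \<omega>
    unfolding strat_sum3_refine[OF \<tau> \<sigma> R sub] strat_sum3_diag[OF R] sum_subtractf[symmetric] A_def
    by (intro sum.cong refl) (simp add: left_diff_distrib)
  then have "expectation (\<lambda>\<omega>. (strat_sum3 i j k a b \<tau> \<sigma> \<omega> - strat_sum3 i j k a b R R \<omega>)\<^sup>2)
    \<le> 3 * (\<Sum>x\<in>?X. ?\<delta> x * (\<Sum>y\<in>?X. ?\<delta> y * A x y y)\<^sup>2)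
      + 3 * (\<Sum>x\<in>?X. ?\<delta> x * (\<Sum>y\<in>?X. ?\<delta> y * A y x y)\<^sup>2)
      + 3 * (\<Sum>x\<in>?X. ?\<delta> x * (\<Sum>y\<in>?X. ?\<delta> y * A y y x)\<^sup>2)
      + 6 * (\<Sum>x\<in>?X. \<Sum>y\<in>?X. \<Sum>z\<in>?X. ?\<delta> x * ?\<delta> y * ?\<delta> z * (A x y z)\<^sup>2)"
    using cubic_form_moment[OF R ab i j k, of A] by simp
  also have "\<dots> \<le> 3 * ((b - a) * d\<^sup>2) + 3 * ((b - a) * d\<^sup>2) + 3 * ((b - a) * d\<^sup>2) + 6 * ((b - a)\<^sup>2 * d)"
  proof (intro add_mono mult_left_mono tr t1 t2 t3)
    have "(\<Sum>x\<in>?X. \<Sum>y\<in>?X. \<Sum>z\<in>?X. ?\<delta> x * ?\<delta> y * ?\<delta> z * (A x y z)\<^sup>2)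
      \<le> (\<Sum>x\<in>?X. \<Sum>y\<in>?X. \<Sum>z\<in>?X. ?\<delta> x * ?\<delta> y * ?\<delta> z * (s x y / 2 + s y z / 2))"
      using pos by (intro sum_mono mult_left_mono Asq mult_nonneg_nonneg) auto
    also have "\<dots> = (\<Sum>y\<in>?X. ?\<delta> y * (\<Sum>x\<in>?X. ?\<delta> x * s x y) * (\<Sum>z\<in>?X. ?\<delta> z)) / 2
       + (\<Sum>y\<in>?X. ?\<delta> y * (\<Sum>z\<in>?X. ?\<delta> z * s z y) * (\<Sum>x\<in>?X. ?\<delta> x)) / 2"
    proof -
      have "(\<Sum>x\<in>?X. \<Sum>z\<in>?X. ?\<delta> x * ?\<delta> y * ?\<delta> z * s x y)
          = (\<Sum>x\<in>?X. (?\<delta> y * (?\<delta> x * s x y)) * (\<Sum>z\<in>?X. ?\<delta> z))" for y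
        unfolding sum_distrib_left by (intro sum.cong refl) (simp add: mult_ac)
      then have 1: "(\<Sum>x\<in>?X. \<Sum>y\<in>?X. \<Sum>z\<in>?X. ?\<delta> x * ?\<delta> y * ?\<delta> z * s x y)
          = (\<Sum>y\<in>?X. ?\<delta> y * (\<Sum>x\<in>?X. ?\<delta> x * s x y) * (\<Sum>z\<in>?X. ?\<delta> z))"
        by (subst sum.swap) (simp only: sum_distrib_right[symmetric] sum_distrib_left[symmetric])
      have "(\<Sum>x\<in>?X. \<Sum>z\<in>?X. ?\<delta> x * ?\<delta> y * ?\<delta> z * s y z)
          = (\<Sum>x\<in>?X. (?\<delta> y * (\<Sum>z\<in>?X. ?\<delta> z * s z y)) * ?\<delta> x)" for y
        unfolding sum_distrib_left sum_distrib_right by (intro sum.cong refl) (simp add: mult_ac s01(3))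
      then have 2: "(\<Sum>x\<in>?X. \<Sum>y\<in>?X. \<Sum>z\<in>?X. ?\<delta> x * ?\<delta> y * ?\<delta> z * s y z)
          = (\<Sum>y\<in>?X. ?\<delta> y * (\<Sum>z\<in>?X. ?\<delta> z * s z y) * (\<Sum>x\<in>?X. ?\<delta> x))"
        by (subst sum.swap) (simp only: sum_distrib_left[symmetric])
      have "(\<Sum>x\<in>?X. \<Sum>y\<in>?X. \<Sum>z\<in>?X. ?\<delta> x * ?\<delta> y * ?\<delta> z * (s x y / 2 + s y z / 2))
         = (\<Sum>x\<in>?X. \<Sum>y\<in>?X. \<Sum>z\<in>?X. ?\<delta> x * ?\<delta> y * ?\<delta> z * s x y) / 2
         + (\<Sum>x\<in>?X. \<Sum>y\<in>?X. \<Sum>z\<in>?X. ?\<delta> x * ?\<delta> y * ?\<delta> z * s y z) / 2"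
        by (simp add: distrib_left sum.distrib sum_divide_distrib)
      then show ?thesis unfolding 1 2 .
    qed
    also have "\<dots> \<le> (\<Sum>y\<in>?X. ?\<delta> y * d * (b - a)) / 2 + (\<Sum>y\<in>?X. ?\<delta> y * d * (b - a)) / 2"
      unfolding sum_cell_lengths[OF R] using partition_le[OF R]
      by (intro add_mono divide_right_mono sum_mono mult_right_mono mult_left_mono ssum pos) auto
    also have "\<dots> = (b - a)\<^sup>2 * d"
      using sum_cell_lengths[OF R] by (simp add: sum_distrib_right[symmetric] power2_eq_square)
    finally show "(\<Sum>x\<in>?X. \<Sum>y\<in>?X. \<Sum>z\<in>?X. ?\<delta> x * ?\<delta> y * ?\<delta> z * (A x y z)\<^sup>2) \<le> (b - a)\<^sup>2 * d" .
  qed auto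
  finally show ?thesis by simp
qed

end

section \<open>The iterated Stratonovich integral\<close>

text \<open>The definition gives a finite distance only for fine partitions; comparison with one
  fine partition extends it to all.\<close>

lemma (in prob_space) net_limit_integrable:
  assumes "a \<le> b" and lim: "net_limit M a b S I" and mom: "\<And>P. partition_of a b P \<Longrightarrow> all_moments M (S P)"
    and P: "partition_of a b P"
  shows "integrable M (\<lambda>\<omega>. (S P \<omega> - I \<omega>)\<^sup>2)"
proof -
  have I: "I \<in> borel_measurable M" using lim by (simp add: net_limit_def)
  obtain n where n: "integrable M (\<lambda>\<omega>. (S (uniform_partition a b n) \<omega> - I \<omega>)\<^sup>2)"
    using eventually_happens[OF net_limit_uniform(1)[OF lim \<open>a \<le> b\<close>]] by auto
  have "integrable M (\<lambda>\<omega>. (S P \<omega> - S (uniform_partition a b n) \<omega>)\<^sup>2)"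
    using uniform_partition_of[OF \<open>a \<le> b\<close>] P by (intro all_moments_square_integrable all_moments_diff mom)
  from square_dist_triangle(1)[OF all_moments_measurable[OF mom[OF P]] I this n] show ?thesis .
qed

context wiener
begin

text \<open>The sum that the definition of the iterated integral really forms. It contains products
  of a mean-square limit with an increment, whose square integrability is not evident.\<close>

definition strat_sum3_exact :: "nat \<Rightarrow> nat \<Rightarrow> nat \<Rightarrow> real \<Rightarrow> real \<Rightarrow> real set \<Rightarrow> 'a \<Rightarrow> real" where
  "strat_sum3_exact i j k a b \<tau> \<omega> =
     (\<Sum>u\<in>\<tau> - {b}. (strat2 i j a u \<omega> + strat2 i j a (hi \<tau> u) \<omega>) / 2 * dW k \<tau> u \<omega>)"

context
  fixes a b :: real and i j k :: nat
  assumes ab: "0 \<le> a" "a \<le> b" "b \<le> T" and i: "i \<in> {1..m}" and j: "j \<in> {1..m}" and k: "k \<in> {1..m}"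
begin

lemma strat_sum3_exact_measurable:
  assumes \<tau>: "partition_of a b \<tau>"
  shows "strat_sum3_exact i j k a b \<tau> \<in> borel_measurable M"
proof -
  have 1: "strat2 i j a u \<in> borel_measurable M" if "u \<in> \<tau>" for u
  proof -
    have "a \<le> u" "u \<le> T" using \<tau> that ab by (auto simp: partition_of_def)
    from strat2_net_limit[OF ab(1) this i j] show ?thesis by (simp add: net_limit_def)
  qed
  have 2: "hi \<tau> u \<in> \<tau>" if "u \<in> \<tau> - {b}" for u using hi_mem[OF \<tau> partition_cell[OF \<tau> that]] .
  have 3: "dW k \<tau> u \<in> borel_measurable M" if "u \<in> \<tau> - {b}" for u
    using all_moments_dW[OF \<tau> ab(1,3) k that] by (rule all_moments_measurable)
  show ?thesis unfolding strat_sum3_exact_def[abs_def]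
    using 1 2 3 by (intro borel_measurable_sum borel_measurable_times borel_measurable_divide borel_measurable_add
        borel_measurable_const) auto
qed

text \<open>Refining the inner partition makes the second-level sums converge almost everywhere
  along a subsequence, hence also their products with the outer increments. Fatou then provides
  integrability and the bound.\<close>

lemma strat_sum3_exact_dist:
  assumes \<tau>: "partition_of a b \<tau>" and m: "mesh_below b \<tau> d"
  defines "C \<equiv> 9 * ((b - a) * d\<^sup>2) + 6 * ((b - a)\<^sup>2 * d)"
  shows "integrable M (\<lambda>\<omega>. (strat_sum3_exact i j k a b \<tau> \<omega> - strat_sum3 i j k a b \<tau> \<tau> \<omega>)\<^sup>2)"
    and "expectation (\<lambda>\<omega>. (strat_sum3_exact i j k a b \<tau> \<omega> - strat_sum3 i j k a b \<tau> \<tau> \<omega>)\<^sup>2) \<le> 4 * C"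
proof -
  \<comment> \<open>Contains \<tau>, so every outer node is a partition point at which the inner sum
    can stop, and its mesh tends to 0.\<close>
  define \<sigma> where "\<sigma> n = \<tau> \<union> uniform_partition a b n" for n
  have \<sigma>: "partition_of a b (\<sigma> n)" "\<tau> \<subseteq> \<sigma> n" for n
    using partition_Un[OF \<tau> uniform_partition_of[OF ab(2)]] by (auto simp: \<sigma>_def)
  let ?X = "\<lambda>n u. strat_sum2_at i j a b (\<sigma> n) u"
  have u: "a \<le> u" "u \<le> T" "u \<in> \<sigma> n" if "u \<in> \<tau>" for u n
    using \<tau> that ab \<sigma>(2) by (auto simp: partition_of_def)
  have int: "integrable M (\<lambda>\<omega>. (?X n u \<omega> - strat2 i j a u \<omega>)\<^sup>2)" if "u \<in> \<tau>" for n u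
    unfolding strat_sum2_at_def
    by (rule net_limit_integrable[OF u(1)[OF that] strat2_net_limit[OF ab(1) u(1,2)[OF that] i j] _
          partition_restrict(1)[OF \<sigma>(1) u(3)[OF that]]])
       (rule all_moments_strat_sum2[OF _ ab(1) u(2)[OF that] i j])
  have lim: "(\<lambda>n. expectation (\<lambda>\<omega>. (?X n u \<omega> - strat2 i j a u \<omega>)\<^sup>2)) \<longlonglongrightarrow> 0" if uu: "u \<in> \<tau>" for u
  proof (rule order_tendstoI)
    show "\<forall>\<^sub>F n in sequentially. e < expectation (\<lambda>\<omega>. (?X n u \<omega> - strat2 i j a u \<omega>)\<^sup>2)" if "e < 0" for e
      using that by (intro always_eventually allI) (auto intro: less_le_trans)
    fix e :: real assume "0 < e"
    obtain \<delta> where \<delta>: "\<delta> > 0" "\<And>P. partition_of a u P \<Longrightarrow> mesh_below u P \<delta> \<Longrightarrow>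
       integrable M (\<lambda>\<omega>. (strat_sum2 i j a u P \<omega> - strat2 i j a u \<omega>)\<^sup>2) \<and>
       expectation (\<lambda>\<omega>. (strat_sum2 i j a u P \<omega> - strat2 i j a u \<omega>)\<^sup>2) < e"
      using net_limitD[OF strat2_net_limit[OF ab(1) u(1,2)[OF uu] i j] \<open>0 < e\<close>] by blast
    show "\<forall>\<^sub>F n in sequentially. expectation (\<lambda>\<omega>. (?X n u \<omega> - strat2 i j a u \<omega>)\<^sup>2) < e"
      using uniform_partition_eventually[OF ab(2) \<delta>(1)]
    proof eventually_elim
      fix n assume "mesh_below b (uniform_partition a b n) \<delta>"
      then have "mesh_below b (\<sigma> n) \<delta>"
        using mesh_below_subset[OF uniform_partition_of[OF ab(2)] \<sigma>(1)[of n]] by (auto simp: \<sigma>_def)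
      then show "expectation (\<lambda>\<omega>. (?X n u \<omega> - strat2 i j a u \<omega>)\<^sup>2) < e"
        unfolding strat_sum2_at_def
        using \<delta>(2)[OF partition_restrict(1)[OF \<sigma>(1) u(3)[OF uu]] partition_restrict(4)[OF \<sigma>(1) u(3)[OF uu]]] by simp
    qed
  qed
  obtain r :: "nat \<Rightarrow> nat" where r: "strict_mono r"
    and AE: "AE \<omega> in M. \<forall>u\<in>\<tau>. (\<lambda>n. ?X (r n) u \<omega>) \<longlonglongrightarrow> strat2 i j a u \<omega>"
    by (rule L2_AE_subseq[of \<tau> M ?X "\<lambda>u. strat2 i j a u"]) (use \<tau> int lim in auto)
  let ?f = "\<lambda>n \<omega>. strat_sum3 i j k a b \<tau> (\<sigma> (r n)) \<omega> - strat_sum3 i j k a b \<tau> \<tau> \<omega>"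
  have mom3: "all_moments M (strat_sum3 i j k a b \<tau>' \<sigma>')"
    if "partition_of a b \<tau>'" "partition_of a b \<sigma>'" "\<tau>' \<subseteq> \<sigma>'" for \<tau>' \<sigma>'
    using all_moments_strat_sum3[OF that ab(1,3) i j k] .
  have AE': "AE \<omega> in M. (\<lambda>n. ?f n \<omega>) \<longlonglongrightarrow> strat_sum3_exact i j k a b \<tau> \<omega> - strat_sum3 i j k a b \<tau> \<tau> \<omega>"
    using AE
  proof eventually_elim
    fix \<omega> assume *: "\<forall>u\<in>\<tau>. (\<lambda>n. ?X (r n) u \<omega>) \<longlonglongrightarrow> strat2 i j a u \<omega>"
    have "hi \<tau> u \<in> \<tau>" if "u \<in> \<tau> - {b}" for u using hi_mem[OF \<tau> partition_cell[OF \<tau> that]] .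
    then show "(\<lambda>n. ?f n \<omega>) \<longlonglongrightarrow> strat_sum3_exact i j k a b \<tau> \<omega> - strat_sum3 i j k a b \<tau> \<tau> \<omega>"
      unfolding strat_sum3_def[of _ _ _ _ _ _ "\<sigma> (r _)"] strat_sum3_exact_def
      using * by (intro tendsto_intros) auto
  qed
  \<comment> \<open>Comparison through \<open>strat_sum3\<close> on the refined partition alone:
    both distances are at most C, whatever n is, since C depends only on the mesh of \<tau>.
    Doubling each gives 4 C.\<close>
  have bound: "expectation (\<lambda>\<omega>. (?f n \<omega>)\<^sup>2) \<le> 4 * C" for n
  proof -
    let ?\<sigma> = "\<sigma> (r n)"
    have "expectation (\<lambda>\<omega>. (?f n \<omega>)\<^sup>2) \<le>
       2 * expectation (\<lambda>\<omega>. (strat_sum3 i j k a b \<tau> ?\<sigma> \<omega> - strat_sum3 i j k a b ?\<sigma> ?\<sigma> \<omega>)\<^sup>2)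
       + 2 * expectation (\<lambda>\<omega>. (strat_sum3 i j k a b ?\<sigma> ?\<sigma> \<omega> - strat_sum3 i j k a b \<tau> \<tau> \<omega>)\<^sup>2)"
      using \<tau> \<sigma> by (intro square_dist_triangle(2) all_moments_measurable all_moments_square_integrable
          all_moments_diff mom3) auto
    also have "expectation (\<lambda>\<omega>. (strat_sum3 i j k a b ?\<sigma> ?\<sigma> \<omega> - strat_sum3 i j k a b \<tau> \<tau> \<omega>)\<^sup>2)
       = expectation (\<lambda>\<omega>. (strat_sum3 i j k a b \<tau> \<tau> \<omega> - strat_sum3 i j k a b ?\<sigma> ?\<sigma> \<omega>)\<^sup>2)"
      by (subst square_dist_commute) simp
    finally show ?thesis
      using strat_sum3_dist[OF \<tau> \<sigma>(1) \<sigma>(1) \<sigma>(2) order.refl m ab(1,3) i j k, of "r n", folded C_def]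
        strat_sum3_dist[OF \<tau> \<tau> \<sigma>(1) order.refl \<sigma>(2) m ab(1,3) i j k, of "r n", folded C_def] by linarith
  qed
  have sq: "integrable M (\<lambda>\<omega>. (?f n \<omega>)\<^sup>2)" and fm: "?f n \<in> borel_measurable M" for n
    using \<tau> \<sigma> by (intro all_moments_square_integrable all_moments_measurable all_moments_diff mom3; auto)+
  have gm: "(\<lambda>\<omega>. strat_sum3_exact i j k a b \<tau> \<omega> - strat_sum3 i j k a b \<tau> \<tau> \<omega>) \<in> borel_measurable M"
    using strat_sum3_exact_measurable[OF \<tau>] all_moments_measurable[OF mom3[OF \<tau> \<tau> order.refl]]
    by (rule borel_measurable_diff)
  show "integrable M (\<lambda>\<omega>. (strat_sum3_exact i j k a b \<tau> \<omega> - strat_sum3 i j k a b \<tau> \<tau> \<omega>)\<^sup>2)"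
    "expectation (\<lambda>\<omega>. (strat_sum3_exact i j k a b \<tau> \<omega> - strat_sum3 i j k a b \<tau> \<tau> \<omega>)\<^sup>2) \<le> 4 * C"
    using Fatou_square[OF fm gm AE' sq bound tendsto_const] by auto
qed

text \<open>The iterated limit is also the limit of sums in which all three levels use one
  partition, and these are the cubic forms with kernel \<open>heavi x y * heavi y z\<close>.\<close>

lemma strat_iter3_net_limit:
  "net_limit M a b (\<lambda>P. strat_sum3 i j k a b P P) (strat_iter3 M (W i) (W j) (W k) a b)"
proof -
  let ?Z = "\<lambda>P. strat_sum3 i j k a b P P"
  define C where "C d = 9 * ((b - a) * d\<^sup>2) + 6 * ((b - a)\<^sup>2 * d)" for d
  have C: "\<exists>d>0. C d < e" if "e > 0" for e
  proof -
    have "(C \<longlongrightarrow> C 0) (at_right 0)" unfolding C_def by (intro tendsto_intros)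
    then have "\<forall>\<^sub>F d in at_right 0. C d < e" using order_tendstoD(2)[of C "C 0" _ e] that by (simp add: C_def)
    then have "\<forall>\<^sub>F d in at_right 0. C d < e \<and> d > 0" using eventually_at_right_less[of 0] by (rule eventually_conj)
    then show ?thesis using eventually_happens by fastforce
  qed
  have mom: "all_moments M (?Z P)" if "partition_of a b P" for P
    using all_moments_strat_sum3[OF that that order.refl ab(1,3) i j k] .
  have meas: "?Z P \<in> borel_measurable M" if "partition_of a b P" for P
    using mom[OF that] by (rule all_moments_measurable)
  have "\<exists>I. net_limit M a b ?Z I"
  proof (rule net_limit_exists[OF ab(2) mom])
    fix e :: real assume "e > 0"
    then obtain d where d: "d > 0" "C d < e" using C by blast
    show "\<exists>d>0. \<forall>P R. partition_of a b P \<longrightarrow> partition_of a b R \<longrightarrow> P \<subseteq> R \<longrightarrow> mesh_below b P d \<longrightarrow>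
       expectation (\<lambda>\<omega>. (?Z P \<omega> - ?Z R \<omega>)\<^sup>2) < e"
      by (intro exI[of _ d] conjI allI impI d(1) le_less_trans[OF strat_sum3_dist[OF _ _ _ order.refl _ _ ab(1,3) i j k] d(2)[unfolded C_def]])
  qed
  then obtain I where I: "net_limit M a b ?Z I" by blast
  then have Im: "I \<in> borel_measurable M" by (simp add: net_limit_def)
  let ?S = "strat_sum3_exact i j k a b"
  have S: "net_limit M a b ?S I"
    unfolding net_limit_def
  proof (intro conjI allI impI Im)
    fix e :: real assume e: "e > 0"
    \<comment> \<open>2 times 4 times e / 16 is one half of e; 2 times e / 4 is the other.\<close>
    obtain d1 where d1: "d1 > 0" "C d1 < e / 16" using C[of "e / 16"] e by auto
    have "e / 4 > 0" using e by simp
    then obtain d2 where d2: "d2 > 0" "\<And>P. partition_of a b P \<Longrightarrow> mesh_below b P d2 \<Longrightarrow>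
       integrable M (\<lambda>\<omega>. (?Z P \<omega> - I \<omega>)\<^sup>2) \<and> expectation (\<lambda>\<omega>. (?Z P \<omega> - I \<omega>)\<^sup>2) < e / 4"
      using net_limitD[OF I] by blast
    show "\<exists>\<delta>>0. \<forall>P. partition_of a b P \<longrightarrow> mesh_below b P \<delta> \<longrightarrow>
        integrable M (\<lambda>\<omega>. (?S P \<omega> - I \<omega>)\<^sup>2) \<and> expectation (\<lambda>\<omega>. (?S P \<omega> - I \<omega>)\<^sup>2) < e"
    proof (intro exI[of _ "min d1 d2"] conjI allI impI)
      show "min d1 d2 > 0" using d1 d2 by simp
      fix P assume P: "partition_of a b P" "mesh_below b P (min d1 d2)"
      then have m: "mesh_below b P d1" "mesh_below b P d2" by (auto intro: mesh_below_mono)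
      note A = strat_sum3_exact_dist[OF P(1) m(1)]
      note B = d2(2)[OF P(1) m(2), THEN conjunct1] d2(2)[OF P(1) m(2), THEN conjunct2]
      note t = square_dist_triangle[OF strat_sum3_exact_measurable[OF P(1)] Im A(1) B(1)]
      show "integrable M (\<lambda>\<omega>. (?S P \<omega> - I \<omega>)\<^sup>2)" by (rule t(1))
      show "expectation (\<lambda>\<omega>. (?S P \<omega> - I \<omega>)\<^sup>2) < e"
        using t(2) A(2)[folded C_def] B(2) d1(2) by linarith
    qed
  qed
  let ?J = "\<lambda>s. strat2 i j a s"
  let ?S' = "\<lambda>n \<tau> \<omega>. \<Sum>k'<n. (?J (\<tau> k') \<omega> + ?J (\<tau> (Suc k')) \<omega>) / 2 * (W k (\<tau> (Suc k')) \<omega> - W k (\<tau> k') \<omega>)"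
  have eq: "?S' n \<tau> \<omega> = ?S (\<tau> ` {..n}) \<omega>" if "fine_partition a b \<delta> n \<tau>" for \<delta> n \<tau> \<omega>
    using fine_partition_set(3)[OF that, of "\<lambda>u v. (?J u \<omega> + ?J v \<omega>) / 2 * (W k v \<omega> - W k u \<omega>)"]
    unfolding strat_sum3_exact_def dW_def .
  have fine: "?S' n \<tau> \<in> borel_measurable M" "AE \<omega> in M. ?S' n \<tau> \<omega> = ?S (\<tau> ` {..n}) \<omega>"
    if f: "fine_partition a b \<delta> n \<tau>" for \<delta> n \<tau>
  proof -
    have "?S' n \<tau> = ?S (\<tau> ` {..n})" using eq[OF f] by (intro ext)
    then show "?S' n \<tau> \<in> borel_measurable M" "AE \<omega> in M. ?S' n \<tau> \<omega> = ?S (\<tau> ` {..n}) \<omega>"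
      using strat_sum3_exact_measurable[OF fine_partition_set(1)[OF f]] eq[OF f] by auto
  qed
  have *: "strat_integral M ?J (W k) a b \<in> borel_measurable M" "AE \<omega> in M. strat_integral M ?J (W k) a b \<omega> = I \<omega>"
    unfolding strat_integral_def[of M ?J]
    by (rule net_limit_SOME[OF ab(2) S fine strat_sum3_exact_measurable]; assumption)+
  have "strat_iter3 M (W i) (W j) (W k) a b = strat_integral M ?J (W k) a b"
    by (simp add: strat_iter3_def)
  moreover have "AE \<omega> in M. I \<omega> = strat_integral M ?J (W k) a b \<omega>"
    using *(2) by eventually_elim simp
  ultimately show ?thesis
    using net_limit_cong_AE[OF I _ *(1) meas] by simp
qed

end

end

section \<open>Legendre polynomials\<close>

lemma higher_pderiv_mult:
  fixes p q :: "real poly"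
  shows "(pderiv ^^ n) (p * q) = (\<Sum>k\<le>n. smult (of_nat (n choose k)) ((pderiv ^^ k) p * (pderiv ^^ (n - k)) q))"
proof (induction n)
  case (Suc n)
  define a where "a k = (pderiv ^^ k) p" for k
  define b where "b k = (pderiv ^^ k) q" for k
  have da: "pderiv (a k) = a (Suc k)" and db: "pderiv (b k) = b (Suc k)" for k
    by (simp_all add: a_def b_def)
  have "(pderiv ^^ Suc n) (p * q) = (\<Sum>k\<le>n. smult (of_nat (n choose k)) (a (Suc k) * b (n - k) + a k * b (Suc (n - k))))"
    using Suc by (simp add: higher_pderiv_sum[of 1, simplified] pderiv_smult pderiv_mult a_def[symmetric] b_def[symmetric] da db algebra_simps)
  also have "\<dots> = (\<Sum>k\<le>n. smult (of_nat (n choose k)) (a (Suc k) * b (n - k)))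
     + (\<Sum>k\<le>n. smult (of_nat (n choose k)) (a k * b (Suc n - k)))"
    by (simp add: sum.distrib smult_add_right Suc_diff_le)
  also have "(\<Sum>k\<le>n. smult (of_nat (n choose k)) (a k * b (Suc n - k)))
     = (\<Sum>k\<le>Suc n. smult (of_nat (n choose k)) (a k * b (Suc n - k)))"
    by (simp add: binomial_eq_0)
  also have "\<dots> = a 0 * b (Suc n) + (\<Sum>k\<le>n. smult (of_nat (n choose Suc k)) (a (Suc k) * b (n - k)))"
    by (subst sum.atMost_Suc_shift) simp
  also have "(\<Sum>k\<le>n. smult (of_nat (n choose k)) (a (Suc k) * b (n - k)))
     + (a 0 * b (Suc n) + (\<Sum>k\<le>n. smult (of_nat (n choose Suc k)) (a (Suc k) * b (n - k))))
     = (\<Sum>k\<le>Suc n. smult (of_nat (Suc n choose k)) (a k * b (Suc n - k)))"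
    by (subst sum.atMost_Suc_shift) (simp add: sum.distrib smult_add_left)
  finally show ?case by (simp add: a_def b_def)
qed simp

lemma higher_pderiv_linear_power:
  fixes c :: real
  assumes "k \<le> n"
  shows "(pderiv ^^ k) ([:c, 1:] ^ n) = smult (fact n / fact (n - k)) ([:c, 1:] ^ (n - k))"
  using assms
proof (induction k)
  case (Suc k)
  then obtain l where l: "n - k = Suc l" "n - Suc k = l" by (cases "n - k") auto
  have "(pderiv ^^ Suc k) ([:c, 1:] ^ n) = smult (fact n / fact (Suc l)) (pderiv ([:c, 1:] ^ Suc l))"
    using Suc l by (simp add: pderiv_smult del: fact_Suc power_Suc)
  also have "\<dots> = smult (fact n / fact l) ([:c, 1:] ^ l)"
    by (simp add: pderiv_power_Suc pderiv_pCons del: power_Suc)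
  finally show ?case using l by simp
qed simp

text \<open>This is (x^2 - 1)^n, kept as a product so that the Leibniz rule reproduces the binomial
  sum in \<open>legendre_poly\<close>.\<close>

definition rodrigues_base :: "nat \<Rightarrow> real poly" where
  "rodrigues_base n = [:-1, 1:] ^ n * [:1, 1:] ^ n"

definition legendreP :: "nat \<Rightarrow> real poly" where
  "legendreP n = smult (1 / (2 ^ n * fact n)) ((pderiv ^^ n) (rodrigues_base n))"

text \<open>Rodrigues' formula. In the Leibniz rule the derivatives of the two powers contribute
  n!/(n-k)! and n!/k!, whose product is n! times another binomial coefficient.\<close>

lemma poly_legendreP: "poly (legendreP n) x = legendre_poly n x"
proof -
  have summand: "real (n choose k) * (fact n / fact (n - k) * (x - 1) ^ (n - k) * (fact n / fact k * (x + 1) ^ k))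
     = fact n * ((real (n choose k))\<^sup>2 * (x - 1) ^ (n - k) * (x + 1) ^ k)" if "k \<le> n" for k
    using binomial_fact[OF that, where 'a = real] by (simp add: power2_eq_square field_simps)
  have "poly ((pderiv ^^ n) (rodrigues_base n)) x
    = (\<Sum>k\<le>n. real (n choose k) * (fact n / fact (n - k) * (x - 1) ^ (n - k) * (fact n / fact k * (x + 1) ^ k)))"
    unfolding rodrigues_base_def higher_pderiv_mult poly_sum
    by (intro sum.cong refl) (simp add: higher_pderiv_linear_power algebra_simps)
  also have "\<dots> = fact n * (\<Sum>k\<le>n. (real (n choose k))\<^sup>2 * (x - 1) ^ (n - k) * (x + 1) ^ k)"
    unfolding sum_distrib_left using summand by (intro sum.cong refl) auto
  finally show ?thesis by (simp add: legendreP_def legendre_poly_def)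
qed

section \<open>Polynomial integrals over [-1, 1] and orthogonality\<close>

lemma integral_pderiv:
  "a \<le> b \<Longrightarrow> integral {a..b} (poly (pderiv p)) = poly p b - poly p (a :: real)"
  by (intro integral_unique fundamental_theorem_of_calculus)
     (auto intro!: DERIV_subset[OF poly_DERIV] simp: has_real_derivative_iff_has_vector_derivative[symmetric])

lemma poly_integrable [simp]: "poly p integrable_on {a..b::real}"
  by (intro integrable_continuous_interval continuous_intros)

definition pint :: "real poly \<Rightarrow> real" where
  "pint p = integral {-1..1} (poly p)"

lemma pint_pderiv: "pint (pderiv p) = poly p 1 - poly p (-1)"
  by (simp add: pint_def integral_pderiv)

lemma pint_add: "pint (p + q) = pint p + pint q"
proof -
  have "poly (p + q) = (\<lambda>x. poly p x + poly q x)" by auto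
  then show ?thesis unfolding pint_def by (simp add: Henstock_Kurzweil_Integration.integral_add)
qed

lemma pint_smult: "pint (smult c p) = c * pint p"
proof -
  have "poly (smult c p) = (\<lambda>x. c * poly p x)" by auto
  then show ?thesis unfolding pint_def by simp
qed

lemma pint_0: "pint 0 = 0"
  using pint_smult[of 0 0] by simp

lemma pint_by_parts:
  assumes "poly p (-1) * poly q (-1) = 0" "poly p 1 * poly q 1 = 0"
  shows "pint (pderiv p * q) = - pint (p * pderiv q)"
  using pint_pderiv[of "p * q"] assms by (simp add: pderiv_mult pint_add mult.commute)

text \<open>With fewer than n derivatives every Leibniz term still contains both linear
  factors.\<close>

lemma rodrigues_base_vanish:
  assumes "k < n"
  shows "poly ((pderiv ^^ k) (rodrigues_base n)) 1 = 0" "poly ((pderiv ^^ k) (rodrigues_base n)) (-1) = 0"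
proof -
  have "poly ((pderiv ^^ k) (rodrigues_base n)) x = (\<Sum>l\<le>k. real (k choose l) *
     (fact n / fact (n - l) * (x - 1) ^ (n - l) * (fact n / fact (n - (k - l)) * (x + 1) ^ (n - (k - l)))))" for x
    unfolding rodrigues_base_def higher_pderiv_mult poly_sum
    using assms by (intro sum.cong refl) (simp add: higher_pderiv_linear_power algebra_simps)
  then show "poly ((pderiv ^^ k) (rodrigues_base n)) 1 = 0" "poly ((pderiv ^^ k) (rodrigues_base n)) (-1) = 0"
    using assms by (auto intro!: sum.neutral)
qed

lemma integral_rodrigues:
  assumes "k \<le> n"
  shows "pint ((pderiv ^^ n) (rodrigues_base n) * q)
    = (-1) ^ k * pint ((pderiv ^^ (n - k)) (rodrigues_base n) * (pderiv ^^ k) q)"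
  using assms
proof (induction k)
  case (Suc k)
  then obtain l where l: "n - k = Suc l" "n - Suc k = l" "l < n" by (cases "n - k") auto
  have "pint ((pderiv ^^ Suc l) (rodrigues_base n) * (pderiv ^^ k) q)
     = - pint ((pderiv ^^ l) (rodrigues_base n) * (pderiv ^^ Suc k) q)"
    using pint_by_parts[of "(pderiv ^^ l) (rodrigues_base n)" "(pderiv ^^ k) q"]
      rodrigues_base_vanish[OF l(3)] by simp
  then show ?case using Suc l by simp
qed simp

text \<open>A Beta integral, by parts: each step moves one power from x - 1 to x + 1. The sign comes
  from x - 1 being negative on the interval.\<close>

lemma integral_shifted_powers:
  "pint ([:-1, 1:] ^ p * [:1, 1:] ^ q) =
     (-1) ^ p * fact p * fact q * 2 ^ (p + q + 1) / (fact (p + q + 1) :: real)"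
proof (induction p arbitrary: q)
  case 0
  have "pderiv (smult (1 / real (Suc q)) ([:1, 1:] ^ Suc q)) = [:1, 1:] ^ q"
    by (simp add: pderiv_smult pderiv_power_Suc pderiv_pCons del: power_Suc of_nat_Suc)
  with pint_pderiv[of "smult (1 / real (Suc q)) ([:1, 1:] ^ Suc q)"]
  have "pint ([:1, 1:] ^ q) = 2 ^ Suc q / real (Suc q)" by simp
  then show ?case by (simp del: of_nat_Suc)
next
  case (Suc p)
  define f where "f = smult (1 / real (Suc q)) ([:1, 1:] ^ Suc q)"
  have f: "pderiv f = [:1, 1:] ^ q"
    by (simp add: f_def pderiv_smult pderiv_power_Suc pderiv_pCons del: power_Suc of_nat_Suc)
  have "pint (pderiv f * [:-1, 1:] ^ Suc p) = - pint (f * pderiv ([:-1, 1:] ^ Suc p))"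
    by (rule pint_by_parts) (simp_all add: f_def)
  also have "f * pderiv ([:-1, 1:] ^ Suc p) = smult (real (Suc p) / real (Suc q)) ([:-1, 1:] ^ p * [:1, 1:] ^ Suc q)"
    by (simp add: f_def pderiv_power_Suc pderiv_pCons mult_ac del: power_Suc of_nat_Suc)
  finally have "pint ([:-1, 1:] ^ Suc p * [:1, 1:] ^ q)
     = - (real (Suc p) / real (Suc q)) * pint ([:-1, 1:] ^ p * [:1, 1:] ^ Suc q)"
    unfolding f by (simp add: mult.commute[of "[:1, 1:] ^ q"] pint_smult del: power_Suc of_nat_Suc)
  also have "\<dots> = (-1) ^ Suc p * fact (Suc p) * fact q * 2 ^ (Suc p + q + 1) / fact (Suc p + q + 1)"
  proof -
    have e: "p + Suc q + 1 = Suc p + q + 1" by simp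
    have "- (real (Suc p) / real (Suc q)) * ((-1) ^ p * fact p * fact (Suc q) * X) = (-1) ^ Suc p * fact (Suc p) * fact q * X" for X
      by (simp add: mult_ac del: of_nat_Suc)
    from this[of "2 ^ (Suc p + q + 1) / fact (Suc p + q + 1)"] show ?thesis
      unfolding Suc.IH e times_divide_eq_right .
  qed
  finally show ?case .
qed

lemma degree_rodrigues_base: "degree (rodrigues_base n) = 2 * n" and lead_coeff_rodrigues_base: "coeff (rodrigues_base n) (2 * n) = 1"
proof -
  have "degree ([:c, 1:] ^ n) = n" for c :: real by (simp add: degree_power_eq)
  then show d: "degree (rodrigues_base n) = 2 * n"
    by (simp add: rodrigues_base_def degree_mult_eq)
  show "coeff (rodrigues_base n) (2 * n) = 1"
    unfolding d[symmetric] by (simp add: rodrigues_base_def lead_coeff_mult lead_coeff_power)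
qed

lemma degree_legendreP: "degree (legendreP n) = n"
  by (simp add: legendreP_def degree_higher_pderiv degree_rodrigues_base)

lemma legendreP_nz: "legendreP n \<noteq> 0"
proof (cases n)
  case 0 then show ?thesis by (simp add: legendreP_def rodrigues_base_def)
next
  case (Suc k) then show ?thesis using degree_legendreP[of n] by auto
qed

lemma integral_legendreP_lower:
  assumes "degree q < n"
  shows "pint (legendreP n * q) = 0"
proof -
  have "(pderiv ^^ n) q = 0"
    using assms by (intro poly_eqI) (simp add: coeff_higher_pderiv coeff_eq_0)
  then have "pint ((pderiv ^^ n) (rodrigues_base n) * q) = 0"
    using integral_rodrigues[of n n q] by (simp add: pint_0)
  then show ?thesis by (simp add: legendreP_def pint_smult)
qed

text \<open>Moving all n derivatives onto the other factor leaves the 2n-th derivative of a monic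
  polynomial of degree 2n, the constant (2n)!, times a Beta integral.\<close>

lemma integral_legendreP_square:
  "pint (legendreP n * legendreP n) = 2 / (2 * real n + 1)"
proof -
  let ?w = "rodrigues_base n"
  have top: "(pderiv ^^ n) ((pderiv ^^ n) ?w) = [:fact (2 * n):]"
  proof (rule poly_eqI)
    fix k
    have "(pderiv ^^ n) ((pderiv ^^ n) ?w) = (pderiv ^^ (2 * n)) ?w" by (simp add: funpow_add mult_2)
    then show "coeff ((pderiv ^^ n) ((pderiv ^^ n) ?w)) k = coeff [:fact (2 * n):] k"
      using lead_coeff_rodrigues_base[of n]
      by (cases k) (simp_all add: coeff_higher_pderiv pochhammer_fact coeff_eq_0 degree_rodrigues_base)
  qed
  have "pint ((pderiv ^^ n) ?w * (pderiv ^^ n) ?w)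
     = (-1) ^ n * pint (?w * [:fact (2 * n):])"
    using integral_rodrigues[of n n "(pderiv ^^ n) ?w"] by (simp add: top)
  also have "\<dots> = (-1) ^ n * fact (2 * n) * pint ?w"
    by (simp add: pint_smult)
  also have "pint ?w = (-1) ^ n * fact n * fact n * 2 ^ (2 * n + 1) / fact (2 * n + 1)"
    using integral_shifted_powers[of n n] unfolding rodrigues_base_def mult_2[symmetric] .
  finally have *: "pint ((pderiv ^^ n) ?w * (pderiv ^^ n) ?w)
    = (-1) ^ n * fact (2 * n) * ((-1) ^ n * fact n * fact n * 2 ^ (2 * n + 1) / fact (2 * n + 1))" .
  have sq1: "(-1) ^ n * (-1) ^ n = (1 :: real)" by (simp flip: power_mult_distrib)
  have quot: "fact (2 * n) / fact (2 * n + 1) = (1 / (2 * real n + 1) :: real)"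
  proof -
    have "(fact (2 * n + 1) :: real) = (2 * real n + 1) * fact (2 * n)" by simp
    then show ?thesis by (simp only: divide_simps) simp
  qed
  have "pint ((pderiv ^^ n) ?w * (pderiv ^^ n) ?w)
    = ((-1) ^ n * (-1) ^ n) * (fact (2 * n) / fact (2 * n + 1)) * ((fact n)\<^sup>2 * 2 ^ (2 * n + 1))"
    unfolding * by (simp only: power2_eq_square times_divide_eq_right times_divide_eq_left mult_ac)
  then have "pint ((pderiv ^^ n) ?w * (pderiv ^^ n) ?w) = (fact n)\<^sup>2 * 2 ^ (2 * n + 1) / (2 * real n + 1)"
    unfolding sq1 quot by simp
  moreover have "pint (legendreP n * legendreP n)
     = 1 / (2 ^ n * fact n)\<^sup>2 * pint ((pderiv ^^ n) ?w * (pderiv ^^ n) ?w)"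
    by (simp add: legendreP_def power2_eq_square pint_smult)
  ultimately show ?thesis
    by (simp add: power_mult_distrib power_mult[symmetric] mult.commute[of n 2])
qed

lemma integral_legendreP:
  "pint (legendreP i * legendreP j) = (if i = j then 2 / (2 * real i + 1) else 0)"
  using integral_legendreP_lower[of "legendreP i" j] integral_legendreP_lower[of "legendreP j" i]
    integral_legendreP_square[of i]
  by (cases i j rule: linorder_cases) (simp_all add: degree_legendreP mult.commute)

lemma legendreP_span:
  assumes "degree q \<le> n"
  shows "\<exists>c. q = (\<Sum>j\<le>n. smult (c j) (legendreP j))"
  using assms
proof (induction n arbitrary: q)
  case 0
  then obtain a where "q = [:a:]" by (metis degree_eq_zeroE le_zero_eq)
  moreover have "legendreP 0 = 1" by (simp add: legendreP_def rodrigues_base_def)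
  ultimately show ?case by (intro exI[of _ "\<lambda>_. a"]) (simp add: one_pCons)
next
  case (Suc n)
  define a where "a = coeff q (Suc n) / coeff (legendreP (Suc n)) (Suc n)"
  have lc: "coeff (legendreP (Suc n)) (Suc n) \<noteq> 0"
    using legendreP_nz[of "Suc n"] degree_legendreP[of "Suc n"] leading_coeff_0_iff[of "legendreP (Suc n)"] by simp
  have "degree (q - smult a (legendreP (Suc n))) \<le> n"
  proof (rule degree_le, intro allI impI)
    fix i assume i: "n < i"
    show "coeff (q - smult a (legendreP (Suc n))) i = 0"
    proof (cases "i = Suc n")
      case True then show ?thesis using lc by (simp add: a_def)
    next
      case False then show ?thesis using i Suc.prems degree_legendreP[of "Suc n"] by (simp add: coeff_eq_0)
    qed
  qed
  from Suc.IH[OF this] obtain c where c: "q - smult a (legendreP (Suc n)) = (\<Sum>j\<le>n. smult (c j) (legendreP j))" by blast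
  have "q = (\<Sum>j\<le>Suc n. smult ((c(Suc n := a)) j) (legendreP j))"
    using c by (simp add: algebra_simps)
  then show ?case by blast
qed

section \<open>Legendre expansions on an interval\<close>

text \<open>Boundedness is asked on \<open>space N\<close> only, as polynomials are unbounded on the
  whole line. The class is closed under ring operations, which settles integrability on finite
  measure spaces.\<close>

definition bdd_meas :: "'a measure \<Rightarrow> ('a \<Rightarrow> real) \<Rightarrow> bool" where
  "bdd_meas N f \<longleftrightarrow> f \<in> borel_measurable N \<and> (\<exists>B. \<forall>x\<in>space N. \<bar>f x\<bar> \<le> B)"

lemma bdd_measI: "f \<in> borel_measurable N \<Longrightarrow> (\<And>x. x \<in> space N \<Longrightarrow> \<bar>f x\<bar> \<le> B) \<Longrightarrow> bdd_meas N f"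
  by (auto simp: bdd_meas_def)

lemma bdd_meas_measurable [measurable_dest]: "bdd_meas N f \<Longrightarrow> f \<in> borel_measurable N"
  by (simp add: bdd_meas_def)

lemma bdd_meas_integrable: "finite_measure N \<Longrightarrow> bdd_meas N f \<Longrightarrow> integrable N f"
  unfolding bdd_meas_def by (auto intro!: finite_measure.integrable_const_bound AE_I2)

lemma bdd_meas_const: "bdd_meas N (\<lambda>_. c)"
  by (rule bdd_measI[of _ _ "\<bar>c\<bar>"]) auto

lemma bdd_meas_add: "bdd_meas N f \<Longrightarrow> bdd_meas N g \<Longrightarrow> bdd_meas N (\<lambda>x. f x + g x)"
proof -
  assume f: "bdd_meas N f" and g: "bdd_meas N g"
  obtain A B where "\<forall>x\<in>space N. \<bar>f x\<bar> \<le> A" "\<forall>x\<in>space N. \<bar>g x\<bar> \<le> B" using f g by (auto simp: bdd_meas_def)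
  then show ?thesis using f g
    by (intro bdd_measI[of _ _ "A + B"]) (auto intro!: order_trans[OF abs_triangle_ineq] add_mono simp: bdd_meas_def)
qed

lemma bdd_meas_mult: "bdd_meas N f \<Longrightarrow> bdd_meas N g \<Longrightarrow> bdd_meas N (\<lambda>x. f x * g x)"
proof -
  assume f: "bdd_meas N f" and g: "bdd_meas N g"
  obtain A B where "\<forall>x\<in>space N. \<bar>f x\<bar> \<le> A" "\<forall>x\<in>space N. \<bar>g x\<bar> \<le> B" using f g by (auto simp: bdd_meas_def)
  then show ?thesis using f g
    by (intro bdd_measI[of _ _ "\<bar>A\<bar> * \<bar>B\<bar>"])
       (auto simp: bdd_meas_def abs_mult intro!: mult_mono intro: order_trans[OF _ abs_ge_self])
qed

lemma bdd_meas_diff: "bdd_meas N f \<Longrightarrow> bdd_meas N g \<Longrightarrow> bdd_meas N (\<lambda>x. f x - g x)"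
  using bdd_meas_add[of N f "\<lambda>x. (-1) * g x"] bdd_meas_mult[OF bdd_meas_const[of N "-1"], of g] by simp

lemma bdd_meas_power2: "bdd_meas N f \<Longrightarrow> bdd_meas N (\<lambda>x. (f x)\<^sup>2)"
  using bdd_meas_mult[of N f f] by (simp add: power2_eq_square)

lemma bdd_meas_sum: "(\<And>i. i \<in> I \<Longrightarrow> bdd_meas N (f i)) \<Longrightarrow> bdd_meas N (\<lambda>x. \<Sum>i\<in>I. f i x)"
  by (induction I rule: infinite_finite_induct) (auto intro: bdd_meas_add bdd_meas_const)

lemmas bdd_intros = bdd_meas_sum bdd_meas_power2 bdd_meas_diff bdd_meas_add bdd_meas_mult bdd_meas_const

lemma orthonormal_expansion:
  fixes f :: "'a \<Rightarrow> real"
  assumes N: "finite_measure N" and S: "finite S" and e: "\<And>a. a \<in> S \<Longrightarrow> bdd_meas N (e a)" and f: "bdd_meas N f"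
    and on: "\<And>a b. a \<in> S \<Longrightarrow> b \<in> S \<Longrightarrow> (\<integral>x. e a x * e b x \<partial>N) = (if a = b then 1 else 0)"
  shows "(\<integral>x. (f x - (\<Sum>a\<in>S. c a * e a x))\<^sup>2 \<partial>N)
    = (\<integral>x. (f x)\<^sup>2 \<partial>N) - 2 * (\<Sum>a\<in>S. c a * (\<integral>x. f x * e a x \<partial>N)) + (\<Sum>a\<in>S. (c a)\<^sup>2)"
proof -
  note int = bdd_meas_integrable[OF N]
  have "(\<integral>x. (f x - (\<Sum>a\<in>S. c a * e a x))\<^sup>2 \<partial>N)
     = (\<integral>x. (f x)\<^sup>2 - 2 * (\<Sum>a\<in>S. c a * (f x * e a x)) + (\<Sum>a\<in>S. \<Sum>b\<in>S. c a * c b * (e a x * e b x)) \<partial>N)"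
  proof (intro Bochner_Integration.integral_cong refl)
    fix x
    have 1: "(\<Sum>a\<in>S. \<Sum>b\<in>S. c a * c b * (e a x * e b x)) = (\<Sum>a\<in>S. c a * e a x)\<^sup>2"
      by (simp add: power2_eq_square sum_product mult_ac)
    have 2: "(\<Sum>a\<in>S. c a * (f x * e a x)) = f x * (\<Sum>a\<in>S. c a * e a x)"
      by (simp add: sum_distrib_left mult_ac)
    show "(f x - (\<Sum>a\<in>S. c a * e a x))\<^sup>2 = (f x)\<^sup>2 - 2 * (\<Sum>a\<in>S. c a * (f x * e a x))
      + (\<Sum>a\<in>S. \<Sum>b\<in>S. c a * c b * (e a x * e b x))"
      unfolding 1 2 by (simp add: power2_diff)
  qed
  also have "\<dots> = (\<integral>x. (f x)\<^sup>2 \<partial>N) - 2 * (\<integral>x. (\<Sum>a\<in>S. c a * (f x * e a x)) \<partial>N)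
     + (\<integral>x. (\<Sum>a\<in>S. \<Sum>b\<in>S. c a * c b * (e a x * e b x)) \<partial>N)"
    using e f by (subst Bochner_Integration.integral_add; (subst Bochner_Integration.integral_diff)?)
      (auto intro!: int bdd_intros)
  also have "(\<integral>x. (\<Sum>a\<in>S. c a * (f x * e a x)) \<partial>N) = (\<Sum>a\<in>S. c a * (\<integral>x. f x * e a x \<partial>N))"
    using e f by (subst Bochner_Integration.integral_sum) (auto intro!: int bdd_intros)
  also have "(\<integral>x. (\<Sum>a\<in>S. \<Sum>b\<in>S. c a * c b * (e a x * e b x)) \<partial>N) = (\<Sum>a\<in>S. \<Sum>b\<in>S. c a * c b * (if a = b then 1 else 0))"
  proof (subst Bochner_Integration.integral_sum)
    show "integrable N (\<lambda>x. \<Sum>b\<in>S. c a * c b * (e a x * e b x))" if "a \<in> S" for a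
      using e that by (auto intro!: int bdd_intros)
    show "(\<Sum>a\<in>S. \<integral>x. (\<Sum>b\<in>S. c a * c b * (e a x * e b x)) \<partial>N) = (\<Sum>a\<in>S. \<Sum>b\<in>S. c a * c b * (if a = b then 1 else 0))"
    proof (rule sum.cong[OF refl])
      fix a assume a: "a \<in> S"
      show "(\<integral>x. (\<Sum>b\<in>S. c a * c b * (e a x * e b x)) \<partial>N) = (\<Sum>b\<in>S. c a * c b * (if a = b then 1 else 0))"
        using e a on by (subst Bochner_Integration.integral_sum) (auto intro!: int bdd_intros sum.cong)
    qed
  qed
  also have "\<dots> = (\<Sum>a\<in>S. (c a)\<^sup>2)"
    using S by (simp add: if_distrib[of "\<lambda>y. _ * y"] sum.delta power2_eq_square cong: if_cong)
  finally show ?thesis .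
qed

text \<open>The coefficients c are arbitrary: the error is that of the orthogonal projection plus
  the squared deviation of c from the Fourier coefficients d. \<open>trace_norm\<close> relies on
  this freedom, its coefficients being perturbed.\<close>

lemma orthonormal_remainder:
  fixes f :: "'a \<Rightarrow> real"
  assumes N: "finite_measure N" and S: "finite S" and e: "\<And>a. a \<in> S \<Longrightarrow> bdd_meas N (e a)" and f: "bdd_meas N f"
    and on: "\<And>a b. a \<in> S \<Longrightarrow> b \<in> S \<Longrightarrow> (\<integral>x. e a x * e b x \<partial>N) = (if a = b then 1 else 0)"
  defines "d \<equiv> \<lambda>a. \<integral>x. f x * e a x \<partial>N"
  shows "(\<integral>x. (f x - (\<Sum>a\<in>S. c a * e a x))\<^sup>2 \<partial>N)
    = (\<integral>x. (f x)\<^sup>2 \<partial>N) - (\<Sum>a\<in>S. (d a)\<^sup>2) + (\<Sum>a\<in>S. (c a - d a)\<^sup>2)"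
  using orthonormal_expansion[where N = N and S = S and e = e and f = f and c = c, OF N S e f on]
  unfolding d_def by (simp add: power2_diff sum.distrib sum_subtractf sum_distrib_left mult_ac)

lemma bessel:
  fixes f :: "'a \<Rightarrow> real"
  assumes N: "finite_measure N" and S: "finite S" and e: "\<And>a. a \<in> S \<Longrightarrow> bdd_meas N (e a)" and f: "bdd_meas N f"
    and on: "\<And>a b. a \<in> S \<Longrightarrow> b \<in> S \<Longrightarrow> (\<integral>x. e a x * e b x \<partial>N) = (if a = b then 1 else 0)"
  shows "(\<Sum>a\<in>S. (\<integral>x. f x * e a x \<partial>N)\<^sup>2) \<le> (\<integral>x. (f x)\<^sup>2 \<partial>N)"
proof -
  have "0 \<le> (\<integral>x. (f x - (\<Sum>a\<in>S. (\<integral>x. f x * e a x \<partial>N) * e a x))\<^sup>2 \<partial>N)" by simp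
  then show ?thesis
    using orthonormal_remainder[where N = N and S = S and e = e and f = f and c = "\<lambda>a. \<integral>x. f x * e a x \<partial>N", OF N S e f on]
    by simp
qed

section \<open>The interval [t, T), its Legendre system and Parseval remainders\<close>

locale interval =
  fixes t T :: real
  assumes tT: "t < T"
begin

text \<open>The right end is left out so that every point of the space lies in a cell of each
  partition of [t, T].\<close>

definition \<mu> :: "real measure" where "\<mu> = restrict_space lborel {t..<T}"

abbreviation \<phi> :: "nat \<Rightarrow> real \<Rightarrow> real" where "\<phi> \<equiv> legendre_phi t T"

lemma space_\<mu> [simp]: "space \<mu> = {t..<T}"
  by (simp add: \<mu>_def space_restrict_space)

lemma measurable_\<mu>: "f \<in> borel_measurable borel \<Longrightarrow> f \<in> borel_measurable \<mu>"
  unfolding \<mu>_def by (intro measurable_restrict_space1) simp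

lemma finite_\<mu>: "finite_measure \<mu>"
proof
  have "emeasure \<mu> (space \<mu>) = ennreal (T - t)"
    using tT unfolding \<mu>_def by (subst emeasure_restrict_space) (auto simp: space_restrict_space)
  then show "emeasure \<mu> (space \<mu>) \<noteq> \<infinity>" by simp
qed

sublocale \<mu>: finite_measure \<mu> by (rule finite_\<mu>)

lemma continuous_bdd_meas:
  assumes "continuous_on {t..T} f" shows "bdd_meas \<mu> f"
proof -
  have "f \<in> borel_measurable (restrict_space borel {t..<T})"
    using assms by (intro borel_measurable_continuous_on_restrict) (auto elim: continuous_on_subset)
  then have "f \<in> borel_measurable \<mu>"
    unfolding \<mu>_def by (subst measurable_cong_sets[OF sets_restrict_space_cong[OF sets_lborel] refl])
  moreover have "bounded (f ` {t..T})"
    using assms by (intro compact_imp_bounded compact_continuous_image) auto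
  moreover obtain B where "\<forall>x\<in>{t..T}. \<bar>f x\<bar> \<le> B" using calculation(2) by (auto simp: bounded_iff)
  ultimately show ?thesis
    by (intro bdd_measI[of _ _ B]) auto
qed

lemma integral_\<mu>_interval:
  fixes f :: "real \<Rightarrow> real"
  assumes f: "continuous_on {t..T} f" and u: "u \<in> {t..T}"
  shows "(\<integral>x. f x * indicator {..u} x \<partial>\<mu>) = integral {t..u} f"
proof -
  have "(\<integral>x. f x * indicator {..u} x \<partial>\<mu>) = (\<integral>x. indicator {t..<T} x *\<^sub>R (f x * indicator {..u} x) \<partial>lborel)"
    unfolding \<mu>_def by (rule integral_restrict_space) simp
  also have "\<dots> = (\<integral>x. indicator {t..u} x *\<^sub>R f x \<partial>lborel)"
  proof (rule integral_cong_AE)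
    have "continuous_on {t..u} f" using f u by (auto elim: continuous_on_subset)
    then show "(\<lambda>x. indicator {t..u} x *\<^sub>R f x) \<in> borel_measurable lborel"
      using borel_integrable_compact[of "{t..u}" f] by auto
    have "(\<lambda>x. indicator {t..T} x *\<^sub>R f x) \<in> borel_measurable lborel"
      using borel_integrable_compact[of "{t..T}" f] f by auto
    then have "(\<lambda>x. (indicator {t..T} x *\<^sub>R f x) * (indicator {t..<T} x * indicator {..u} x)) \<in> borel_measurable lborel"
      by measurable
    also have "(\<lambda>x. (indicator {t..T} x *\<^sub>R f x) * (indicator {t..<T} x * indicator {..u} x))
      = (\<lambda>x. indicator {t..<T} x *\<^sub>R (f x * indicator {..u} x))"
      by (auto simp: indicator_def)
    finally show "(\<lambda>x. indicator {t..<T} x *\<^sub>R (f x * indicator {..u} x)) \<in> borel_measurable lborel" .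
    have "AE x in lborel. x \<noteq> T" by (rule AE_lborel_singleton)
    then show "AE x in lborel. indicator {t..<T} x *\<^sub>R (f x * indicator {..u} x) = indicator {t..u} x *\<^sub>R f x"
      by eventually_elim (use u in \<open>auto simp: indicator_def\<close>)
  qed
  also have "\<dots> = integral {t..u} f"
    using set_borel_integral_eq_integral(2)[of "{t..u}" f] borel_integrable_compact[of "{t..u}" f]
      continuous_on_subset[OF f, of "{t..u}"] u
    by (simp add: set_integrable_def set_lebesgue_integral_def)
  finally show ?thesis .
qed

lemma integral_\<mu>:
  fixes f :: "real \<Rightarrow> real"
  assumes f: "continuous_on {t..T} f"
  shows "(\<integral>x. f x \<partial>\<mu>) = integral {t..T} f"
proof -
  have "(\<integral>x. f x \<partial>\<mu>) = (\<integral>x. f x * indicator {..T} x \<partial>\<mu>)"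
    by (intro Bochner_Integration.integral_cong refl) (auto simp: indicator_def)
  then show ?thesis using integral_\<mu>_interval[OF f, of T] tT by simp
qed

lemma AE_\<mu>_neq: "AE x in \<mu>. x \<noteq> c"
  unfolding \<mu>_def using AE_lborel_singleton[of c] by (subst AE_restrict_space_iff) auto

lemma phi_poly: "\<phi> j s = poly (smult (sqrt ((2 * real j + 1) / (T - t))) (legendreP j)) ((s - (T + t) / 2) * (2 / (T - t)))"
  by (simp add: legendre_phi_def poly_legendreP)

lemma continuous_phi: "continuous_on A (\<phi> j)"
  unfolding phi_poly[abs_def] by (intro continuous_intros)

lemma bdd_phi: "bdd_meas \<mu> (\<phi> j)"
  by (intro continuous_bdd_meas continuous_phi)

lemma phi_orthonormal: "(\<integral>x. \<phi> i x * \<phi> j x \<partial>\<mu>) = (if i = j then 1 else 0)"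
proof -
  let ?c = "\<lambda>j. sqrt ((2 * real j + 1) / (T - t))"
  let ?p = "legendreP i * legendreP j"
  define k where "k = 2 / (T - t)"
  have k: "k > 0" using tT by (simp add: k_def)
  have "(poly ?p has_integral pint ?p) (cbox (-1) 1)"
    unfolding pint_def box_real by (rule integrable_integral) simp
  \<comment> \<open>The shift for which k x + c is the argument of the Legendre polynomial in
    \<open>\<phi>\<close>, carrying [t, T] onto [-1, 1].\<close>
  define c where "c = - ((T + t) / 2 * k)"
  note I0 = has_integral_affinity'[OF \<open>(poly ?p has_integral pint ?p) (cbox (-1) 1)\<close> k, of c]
  have ends: "(-1 - c) /\<^sub>R k = t" "(1 - c) /\<^sub>R k = T"
    using tT by (simp_all add: c_def k_def field_simps)
  have arg: "k *\<^sub>R x + c = (x - (T + t) / 2) * k" for x by (simp add: c_def algebra_simps)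
  have val: "pint ?p /\<^sub>R k ^ DIM(real) = pint ?p / k" by (simp add: divide_inverse)
  have I: "((\<lambda>x. poly ?p ((x - (T + t) / 2) * k)) has_integral pint ?p / k) {t..T}"
    using I0 unfolding ends arg val box_real .
  have "(\<integral>x. \<phi> i x * \<phi> j x \<partial>\<mu>) = integral {t..T} (\<lambda>x. \<phi> i x * \<phi> j x)"
    by (intro integral_\<mu> continuous_intros continuous_phi)
  also have "\<dots> = integral {t..T} (\<lambda>x. (?c i * ?c j) * poly ?p ((x - (T + t) / 2) * k))"
    by (simp add: phi_poly k_def mult_ac)
  also have "\<dots> = (?c i * ?c j) * (pint ?p / k)"
    using I by (simp only: integral_mult_right integral_unique[OF I])
  also have "\<dots> = (if i = j then 1 else 0)"
  proof -
    have "a / L * (2 / a / (2 / L)) = 1" if "a > 0" "L > 0" for a L :: real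
      using that by (simp add: field_simps)
    from this[of "2 * real i + 1" "T - t"] show ?thesis
      using tT by (simp add: integral_legendreP k_def) (simp add: field_simps)
  qed
  finally show ?thesis .
qed

lemma polynomial_span:
  fixes q :: "real poly"
  shows "\<exists>c. \<forall>x. poly q x = (\<Sum>j\<le>degree q. c j * \<phi> j x)"
proof -
  define k where "k = 2 / (T - t)"
  have k: "k > 0" using tT by (simp add: k_def)
  \<comment> \<open>q composed with the inverse of the affine map inside \<open>\<phi>\<close>, so
    that an expansion of r in \<open>legendreP\<close> becomes one of q in
    \<open>\<phi>\<close>.\<close>
  define r where "r = pcompose q [:(T + t) / 2, 1 / k:]"
  have "degree r \<le> degree q" using k by (simp add: r_def degree_pcompose)
  then obtain c where c: "r = (\<Sum>j\<le>degree q. smult (c j) (legendreP j))" using legendreP_span by blast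
  have nz: "sqrt ((2 * real j + 1) / (T - t)) \<noteq> 0" for j using tT by simp
  have "poly q x = (\<Sum>j\<le>degree q. (c j / sqrt ((2 * real j + 1) / (T - t))) * \<phi> j x)" for x
  proof -
    have "poly q x = poly r ((x - (T + t) / 2) * k)"
      using k by (simp add: r_def poly_pcompose field_simps)
    also have "\<dots> = (\<Sum>j\<le>degree q. c j * poly (legendreP j) ((x - (T + t) / 2) * k))"
      unfolding c by (simp add: poly_sum)
    also have "\<dots> = (\<Sum>j\<le>degree q. (c j / sqrt ((2 * real j + 1) / (T - t))) * \<phi> j x)"
      by (intro sum.cong refl) (use nz in \<open>simp add: phi_poly k_def\<close>)
    finally show ?thesis .
  qed
  then show ?thesis by (intro exI[of _ "\<lambda>j. c j / sqrt ((2 * real j + 1) / (T - t))"]) blast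
qed

text \<open>The defect in Bessel's inequality, equal to the squared distance of f from the span of
  the first p + 1 functions.\<close>

definition tail :: "(real \<Rightarrow> real) \<Rightarrow> nat \<Rightarrow> real" where
  "tail f p = (\<integral>x. (f x)\<^sup>2 \<partial>\<mu>) - (\<Sum>j\<le>p. (\<integral>x. f x * \<phi> j x \<partial>\<mu>)\<^sup>2)"

lemma tail_nonneg: "bdd_meas \<mu> f \<Longrightarrow> 0 \<le> tail f p"
  unfolding tail_def using bessel[OF finite_\<mu>, of "{..p}" \<phi> f] by (simp add: bdd_phi phi_orthonormal)

lemma tail_antimono: "p \<le> q \<Longrightarrow> tail f q \<le> tail f p"
  unfolding tail_def by (intro diff_left_mono sum_mono2) auto

lemma tail_le:
  assumes f: "bdd_meas \<mu> f"
  shows "tail f (degree q) \<le> (\<integral>x. (f x - poly q x)\<^sup>2 \<partial>\<mu>)"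
proof -
  obtain c where c: "\<And>x. poly q x = (\<Sum>j\<le>degree q. c j * \<phi> j x)" using polynomial_span by blast
  show ?thesis
    unfolding c using orthonormal_remainder[OF finite_\<mu>, of "{..degree q}" \<phi> f c]
    by (simp add: bdd_phi phi_orthonormal f tail_def sum_nonneg)
qed

text \<open>Approximation by some polynomial bounds the tail at its degree, and the tail decreases;
  completeness is thus only used as density of polynomials.\<close>

lemma tail_tendsto_0:
  assumes f: "bdd_meas \<mu> f" and approx: "\<And>e. e > 0 \<Longrightarrow> \<exists>q. (\<integral>x. (f x - poly q x)\<^sup>2 \<partial>\<mu>) < e"
  shows "tail f \<longlonglongrightarrow> 0"
proof (rule LIMSEQ_I)
  fix e :: real assume "e > 0"
  then obtain q where "(\<integral>x. (f x - poly q x)\<^sup>2 \<partial>\<mu>) < e" using approx by blast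
  then have "tail f (degree q) < e" using tail_le[OF f, of q] by simp
  then show "\<exists>N. \<forall>n\<ge>N. norm (tail f n - 0) < e"
    using tail_nonneg[OF f] tail_antimono[of "degree q" _ f] by (intro exI[of _ "degree q"]) (auto intro: le_less_trans)
qed

lemma measure_\<mu>: "measure \<mu> (space \<mu>) = T - t"
  using tT unfolding \<mu>_def by (subst measure_restrict_space) (auto simp: space_restrict_space)

lemma continuous_approx:
  assumes f: "continuous_on {t..T} f" and "e > 0"
  shows "\<exists>q. (\<integral>x. (f x - poly q x)\<^sup>2 \<partial>\<mu>) < e"
proof -
  define d where "d = sqrt (e / 2 / (T - t))"
  have "d\<^sup>2 = e / 2 / (T - t)" using \<open>e > 0\<close> tT by (simp add: d_def)
  then have "d\<^sup>2 * (T - t) = e / 2" using tT by (subst (asm) nonzero_eq_divide_eq) auto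
  moreover have "d > 0" using \<open>e > 0\<close> tT by (simp add: d_def)
  ultimately have d: "d > 0" "d\<^sup>2 * (T - t) = e / 2" by auto
  obtain g where g: "real_polynomial_function g" "\<And>x. x \<in> {t..T} \<Longrightarrow> \<bar>f x - g x\<bar> < d"
    using Stone_Weierstrass_real_polynomial_function[OF _ f d(1)] by auto
  obtain a n where a: "g = (\<lambda>x. \<Sum>i\<le>n. a i * x ^ i)"
    using g(1) unfolding real_polynomial_function_iff_sum by blast
  define q where "q = (\<Sum>i\<le>n. monom (a i) i)"
  have q: "poly q x = g x" for x by (simp add: q_def a poly_sum poly_monom)
  have "(\<integral>x. (f x - poly q x)\<^sup>2 \<partial>\<mu>) \<le> (\<integral>x. d\<^sup>2 \<partial>\<mu>)"
  proof (rule integral_mono)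
    show "integrable \<mu> (\<lambda>x. (f x - poly q x)\<^sup>2)"
      by (intro bdd_meas_integrable[OF finite_\<mu>] bdd_intros continuous_bdd_meas f continuous_intros)
    show "integrable \<mu> (\<lambda>x. d\<^sup>2)" by simp
    fix x assume "x \<in> space \<mu>"
    then have "\<bar>f x - poly q x\<bar> \<le> d" using g(2)[of x] by (auto simp: q)
    then show "(f x - poly q x)\<^sup>2 \<le> d\<^sup>2" using d(1) by (simp add: power2_le_iff_abs_le)
  qed
  also have "\<dots> = e / 2" using d(2) by (simp add: measure_\<mu> mult.commute del: space_\<mu>)
  finally show ?thesis using \<open>e > 0\<close> by (intro exI[of _ q]) simp
qed

lemma tail_continuous: "continuous_on {t..T} f \<Longrightarrow> tail f \<longlonglongrightarrow> 0"
  by (intro tail_tendsto_0 continuous_bdd_meas continuous_approx)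

lemma bdd_indicator: "bdd_meas \<mu> (indicator {..u})"
  by (rule bdd_measI[of _ _ 1]) (auto intro!: measurable_\<mu>)

lemma indicator_approx:
  assumes "e > 0"
  shows "\<exists>q. (\<integral>x. (indicator {..u} x - poly q x)\<^sup>2 \<partial>\<mu>) < e"
proof -
  \<comment> \<open>Continuous ramps falling from 1 at u to 0 at u + 1/n, to which Weierstrass
    approximation applies.\<close>
  define g where "g n x = max 0 (min 1 (1 + real n * (u - x)))" for n x
  have gc: "continuous_on A (g n)" for A n unfolding g_def by (intro continuous_intros)
  have "(\<lambda>n. \<integral>x. (indicator {..u} x - g n x)\<^sup>2 \<partial>\<mu>) \<longlonglongrightarrow> (\<integral>x. 0 \<partial>\<mu>)"
  proof (rule integral_dominated_convergence[where w = "\<lambda>_. 1"])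
    show "(\<lambda>x. (indicator {..u} x - g n x)\<^sup>2) \<in> borel_measurable \<mu>" for n
      by (intro bdd_meas_measurable bdd_intros bdd_indicator continuous_bdd_meas gc)
    have lim: "(\<lambda>n. g n x) \<longlonglongrightarrow> indicator {..u} x" for x
    proof (cases "x \<le> u")
      case True
      then have "g n x = 1" for n by (simp add: g_def)
      then show ?thesis using True by simp
    next
      case False
      obtain N where N: "1 / (x - u) < real N" using reals_Archimedean2 by blast
      have "g n x = 0" if "n \<ge> N" for n
      proof -
        have "1 / (x - u) < real n" using N that by simp
        then have "1 + real n * (u - x) < 0" using False by (simp add: field_simps)
        then show ?thesis by (simp add: g_def)
      qed
      then have "(\<lambda>n. g n x) \<longlonglongrightarrow> 0"
        by (intro tendsto_eventually) (auto simp: eventually_sequentially)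
      then show ?thesis using False by simp
    qed
    have "(\<lambda>n. (indicator {..u} x - g n x)\<^sup>2) \<longlonglongrightarrow> (indicator {..u} x - indicator {..u} x)\<^sup>2" for x
      by (intro tendsto_intros lim)
    then show "AE x in \<mu>. (\<lambda>n. (indicator {..u} x - g n x)\<^sup>2) \<longlonglongrightarrow> 0" by simp
    have "\<bar>indicator {..u} x - g n x\<bar> \<le> 1" for n x by (auto simp: g_def indicator_def)
    then show "AE x in \<mu>. norm ((indicator {..u} x - g n x)\<^sup>2) \<le> 1" for n
      by (simp add: abs_square_le_1)
  qed auto
  then have "\<forall>\<^sub>F n in sequentially. (\<integral>x. (indicator {..u} x - g n x)\<^sup>2 \<partial>\<mu>) < e / 4"
    using \<open>e > 0\<close> by (intro order_tendstoD(2)[of _ 0]) auto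
  then obtain n where n: "(\<integral>x. (indicator {..u} x - g n x)\<^sup>2 \<partial>\<mu>) < e / 4" by (auto simp: eventually_sequentially)
  obtain q where q: "(\<integral>x. (g n x - poly q x)\<^sup>2 \<partial>\<mu>) < e / 4"
    using continuous_approx[OF gc, of "e / 4" n] \<open>e > 0\<close> by auto
  have pc: "continuous_on {t..T} (poly q)" by (intro continuous_intros)
  have "(\<integral>x. (indicator {..u} x - poly q x)\<^sup>2 \<partial>\<mu>) \<le> 2 * (\<integral>x. (indicator {..u} x - g n x)\<^sup>2 \<partial>\<mu>) + 2 * (\<integral>x. (g n x - poly q x)\<^sup>2 \<partial>\<mu>)"
    by (intro square_dist_triangle(2) bdd_meas_measurable bdd_meas_integrable[OF finite_\<mu>] bdd_intros
        bdd_indicator continuous_bdd_meas gc pc)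
  with n q show ?thesis by (intro exI[of _ q]) linarith
qed

lemma tail_indicator: "tail (indicator {..u}) \<longlonglongrightarrow> 0"
  by (intro tail_tendsto_0 bdd_indicator indicator_approx)

section \<open>Primitives of the Legendre system and the functions \<open>\<theta> q\<close>\<close>

definition \<Phi> :: "nat \<Rightarrow> real \<Rightarrow> real" where "\<Phi> j u = integral {t..u} (\<phi> j)"

text \<open>This is the integral of \<phi>_j over [u, T].\<close>

definition \<Psi> :: "nat \<Rightarrow> real \<Rightarrow> real" where "\<Psi> j u = \<Phi> j T - \<Phi> j u"

definition \<theta> :: "nat \<Rightarrow> real \<Rightarrow> real" where "\<theta> q u = (u - t) - (\<Sum>j\<le>q. (\<Phi> j u)\<^sup>2)"

lemma Phi_deriv: "u \<in> {t..T} \<Longrightarrow> (\<Phi> j has_real_derivative \<phi> j u) (at u within {t..T})"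
  unfolding \<Phi>_def[abs_def] by (intro integral_has_real_derivative continuous_phi)

lemma Psi_deriv: "u \<in> {t..T} \<Longrightarrow> (\<Psi> j has_real_derivative - \<phi> j u) (at u within {t..T})"
  unfolding \<Psi>_def[abs_def] by (auto intro!: derivative_eq_intros Phi_deriv)

lemma continuous_Phi: "continuous_on {t..T} (\<Phi> j)"
  using Phi_deriv by (intro DERIV_continuous_on)

lemma continuous_Psi: "continuous_on {t..T} (\<Psi> j)"
  unfolding \<Psi>_def by (intro continuous_intros continuous_Phi)

lemma continuous_theta: "continuous_on {t..T} (\<theta> q)"
  unfolding \<theta>_def by (intro continuous_intros continuous_Phi)

lemma Phi_t [simp]: "\<Phi> j t = 0" by (simp add: \<Phi>_def)

lemma Psi_T [simp]: "\<Psi> j T = 0" by (simp add: \<Psi>_def)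

lemma Phi_integral: "u \<in> {t..T} \<Longrightarrow> (\<integral>x. indicator {..u} x * \<phi> j x \<partial>\<mu>) = \<Phi> j u"
  using integral_\<mu>_interval[OF continuous_phi, of u j] by (simp add: \<Phi>_def mult.commute)

lemma phi_0: "\<phi> 0 x = 1 / sqrt (T - t)"
  by (simp add: legendre_phi_def legendre_poly_def real_sqrt_divide)

lemma Phi_0: "u \<in> {t..T} \<Longrightarrow> \<Phi> 0 u = (u - t) / sqrt (T - t)"
  by (simp add: \<Phi>_def phi_0[abs_def])

text \<open>A multiple of the orthogonality relation with the constant function
  \<open>\<phi> 0\<close>. It leaves a single term in sums involving \<open>\<Phi> j T\<close> and
  so makes the identities for \<Phi> and \<Psi> below exact at every finite q.\<close>

lemma Phi_T: "\<Phi> j T = (if j = 0 then sqrt (T - t) else 0)"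
proof -
  have "\<Phi> j T = (\<integral>x. \<phi> j x \<partial>\<mu>)" by (simp add: \<Phi>_def integral_\<mu>[OF continuous_phi])
  also have "\<dots> = (\<integral>x. sqrt (T - t) * (\<phi> j x * \<phi> 0 x) \<partial>\<mu>)"
    using tT by (intro Bochner_Integration.integral_cong refl) (simp add: phi_0)
  also have "\<dots> = sqrt (T - t) * (if j = 0 then 1 else 0)"
    by (simp only: integral_mult_right_zero phi_orthonormal)
  finally show ?thesis by simp
qed

text \<open>The values \<Phi>_j(u) are the Fourier coefficients of the indicator of [t, u], whose
  squared norm is u - t.\<close>

lemma theta_eq_tail:
  assumes u: "u \<in> {t..T}"
  shows "\<theta> q u = tail (indicator {..u}) q"
proof -
  have "(\<integral>x. (indicator {..u} x :: real)\<^sup>2 \<partial>\<mu>) = (\<integral>x. 1 * indicator {..u} x \<partial>\<mu>)"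
    by (intro Bochner_Integration.integral_cong refl) (auto simp: indicator_def)
  also have "\<dots> = u - t" using integral_\<mu>_interval[of "\<lambda>_. 1" u] u by simp
  finally show ?thesis using u by (simp add: tail_def \<theta>_def Phi_integral)
qed

lemma theta_nonneg: "u \<in> {t..T} \<Longrightarrow> 0 \<le> \<theta> q u"
  by (simp add: theta_eq_tail tail_nonneg bdd_indicator)

lemma theta_le: "u \<in> {t..T} \<Longrightarrow> \<theta> q u \<le> T - t"
  unfolding \<theta>_def by (auto intro: order_trans[OF diff_left_mono[OF sum_nonneg]])

lemma theta_tendsto_0: "u \<in> {t..T} \<Longrightarrow> (\<lambda>q. \<theta> q u) \<longlonglongrightarrow> 0"
  using tail_indicator[of u] by (simp add: theta_eq_tail)

lemma theta_square_tendsto_0: "(\<lambda>q. \<integral>u. (\<theta> q u)\<^sup>2 \<partial>\<mu>) \<longlonglongrightarrow> 0"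
proof -
  have "(\<lambda>q. \<integral>u. (\<theta> q u)\<^sup>2 \<partial>\<mu>) \<longlonglongrightarrow> (\<integral>u. 0 \<partial>\<mu>)"
  proof (rule integral_dominated_convergence[where w = "\<lambda>_. (T - t)\<^sup>2"])
    show "(\<lambda>u. (\<theta> q u)\<^sup>2) \<in> borel_measurable \<mu>" for q
      by (intro bdd_meas_measurable bdd_intros continuous_bdd_meas continuous_theta)
    have "(\<lambda>q. (\<theta> q u)\<^sup>2) \<longlonglongrightarrow> 0\<^sup>2" if "u \<in> {t..T}" for u by (intro tendsto_intros theta_tendsto_0 that)
    then show "AE u in \<mu>. (\<lambda>q. (\<theta> q u)\<^sup>2) \<longlonglongrightarrow> 0" by (intro AE_I2) auto
    show "AE u in \<mu>. norm ((\<theta> q u)\<^sup>2) \<le> (T - t)\<^sup>2" for q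
      using theta_nonneg theta_le by (intro AE_I2) (auto intro!: power_mono)
  qed auto
  then show ?thesis by simp
qed

lemma sum_Phi_Psi: "u \<in> {t..T} \<Longrightarrow> (\<Sum>j\<le>q. \<Phi> j u * \<Psi> j u) = \<theta> q u"
proof -
  assume u: "u \<in> {t..T}"
  have "(\<Sum>j\<le>q. \<Phi> j u * \<Psi> j u) = (\<Sum>j\<le>q. \<Phi> j u * (if j = 0 then sqrt (T - t) else 0)) - (\<Sum>j\<le>q. (\<Phi> j u)\<^sup>2)"
    by (simp add: \<Psi>_def Phi_T right_diff_distrib sum_subtractf power2_eq_square)
  also have "(\<Sum>j\<le>q. \<Phi> j u * (if j = 0 then sqrt (T - t) else 0)) = \<Phi> 0 u * sqrt (T - t)"
    by (simp add: if_distrib[of "\<lambda>x. _ * x"] sum.delta cong: if_cong)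
  also have "\<dots> = u - t" using tT by (simp add: Phi_0[OF u])
  finally show ?thesis by (simp add: \<theta>_def)
qed

text \<open>Since \<Psi> = \<Phi>(T) - \<Phi>, the square is \<Phi>(T) \<Psi> minus \<Phi> \<Psi>;
  the first part lives at j = 0 and equals T - u.\<close>

lemma sum_Psi_square: "u \<in> {t..T} \<Longrightarrow> (\<Sum>j\<le>q. (\<Psi> j u)\<^sup>2) = (T - u) - \<theta> q u"
proof -
  assume u: "u \<in> {t..T}"
  have "(\<Psi> j u)\<^sup>2 = (if j = 0 then \<Phi> 0 T * \<Psi> 0 u else 0) - \<Phi> j u * \<Psi> j u" for j
    by (simp add: \<Psi>_def Phi_T power2_eq_square algebra_simps)
  then have "(\<Sum>j\<le>q. (\<Psi> j u)\<^sup>2) = \<Phi> 0 T * \<Psi> 0 u - \<theta> q u"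
    by (simp add: sum_subtractf sum_Phi_Psi[OF u] sum.delta)
  also have "\<Phi> 0 T * \<Psi> 0 u = T - u"
  proof -
    have "sqrt (T - t) * ((u - t) / sqrt (T - t)) = u - t" "sqrt (T - t) * sqrt (T - t) = T - t" using tT by simp_all
    then show ?thesis
      unfolding \<Psi>_def Phi_0[OF u] right_diff_distrib by (simp only: Phi_T refl if_True)
  qed
  finally show ?thesis .
qed

end

section \<open>The Fourier coefficients\<close>

context interval
begin

lemma by_parts:
  assumes F: "\<And>x. x \<in> {t..T} \<Longrightarrow> (F has_real_derivative f x) (at x within {t..T})"
    and G: "\<And>x. x \<in> {t..T} \<Longrightarrow> (G has_real_derivative g x) (at x within {t..T})"
    and c: "continuous_on {t..T} f" "continuous_on {t..T} g" and b: "F T * G T = 0" "F t * G t = 0"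
  shows "integral {t..T} (\<lambda>x. F x * g x) = - integral {t..T} (\<lambda>x. f x * G x)"
proof -
  have cF: "continuous_on {t..T} F" "continuous_on {t..T} G" using DERIV_continuous_on[OF F] DERIV_continuous_on[OF G] by auto
  have "((\<lambda>x. F x * g x + f x * G x) has_integral (F T * G T - F t * G t)) {t..T}"
  proof (rule fundamental_theorem_of_calculus)
    show "t \<le> T" using tT by simp
    fix x assume x: "x \<in> {t..T}"
    have "((\<lambda>x. F x * G x) has_real_derivative F x * g x + f x * G x) (at x within {t..T})"
      using F[OF x] G[OF x] by (auto intro!: derivative_eq_intros)
    then show "((\<lambda>x. F x * G x) has_vector_derivative F x * g x + f x * G x) (at x within {t..T})"
      by (simp add: has_real_derivative_iff_has_vector_derivative)
  qed
  then have "integral {t..T} (\<lambda>x. F x * g x + f x * G x) = 0" using b by (simp add: integral_unique)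
  moreover have "integral {t..T} (\<lambda>x. F x * g x + f x * G x) = integral {t..T} (\<lambda>x. F x * g x) + integral {t..T} (\<lambda>x. f x * G x)"
    using c cF by (intro Henstock_Kurzweil_Integration.integral_add integrable_continuous_interval continuous_intros)
  ultimately show ?thesis by simp
qed

lemmas cont_intros = continuous_intros continuous_phi continuous_Phi continuous_Psi continuous_theta

text \<open>Integrating the outermost variable by parts leaves the middle variable as the only one,
  between a primitive from the left and one from the right. In this form the coefficients can be
  summed over any two coinciding indices.\<close>

lemma coeffC_integral: "coeffC t T j3 j2 j1 = integral {t..T} (\<lambda>x. \<Phi> j1 x * \<phi> j2 x * \<Psi> j3 x)"
proof -
  define g where "g x = \<phi> j2 x * \<Phi> j1 x" for x
  define G where "G s = integral {t..s} g" for s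
  have gc: "continuous_on {t..T} g" unfolding g_def by (intro cont_intros)
  have "integral {t..T} (\<lambda>x. \<Psi> j3 x * g x) = - integral {t..T} (\<lambda>x. - \<phi> j3 x * G x)"
  proof (rule by_parts)
    show "(\<Psi> j3 has_real_derivative - \<phi> j3 x) (at x within {t..T})" if "x \<in> {t..T}" for x by (rule Psi_deriv[OF that])
    show "(G has_real_derivative g x) (at x within {t..T})" if "x \<in> {t..T}" for x
      unfolding G_def[abs_def] by (rule integral_has_real_derivative[OF gc that])
    show "continuous_on {t..T} (\<lambda>x. - \<phi> j3 x)" by (intro cont_intros)
    show "\<Psi> j3 T * G T = 0" "\<Psi> j3 t * G t = 0" by (simp_all add: G_def)
  qed (rule gc)
  also have "\<dots> = integral {t..T} (\<lambda>x. \<phi> j3 x * G x)" by simp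
  also have "\<dots> = coeffC t T j3 j2 j1" by (simp add: coeffC_def G_def[abs_def] g_def[abs_def] \<Phi>_def)
  finally show ?thesis by (simp add: g_def mult_ac)
qed

lemma coeffC_mu: "coeffC t T j3 j2 j1 = (\<integral>x. \<Phi> j1 x * \<phi> j2 x * \<Psi> j3 x \<partial>\<mu>)"
  unfolding coeffC_integral by (rule integral_\<mu>[symmetric]) (intro cont_intros)

text \<open>\<Phi>_j \<phi>_j is the derivative of half the square of \<Phi>_j, so another
  integration by parts moves the derivative back to \<Psi>.\<close>

lemma coeffC_diag12: "coeffC t T j3 j j = (\<integral>x. (\<Phi> j x)\<^sup>2 / 2 * \<phi> j3 x \<partial>\<mu>)"
proof -
  have "integral {t..T} (\<lambda>x. \<Psi> j3 x * (\<Phi> j x * \<phi> j x)) = - integral {t..T} (\<lambda>x. - \<phi> j3 x * ((\<Phi> j x)\<^sup>2 / 2))"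
  proof (rule by_parts)
    show "(\<Psi> j3 has_real_derivative - \<phi> j3 x) (at x within {t..T})" if "x \<in> {t..T}" for x by (rule Psi_deriv[OF that])
    show "((\<lambda>x. (\<Phi> j x)\<^sup>2 / 2) has_real_derivative \<Phi> j x * \<phi> j x) (at x within {t..T})" if "x \<in> {t..T}" for x
      using Phi_deriv[OF that, of j] by (auto intro!: derivative_eq_intros simp: power2_eq_square)
  qed (auto intro!: cont_intros)
  also have "\<dots> = integral {t..T} (\<lambda>x. (\<Phi> j x)\<^sup>2 / 2 * \<phi> j3 x)" by (simp add: mult.commute)
  also have "\<dots> = (\<integral>x. (\<Phi> j x)\<^sup>2 / 2 * \<phi> j3 x \<partial>\<mu>)"
    by (rule integral_\<mu>[symmetric]) (auto intro!: cont_intros)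
  finally show ?thesis unfolding coeffC_integral by (simp add: mult_ac)
qed

lemma coeffC_diag23: "coeffC t T j j j1 = (\<integral>x. (\<Psi> j x)\<^sup>2 / 2 * \<phi> j1 x \<partial>\<mu>)"
proof -
  have "integral {t..T} (\<lambda>x. \<Phi> j1 x * (\<phi> j x * \<Psi> j x)) = - integral {t..T} (\<lambda>x. \<phi> j1 x * (- (\<Psi> j x)\<^sup>2 / 2))"
  proof (rule by_parts)
    show "(\<Phi> j1 has_real_derivative \<phi> j1 x) (at x within {t..T})" if "x \<in> {t..T}" for x by (rule Phi_deriv[OF that])
    show "((\<lambda>x. - (\<Psi> j x)\<^sup>2 / 2) has_real_derivative \<phi> j x * \<Psi> j x) (at x within {t..T})" if "x \<in> {t..T}" for x
      using Psi_deriv[OF that, of j] by (auto intro!: derivative_eq_intros simp: power2_eq_square)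
  qed (auto intro!: cont_intros)
  also have "\<dots> = integral {t..T} (\<lambda>x. (\<Psi> j x)\<^sup>2 / 2 * \<phi> j1 x)" by (simp add: mult.commute)
  also have "\<dots> = (\<integral>x. (\<Psi> j x)\<^sup>2 / 2 * \<phi> j1 x \<partial>\<mu>)"
    by (rule integral_\<mu>[symmetric]) (auto intro!: cont_intros)
  finally show ?thesis unfolding coeffC_integral by (simp add: mult_ac)
qed

lemma integrable_cont: "continuous_on {t..T} f \<Longrightarrow> integrable \<mu> (f :: real \<Rightarrow> real)"
  by (intro bdd_meas_integrable[OF finite_\<mu>] continuous_bdd_meas)

lemma trace12: "(\<Sum>j\<le>q. coeffC t T j3 j j) = (\<integral>x. ((x - t) / 2 - 1 / 2 * \<theta> q x) * \<phi> j3 x \<partial>\<mu>)"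
proof -
  have "(\<Sum>j\<le>q. coeffC t T j3 j j) = (\<integral>x. (\<Sum>j\<le>q. (\<Phi> j x)\<^sup>2 / 2 * \<phi> j3 x) \<partial>\<mu>)"
    unfolding coeffC_diag12
    by (rule Bochner_Integration.integral_sum[symmetric]) (auto intro!: integrable_cont cont_intros)
  also have "\<dots> = (\<integral>x. ((x - t) / 2 - 1 / 2 * \<theta> q x) * \<phi> j3 x \<partial>\<mu>)"
    by (intro Bochner_Integration.integral_cong refl)
       (simp add: \<theta>_def sum_distrib_right[symmetric] sum_divide_distrib[symmetric] diff_divide_distrib)
  finally show ?thesis .
qed

lemma trace23: "(\<Sum>j\<le>q. coeffC t T j j j1) = (\<integral>x. ((T - x) / 2 - 1 / 2 * \<theta> q x) * \<phi> j1 x \<partial>\<mu>)"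
proof -
  have "(\<Sum>j\<le>q. coeffC t T j j j1) = (\<integral>x. (\<Sum>j\<le>q. (\<Psi> j x)\<^sup>2 / 2 * \<phi> j1 x) \<partial>\<mu>)"
    unfolding coeffC_diag23
    by (rule Bochner_Integration.integral_sum[symmetric]) (auto intro!: integrable_cont cont_intros)
  also have "\<dots> = (\<integral>x. ((T - x) / 2 - 1 / 2 * \<theta> q x) * \<phi> j1 x \<partial>\<mu>)"
    by (intro Bochner_Integration.integral_cong refl)
       (simp add: sum_Psi_square sum_distrib_right[symmetric] sum_divide_distrib[symmetric] diff_divide_distrib)
  finally show ?thesis .
qed

text \<open>The odd shape \<open>0 - (-1) * \<theta> q x\<close> fits the pattern of
  \<open>trace_norm\<close> with g = 0 and \<kappa> = -1: this trace is a pure error term.\<close>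

lemma trace13: "(\<Sum>j\<le>q. coeffC t T j j2 j) = (\<integral>x. (0 - (-1) * \<theta> q x) * \<phi> j2 x \<partial>\<mu>)"
proof -
  have "(\<Sum>j\<le>q. coeffC t T j j2 j) = (\<integral>x. (\<Sum>j\<le>q. \<Phi> j x * \<phi> j2 x * \<Psi> j x) \<partial>\<mu>)"
    unfolding coeffC_mu
    by (rule Bochner_Integration.integral_sum[symmetric]) (auto intro!: integrable_cont cont_intros)
  also have "\<dots> = (\<integral>x. (0 - (-1) * \<theta> q x) * \<phi> j2 x \<partial>\<mu>)"
  proof (intro Bochner_Integration.integral_cong refl)
    fix x assume "x \<in> space \<mu>"
    then have x: "x \<in> {t..T}" by auto
    have "(\<Sum>j\<le>q. \<Phi> j x * \<phi> j2 x * \<Psi> j x) = (\<Sum>j\<le>q. \<Phi> j x * \<Psi> j x) * \<phi> j2 x"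
      unfolding sum_distrib_right by (intro sum.cong refl) (simp add: mult_ac)
    then show "(\<Sum>j\<le>q. \<Phi> j x * \<phi> j2 x * \<Psi> j x) = (0 - (-1) * \<theta> q x) * \<phi> j2 x"
      by (simp add: sum_Phi_Psi[OF x])
  qed
  finally show ?thesis .
qed

text \<open>Expanding the perturbed function up to p, but comparing with g, costs the tail of g and,
  by Bessel, at most the norm of the perturbation. The bound separates p from q, so the truncation
  indices may grow independently.\<close>

lemma trace_norm:
  assumes g: "continuous_on {t..T} g"
  shows "(\<integral>x. (g x - (\<Sum>j\<le>p. (\<integral>y. (g y - \<kappa> * \<theta> q y) * \<phi> j y \<partial>\<mu>) * \<phi> j x))\<^sup>2 \<partial>\<mu>)
    \<le> tail g p + \<kappa>\<^sup>2 * (\<integral>x. (\<theta> q x)\<^sup>2 \<partial>\<mu>)"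
proof -
  define c where "c j = (\<integral>y. (g y - \<kappa> * \<theta> q y) * \<phi> j y \<partial>\<mu>)" for j
  have c: "c j - (\<integral>y. g y * \<phi> j y \<partial>\<mu>) = - \<kappa> * (\<integral>y. \<theta> q y * \<phi> j y \<partial>\<mu>)" for j
  proof -
    have "c j = (\<integral>y. g y * \<phi> j y - \<kappa> * (\<theta> q y * \<phi> j y) \<partial>\<mu>)"
      by (simp add: c_def left_diff_distrib mult.assoc)
    also have "\<dots> = (\<integral>y. g y * \<phi> j y \<partial>\<mu>) - \<kappa> * (\<integral>y. \<theta> q y * \<phi> j y \<partial>\<mu>)"
      by (subst Bochner_Integration.integral_diff) (auto intro!: integrable_cont cont_intros g)
    finally show ?thesis by simp
  qed
  have "(\<integral>x. (g x - (\<Sum>j\<le>p. c j * \<phi> j x))\<^sup>2 \<partial>\<mu>)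
    = (\<integral>x. (g x)\<^sup>2 \<partial>\<mu>) - (\<Sum>j\<le>p. (\<integral>y. g y * \<phi> j y \<partial>\<mu>)\<^sup>2) + (\<Sum>j\<le>p. (c j - (\<integral>y. g y * \<phi> j y \<partial>\<mu>))\<^sup>2)"
    using orthonormal_remainder[where N = \<mu> and S = "{..p}" and e = \<phi> and f = g and c = c]
    by (simp add: finite_\<mu> bdd_phi continuous_bdd_meas[OF g] phi_orthonormal)
  also have "\<dots> = tail g p + \<kappa>\<^sup>2 * (\<Sum>j\<le>p. (\<integral>y. \<theta> q y * \<phi> j y \<partial>\<mu>)\<^sup>2)"
    unfolding c tail_def by (simp add: power_mult_distrib sum_distrib_left)
  also have "\<dots> \<le> tail g p + \<kappa>\<^sup>2 * (\<integral>x. (\<theta> q x)\<^sup>2 \<partial>\<mu>)"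
    by (intro add_left_mono mult_left_mono bessel[OF finite_\<mu>])
       (auto intro!: bdd_phi continuous_bdd_meas continuous_theta simp: phi_orthonormal)
  finally show ?thesis by (simp add: c_def)
qed

text \<open>The squared norm of the truncated expansion of the kernel.\<close>

definition boxsum :: "nat \<Rightarrow> nat \<Rightarrow> nat \<Rightarrow> real" where
  "boxsum p1 p2 p3 = (\<Sum>j1\<le>p1. \<Sum>j2\<le>p2. \<Sum>j3\<le>p3. (coeffC t T j3 j2 j1)\<^sup>2)"

lemma theta_L1_tendsto_0: "(\<lambda>q. \<integral>u. \<theta> q u \<partial>\<mu>) \<longlonglongrightarrow> 0"
proof -
  have "(\<lambda>q. \<integral>u. \<theta> q u \<partial>\<mu>) \<longlonglongrightarrow> (\<integral>u. 0 \<partial>\<mu>)"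
  proof (rule integral_dominated_convergence[where w = "\<lambda>_. T - t"])
    show "\<theta> q \<in> borel_measurable \<mu>" for q
      by (intro bdd_meas_measurable continuous_bdd_meas continuous_theta)
    show "AE u in \<mu>. (\<lambda>q. \<theta> q u) \<longlonglongrightarrow> 0" using theta_tendsto_0 by (intro AE_I2) auto
    show "AE u in \<mu>. norm (\<theta> q u) \<le> T - t" for q
      using theta_nonneg theta_le by (intro AE_I2) auto
  qed auto
  then show ?thesis by simp
qed

text \<open>The volume of the simplex t < x < y < z < T, hence the squared norm of the
  kernel.\<close>

lemma integral_parabola: "(\<integral>x. (x - t) * (T - x) \<partial>\<mu>) = (T - t) ^ 3 / 6"
proof -
  have "((\<lambda>x. (x - t) * (T - x)) has_integral ((\<lambda>x. (T - t) * (x - t)\<^sup>2 / 2 - (x - t) ^ 3 / 3) T - (\<lambda>x. (T - t) * (x - t)\<^sup>2 / 2 - (x - t) ^ 3 / 3) t)) {t..T}"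
  proof (rule fundamental_theorem_of_calculus)
    show "t \<le> T" using tT by simp
    fix x assume "x \<in> {t..T}"
    have "((\<lambda>x. (T - t) * (x - t)\<^sup>2 / 2 - (x - t) ^ 3 / 3) has_real_derivative (x - t) * (T - x)) (at x within {t..T})"
      by (auto intro!: derivative_eq_intros simp: power2_eq_square field_simps)
    then show "((\<lambda>x. (T - t) * (x - t)\<^sup>2 / 2 - (x - t) ^ 3 / 3) has_vector_derivative (x - t) * (T - x)) (at x within {t..T})"
      by (simp add: has_real_derivative_iff_has_vector_derivative)
  qed
  then have "integral {t..T} (\<lambda>x. (x - t) * (T - x)) = (T - t) * (T - t)\<^sup>2 / 2 - (T - t) ^ 3 / 3"
    by (simp add: integral_unique)
  moreover have "(\<integral>x. (x - t) * (T - x) \<partial>\<mu>) = integral {t..T} (\<lambda>x. (x - t) * (T - x))"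
    by (rule integral_\<mu>) (intro continuous_intros)
  ultimately show ?thesis by (simp add: power2_eq_square power3_eq_cube)
qed

lemma boxsum_mono:
  assumes "p1 \<le> q1" "p2 \<le> q2" "p3 \<le> q3" shows "boxsum p1 p2 p3 \<le> boxsum q1 q2 q3"
proof -
  have "boxsum p1 p2 p3 \<le> (\<Sum>j1\<le>p1. \<Sum>j2\<le>p2. \<Sum>j3\<le>q3. (coeffC t T j3 j2 j1)\<^sup>2)"
    unfolding boxsum_def using assms by (intro sum_mono sum_mono2) auto
  also have "\<dots> \<le> (\<Sum>j1\<le>p1. \<Sum>j2\<le>q2. \<Sum>j3\<le>q3. (coeffC t T j3 j2 j1)\<^sup>2)"
    using assms by (intro sum_mono sum_mono2) (auto intro!: sum_nonneg)
  also have "\<dots> \<le> boxsum q1 q2 q3"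
    unfolding boxsum_def using assms by (intro sum_mono2) (auto intro!: sum_nonneg)
  finally show ?thesis .
qed

text \<open>Parseval for the kernel without density of products in the cube. Summing over j1, j3 up
  to q turns the squares of \<Phi> and \<Psi> into (y - t) - \<theta> and (T - y) - \<theta>, small
  loss for a fixed large q; the finitely many functions \<Phi>_j1 \<Psi>_j3 are then expanded in j2.
  Monotonicity in the box covers all larger indices.\<close>

lemma boxsum_limit:
  assumes "e > 0"
  shows "\<exists>n. \<forall>p1\<ge>n. \<forall>p2\<ge>n. \<forall>p3\<ge>n. (T - t) ^ 3 / 6 - boxsum p1 p2 p3 < e"
proof -
  have "(\<lambda>q. 2 * (T - t) * (\<integral>u. \<theta> q u \<partial>\<mu>)) \<longlonglongrightarrow> 2 * (T - t) * 0"
    by (intro tendsto_intros theta_L1_tendsto_0)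
  then have "\<forall>\<^sub>F q in sequentially. 2 * (T - t) * (\<integral>u. \<theta> q u \<partial>\<mu>) < e / 2"
    using assms by (intro order_tendstoD(2)) auto
  then obtain q where q: "2 * (T - t) * (\<integral>u. \<theta> q u \<partial>\<mu>) < e / 2" by (auto simp: eventually_sequentially)
  let ?f = "\<lambda>j1 j3 x. \<Phi> j1 x * \<Psi> j3 x"
  have fc: "continuous_on {t..T} (?f j1 j3)" for j1 j3 by (intro cont_intros)
  have "(\<lambda>p. \<Sum>j1\<le>q. \<Sum>j3\<le>q. tail (?f j1 j3) p) \<longlonglongrightarrow> (\<Sum>j1\<le>q. \<Sum>j3\<le>q. 0)"
    by (intro tendsto_sum tail_continuous fc)
  then have "\<forall>\<^sub>F p in sequentially. (\<Sum>j1\<le>q. \<Sum>j3\<le>q. tail (?f j1 j3) p) < e / 2"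
    using assms by (intro order_tendstoD(2)) auto
  then obtain N where N: "\<And>p. p \<ge> N \<Longrightarrow> (\<Sum>j1\<le>q. \<Sum>j3\<le>q. tail (?f j1 j3) p) < e / 2"
    by (auto simp: eventually_sequentially)
  have S: "(\<integral>x. (\<Sum>j1\<le>q. (\<Phi> j1 x)\<^sup>2) * (\<Sum>j3\<le>q. (\<Psi> j3 x)\<^sup>2) \<partial>\<mu>) = (\<Sum>j1\<le>q. \<Sum>j3\<le>q. \<integral>x. (?f j1 j3 x)\<^sup>2 \<partial>\<mu>)"
  proof -
    have "(\<Sum>j1\<le>q. \<Sum>j3\<le>q. \<integral>x. (?f j1 j3 x)\<^sup>2 \<partial>\<mu>) = (\<integral>x. (\<Sum>j1\<le>q. \<Sum>j3\<le>q. (?f j1 j3 x)\<^sup>2) \<partial>\<mu>)"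
      by (subst Bochner_Integration.integral_sum, auto intro!: integrable_cont cont_intros)
         (subst Bochner_Integration.integral_sum, auto intro!: integrable_cont cont_intros)
    then show ?thesis by (simp add: sum_product power_mult_distrib)
  qed
  have "(T - t) ^ 3 / 6 - 2 * (T - t) * (\<integral>u. \<theta> q u \<partial>\<mu>) = (\<integral>x. (x - t) * (T - x) - 2 * (T - t) * \<theta> q x \<partial>\<mu>)"
    by (subst Bochner_Integration.integral_diff) (auto intro!: integrable_cont cont_intros simp: integral_parabola)
  also have "\<dots> \<le> (\<integral>x. (\<Sum>j1\<le>q. (\<Phi> j1 x)\<^sup>2) * (\<Sum>j3\<le>q. (\<Psi> j3 x)\<^sup>2) \<partial>\<mu>)"
  proof (rule integral_mono)
    show "integrable \<mu> (\<lambda>x. (x - t) * (T - x) - 2 * (T - t) * \<theta> q x)"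
      "integrable \<mu> (\<lambda>x. (\<Sum>j1\<le>q. (\<Phi> j1 x)\<^sup>2) * (\<Sum>j3\<le>q. (\<Psi> j3 x)\<^sup>2))"
      by (auto intro!: integrable_cont cont_intros)
    fix x assume "x \<in> space \<mu>"
    then have x: "x \<in> {t..T}" by auto
    have "(\<Sum>j1\<le>q. (\<Phi> j1 x)\<^sup>2) * (\<Sum>j3\<le>q. (\<Psi> j3 x)\<^sup>2) = ((x - t) - \<theta> q x) * ((T - x) - \<theta> q x)"
      unfolding sum_Psi_square[OF x] by (simp add: \<theta>_def)
    also have "\<dots> = (x - t) * (T - x) - (T - t) * \<theta> q x + (\<theta> q x)\<^sup>2" by (simp add: power2_eq_square algebra_simps)
    \<comment> \<open>The doubled constant is mere slack: nonnegativity of \<theta> and of its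
      square suffice.\<close>
    also have "\<dots> \<ge> (x - t) * (T - x) - 2 * (T - t) * \<theta> q x"
    proof -
      have "0 \<le> (T - t) * \<theta> q x" using theta_nonneg[OF x, of q] tT by simp
      then show ?thesis unfolding mult.assoc using zero_le_power2[of "\<theta> q x"] by linarith
    qed
    finally show "(x - t) * (T - x) - 2 * (T - t) * \<theta> q x \<le> (\<Sum>j1\<le>q. (\<Phi> j1 x)\<^sup>2) * (\<Sum>j3\<le>q. (\<Psi> j3 x)\<^sup>2)" .
  qed
  also note S
  finally have A: "(T - t) ^ 3 / 6 - 2 * (T - t) * (\<integral>u. \<theta> q u \<partial>\<mu>) \<le> (\<Sum>j1\<le>q. \<Sum>j3\<le>q. \<integral>x. (?f j1 j3 x)\<^sup>2 \<partial>\<mu>)" .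
  have B: "(\<Sum>j1\<le>q. \<Sum>j3\<le>q. \<integral>x. (?f j1 j3 x)\<^sup>2 \<partial>\<mu>) = boxsum q p q + (\<Sum>j1\<le>q. \<Sum>j3\<le>q. tail (?f j1 j3) p)" for p
  proof -
    have "(\<integral>x. (?f j1 j3 x)\<^sup>2 \<partial>\<mu>) = (\<Sum>j2\<le>p. (coeffC t T j3 j2 j1)\<^sup>2) + tail (?f j1 j3) p" for j1 j3
      unfolding tail_def coeffC_mu by (simp add: mult_ac)
    then have "(\<Sum>j1\<le>q. \<Sum>j3\<le>q. \<integral>x. (?f j1 j3 x)\<^sup>2 \<partial>\<mu>)
      = (\<Sum>j1\<le>q. \<Sum>j3\<le>q. \<Sum>j2\<le>p. (coeffC t T j3 j2 j1)\<^sup>2) + (\<Sum>j1\<le>q. \<Sum>j3\<le>q. tail (?f j1 j3) p)"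
      by (simp add: sum.distrib)
    also have "(\<Sum>j1\<le>q. \<Sum>j3\<le>q. \<Sum>j2\<le>p. (coeffC t T j3 j2 j1)\<^sup>2) = boxsum q p q"
      unfolding boxsum_def by (rule sum.cong[OF refl], rule sum.swap)
    finally show ?thesis .
  qed
  have "(T - t) ^ 3 / 6 - boxsum p1 p2 p3 < e" if "p1 \<ge> max q N" "p2 \<ge> max q N" "p3 \<ge> max q N" for p1 p2 p3
  proof -
    have "boxsum q p2 q \<le> boxsum p1 p2 p3" using that by (intro boxsum_mono) auto
    moreover have "(\<Sum>j1\<le>q. \<Sum>j3\<le>q. tail (?f j1 j3) p2) < e / 2" using N that by auto
    ultimately show ?thesis using A B[of p2] q by linarith
  qed
  then show ?thesis by blast
qed

text \<open>Points are triples (y, x, z) with the middle time first: for fixed y the kernel is a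
  product of a function of x and a function of z, so the inner integrals separate.\<close>

definition N3 :: "(real \<times> real \<times> real) measure" where "N3 = \<mu> \<Otimes>\<^sub>M (\<mu> \<Otimes>\<^sub>M \<mu>)"

lemma finite_\<mu>2: "finite_measure (\<mu> \<Otimes>\<^sub>M \<mu>)"
  by (rule finite_measure_pair_measure) (rule finite_\<mu>)+

lemma finite_N3: "finite_measure N3"
  unfolding N3_def by (intro finite_measure_pair_measure finite_\<mu> finite_\<mu>2)

lemma space_N3: "space N3 = {t..<T} \<times> {t..<T} \<times> {t..<T}"
  by (simp add: N3_def space_pair_measure)

lemma integral_\<mu>2:
  assumes "bdd_meas (\<mu> \<Otimes>\<^sub>M \<mu>) f"
  shows "(\<integral>p. f p \<partial>(\<mu> \<Otimes>\<^sub>M \<mu>)) = (\<integral>x. \<integral>z. f (x, z) \<partial>\<mu> \<partial>\<mu>)"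
proof -
  interpret P: pair_sigma_finite \<mu> \<mu>
    by (intro pair_sigma_finite.intro finite_measure.axioms(1) finite_\<mu>)
  show ?thesis by (rule P.integral_fst'[symmetric, OF bdd_meas_integrable[OF finite_\<mu>2 assms]])
qed

lemma integral_N3:
  assumes f: "bdd_meas N3 f"
  shows "(\<integral>p. f p \<partial>N3) = (\<integral>y. \<integral>x. \<integral>z. f (y, x, z) \<partial>\<mu> \<partial>\<mu> \<partial>\<mu>)"
proof -
  interpret P: pair_sigma_finite \<mu> "\<mu> \<Otimes>\<^sub>M \<mu>"
    by (intro pair_sigma_finite.intro finite_measure.axioms(1) finite_\<mu> finite_\<mu>2)
  have "(\<integral>p. f p \<partial>N3) = (\<integral>y. (\<integral>p. f (y, p) \<partial>(\<mu> \<Otimes>\<^sub>M \<mu>)) \<partial>\<mu>)"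
    unfolding N3_def by (rule P.integral_fst'[symmetric]) (use bdd_meas_integrable[OF finite_N3 f] in \<open>simp add: N3_def\<close>)
  also have "\<dots> = (\<integral>y. \<integral>x. \<integral>z. f (y, x, z) \<partial>\<mu> \<partial>\<mu> \<partial>\<mu>)"
  proof (rule Bochner_Integration.integral_cong[OF refl])
    fix y assume y: "y \<in> space \<mu>"
    obtain B where "\<And>p. p \<in> space N3 \<Longrightarrow> \<bar>f p\<bar> \<le> B" using f by (auto simp: bdd_meas_def)
    moreover have "(\<lambda>p. f (y, p)) \<in> borel_measurable (\<mu> \<Otimes>\<^sub>M \<mu>)"
      using f y by (intro measurable_Pair2[of f \<mu>]) (auto simp: bdd_meas_def N3_def)
    ultimately have "bdd_meas (\<mu> \<Otimes>\<^sub>M \<mu>) (\<lambda>p. f (y, p))"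
      using y by (intro bdd_measI[of _ _ B]) (auto simp: space_N3 space_pair_measure)
    then show "(\<integral>p. f (y, p) \<partial>(\<mu> \<Otimes>\<^sub>M \<mu>)) = (\<integral>x. \<integral>z. f (y, x, z) \<partial>\<mu> \<partial>\<mu>)" by (rule integral_\<mu>2)
  qed
  finally show ?thesis .
qed

lemma heavi_AE_lower: "AE x in \<mu>. heavi x y = indicator {..y} x"
  using AE_\<mu>_neq[of y] by eventually_elim (auto simp: heavi_def indicator_def)

lemma heavi_AE_upper: "AE x in \<mu>. heavi y x = 1 - indicator {..y} x"
  using AE_\<mu>_neq[of y] by eventually_elim (auto simp: heavi_def indicator_def)

lemma measurable_heavi1: "(\<lambda>x. heavi x y) \<in> borel_measurable \<mu>" "(\<lambda>x. heavi y x) \<in> borel_measurable \<mu>"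
  unfolding heavi_def by (auto intro!: measurable_\<mu>)

lemma bdd_heavi: "bdd_meas \<mu> (\<lambda>x. heavi x y)" "bdd_meas \<mu> (\<lambda>x. heavi y x)"
  by (rule bdd_measI[of _ _ 1]; use measurable_heavi1 in \<open>auto simp: heavi_def\<close>)+

lemma integral_heavi_lower:
  fixes f :: "real \<Rightarrow> real"
  assumes f: "continuous_on {t..T} f" and y: "y \<in> {t..T}"
  shows "(\<integral>x. heavi x y * f x \<partial>\<mu>) = integral {t..y} f"
proof -
  have "(\<integral>x. heavi x y * f x \<partial>\<mu>) = (\<integral>x. f x * indicator {..y} x \<partial>\<mu>)"
  proof (rule integral_cong_AE)
    show "(\<lambda>x. heavi x y * f x) \<in> borel_measurable \<mu>" "(\<lambda>x. f x * indicator {..y} x) \<in> borel_measurable \<mu>"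
      by (intro bdd_meas_measurable bdd_intros bdd_heavi bdd_indicator continuous_bdd_meas f)+
    show "AE x in \<mu>. heavi x y * f x = f x * indicator {..y} x"
      using heavi_AE_lower[of y] by eventually_elim simp
  qed
  then show ?thesis using integral_\<mu>_interval[OF f y] by simp
qed

lemma integral_heavi_upper:
  fixes f :: "real \<Rightarrow> real"
  assumes f: "continuous_on {t..T} f" and y: "y \<in> {t..T}"
  shows "(\<integral>x. heavi y x * f x \<partial>\<mu>) = integral {t..T} f - integral {t..y} f"
proof -
  have "(\<integral>x. heavi y x * f x \<partial>\<mu>) = (\<integral>x. f x - f x * indicator {..y} x \<partial>\<mu>)"
  proof (rule integral_cong_AE)
    show "(\<lambda>x. heavi y x * f x) \<in> borel_measurable \<mu>" "(\<lambda>x. f x - f x * indicator {..y} x) \<in> borel_measurable \<mu>"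
      by (intro bdd_meas_measurable bdd_intros bdd_heavi bdd_indicator continuous_bdd_meas f)+
    show "AE x in \<mu>. heavi y x * f x = f x - f x * indicator {..y} x"
      using heavi_AE_upper[of y] by eventually_elim (simp add: right_diff_distrib left_diff_distrib mult.commute)
  qed
  also have "\<dots> = integral {t..T} f - integral {t..y} f"
    using integral_\<mu>_interval[OF f y] integral_\<mu>[OF f]
    by (subst Bochner_Integration.integral_diff)
       (simp_all add: bdd_meas_integrable[OF finite_\<mu>] bdd_meas_mult bdd_indicator continuous_bdd_meas f)
  finally show ?thesis .
qed

end

section \<open>The kernel and its traces\<close>

context interval
begin

lemma measurable_\<mu>_id: "(\<lambda>x. x) \<in> borel_measurable \<mu>"
  by (rule measurable_\<mu>) simp

lemma measurable_N3_proj: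
  "fst \<in> measurable N3 \<mu>" "(\<lambda>p. fst (snd p)) \<in> measurable N3 \<mu>" "(\<lambda>p. snd (snd p)) \<in> measurable N3 \<mu>"
  unfolding N3_def by measurable

lemma bdd_N3_proj:
  assumes "bdd_meas \<mu> f"
  shows "bdd_meas N3 (\<lambda>p. f (fst p))" "bdd_meas N3 (\<lambda>p. f (fst (snd p)))" "bdd_meas N3 (\<lambda>p. f (snd (snd p)))"
proof -
  obtain B where B: "\<And>x. x \<in> space \<mu> \<Longrightarrow> \<bar>f x\<bar> \<le> B" and f: "f \<in> borel_measurable \<mu>"
    using assms unfolding bdd_meas_def by blast
  show "bdd_meas N3 (\<lambda>p. f (fst p))" "bdd_meas N3 (\<lambda>p. f (fst (snd p)))" "bdd_meas N3 (\<lambda>p. f (snd (snd p)))"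
    using B measurable_compose[OF measurable_N3_proj(1) f] measurable_compose[OF measurable_N3_proj(2) f]
      measurable_compose[OF measurable_N3_proj(3) f]
    by (auto intro!: bdd_measI[of _ _ B] simp: space_N3)
qed

lemma bdd_heavi_N3: "bdd_meas N3 (\<lambda>p. heavi (fst (snd p)) (fst p))" "bdd_meas N3 (\<lambda>p. heavi (fst p) (snd (snd p)))"
proof -
  have [measurable]: "fst \<in> borel_measurable N3" "(\<lambda>p. fst (snd p)) \<in> borel_measurable N3" "(\<lambda>p. snd (snd p)) \<in> borel_measurable N3"
    using measurable_N3_proj[THEN measurable_compose, OF measurable_\<mu>_id] by auto
  have "(\<lambda>p. heavi (fst (snd p)) (fst p)) \<in> borel_measurable N3" "(\<lambda>p. heavi (fst p) (snd (snd p))) \<in> borel_measurable N3"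
    unfolding heavi_def by measurable
  then show "bdd_meas N3 (\<lambda>p. heavi (fst (snd p)) (fst p))" "bdd_meas N3 (\<lambda>p. heavi (fst p) (snd (snd p)))"
    by (auto intro!: bdd_measI[of _ _ 1] simp: heavi_def)
qed

definition K3 :: "real \<times> real \<times> real \<Rightarrow> real" where
  "K3 p = heavi (fst (snd p)) (fst p) * heavi (fst p) (snd (snd p))"

text \<open>The index triple is ordered (j1, j2, j3) for the times x, y, z, whereas the point is
  ordered (y, x, z).\<close>

definition e3 :: "nat \<times> nat \<times> nat \<Rightarrow> real \<times> real \<times> real \<Rightarrow> real" where
  "e3 J p = \<phi> (fst (snd J)) (fst p) * \<phi> (fst J) (fst (snd p)) * \<phi> (snd (snd J)) (snd (snd p))"

lemma bdd_K3: "bdd_meas N3 K3"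
  unfolding K3_def[abs_def] by (intro bdd_intros bdd_heavi_N3)

lemma bdd_e3: "bdd_meas N3 (e3 J)"
  unfolding e3_def[abs_def] by (intro bdd_intros bdd_N3_proj bdd_phi)

lemma integral_N3_product':
  assumes F: "bdd_meas N3 F" and eq: "\<And>y x z. F (y, x, z) = f y * g y x * h y z"
  shows "(\<integral>p. F p \<partial>N3) = (\<integral>y. f y * (\<integral>x. g y x \<partial>\<mu>) * (\<integral>z. h y z \<partial>\<mu>) \<partial>\<mu>)"
  unfolding integral_N3[OF F] eq by (simp add: mult.assoc)

lemma e3_orthonormal: "(\<integral>p. e3 J p * e3 J' p \<partial>N3) = (if J = J' then 1 else 0)"
proof -
  have "(\<integral>p. e3 J p * e3 J' p \<partial>N3) = (\<integral>y. (\<phi> (fst (snd J)) y * \<phi> (fst (snd J')) y)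
     * (\<integral>x. \<phi> (fst J) x * \<phi> (fst J') x \<partial>\<mu>) * (\<integral>z. \<phi> (snd (snd J)) z * \<phi> (snd (snd J')) z \<partial>\<mu>) \<partial>\<mu>)"
    by (rule integral_N3_product', intro bdd_meas_mult bdd_e3) (simp add: e3_def mult_ac)
  also have "\<dots> = (if J = J' then 1 else 0)"
    by (cases J; cases J') (simp add: phi_orthonormal)
  finally show ?thesis .
qed

lemma integral_K3_e3: "(\<integral>p. K3 p * e3 (j1, j2, j3) p \<partial>N3) = coeffC t T j3 j2 j1"
proof -
  have "(\<integral>p. K3 p * e3 (j1, j2, j3) p \<partial>N3)
     = (\<integral>y. \<phi> j2 y * (\<integral>x. heavi x y * \<phi> j1 x \<partial>\<mu>) * (\<integral>z. heavi y z * \<phi> j3 z \<partial>\<mu>) \<partial>\<mu>)"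
    by (rule integral_N3_product', intro bdd_meas_mult bdd_K3 bdd_e3) (simp add: e3_def K3_def mult_ac)
  also have "\<dots> = (\<integral>y. \<Phi> j1 y * \<phi> j2 y * \<Psi> j3 y \<partial>\<mu>)"
    by (intro Bochner_Integration.integral_cong refl)
       (simp add: integral_heavi_lower[OF continuous_phi] integral_heavi_upper[OF continuous_phi] \<Psi>_def \<Phi>_def)
  finally show ?thesis by (simp add: coeffC_mu)
qed

lemma integral_K3_square: "(\<integral>p. (K3 p)\<^sup>2 \<partial>N3) = (T - t) ^ 3 / 6"
proof -
  have lower: "(\<integral>x. (heavi x y)\<^sup>2 \<partial>\<mu>) = y - t" and upper: "(\<integral>x. (heavi y x)\<^sup>2 \<partial>\<mu>) = T - y" if y: "y \<in> {t..T}" for y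
  proof -
    have "(\<integral>x. (heavi x y)\<^sup>2 \<partial>\<mu>) = (\<integral>x. heavi x y * 1 \<partial>\<mu>)" "(\<integral>x. (heavi y x)\<^sup>2 \<partial>\<mu>) = (\<integral>x. heavi y x * 1 \<partial>\<mu>)"
      using AE_\<mu>_neq[of y]
      by (intro integral_cong_AE; (intro bdd_meas_measurable bdd_intros bdd_heavi)?; eventually_elim; auto simp: heavi_def)+
    then show "(\<integral>x. (heavi x y)\<^sup>2 \<partial>\<mu>) = y - t" "(\<integral>x. (heavi y x)\<^sup>2 \<partial>\<mu>) = T - y"
      using y tT integral_heavi_lower[of "\<lambda>_. 1" y] integral_heavi_upper[of "\<lambda>_. 1" y] by auto
  qed
  have "(\<integral>p. (K3 p)\<^sup>2 \<partial>N3) = (\<integral>y. 1 * (\<integral>x. (heavi x y)\<^sup>2 \<partial>\<mu>) * (\<integral>z. (heavi y z)\<^sup>2 \<partial>\<mu>) \<partial>\<mu>)"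
    by (rule integral_N3_product', intro bdd_meas_power2 bdd_K3) (simp add: K3_def power_mult_distrib)
  also have "\<dots> = (\<integral>y. (y - t) * (T - y) \<partial>\<mu>)"
    by (intro Bochner_Integration.integral_cong refl) (simp add: lower upper)
  finally show ?thesis by (simp add: integral_parabola)
qed

definition Kp :: "nat \<Rightarrow> nat \<Rightarrow> nat \<Rightarrow> real \<Rightarrow> real \<Rightarrow> real \<Rightarrow> real" where
  "Kp p1 p2 p3 x y z = (\<Sum>j1\<le>p1. \<Sum>j2\<le>p2. \<Sum>j3\<le>p3. coeffC t T j3 j2 j1 * \<phi> j1 x * \<phi> j2 y * \<phi> j3 z)"

lemma kernel_dist:
  "(\<integral>p. (K3 p - Kp p1 p2 p3 (fst (snd p)) (fst p) (snd (snd p)))\<^sup>2 \<partial>N3) = (T - t) ^ 3 / 6 - boxsum p1 p2 p3"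
proof -
  let ?S = "{..p1} \<times> {..p2} \<times> {..p3}"
  let ?c = "\<lambda>J. coeffC t T (snd (snd J)) (fst (snd J)) (fst J)"
  have c: "(\<integral>p. K3 p * e3 J p \<partial>N3) = ?c J" for J
    using integral_K3_e3[of "fst J" "fst (snd J)" "snd (snd J)"] by simp
  have "Kp p1 p2 p3 (fst (snd p)) (fst p) (snd (snd p)) = (\<Sum>J\<in>?S. ?c J * e3 J p)" for p
    by (simp add: Kp_def sum.cartesian_product case_prod_beta e3_def mult_ac)
  then have "(\<integral>p. (K3 p - Kp p1 p2 p3 (fst (snd p)) (fst p) (snd (snd p)))\<^sup>2 \<partial>N3)
     = (\<integral>p. (K3 p - (\<Sum>J\<in>?S. ?c J * e3 J p))\<^sup>2 \<partial>N3)" by simp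
  also have "\<dots> = (\<integral>p. (K3 p)\<^sup>2 \<partial>N3) - (\<Sum>J\<in>?S. (\<integral>p. K3 p * e3 J p \<partial>N3)\<^sup>2)
     + (\<Sum>J\<in>?S. (?c J - (\<integral>p. K3 p * e3 J p \<partial>N3))\<^sup>2)"
    by (rule orthonormal_remainder[OF finite_N3]) (auto simp: bdd_e3 bdd_K3 e3_orthonormal)
  finally show ?thesis
    by (simp add: c integral_K3_square boxsum_def sum.cartesian_product case_prod_beta)
qed

text \<open>The diagonal of an index rectangle ends at the smaller side; this is where
  \<open>min\<close> of two truncation indices comes from in the traces.\<close>

lemma sum_min:
  fixes p q :: nat
  shows "(\<Sum>i\<le>p. \<Sum>j\<le>q. if i = j then f i j else 0) = (\<Sum>i\<le>min p q. f i i :: real)"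
proof -
  have "(\<Sum>i\<le>p. \<Sum>j\<le>q. if i = j then f i j else 0) = (\<Sum>i\<le>p. if i \<le> q then f i i else 0)"
    by (intro sum.cong refl) (simp add: sum.delta')
  also have "\<dots> = (\<Sum>i\<in>{..p} \<inter> {..q}. f i i)" by (subst sum.inter_restrict) simp_all
  also have "{..p} \<inter> {..q} = {..min p q}" by auto
  finally show ?thesis .
qed

lemma trace_integral_aux:
  "(\<integral>y. c * (\<phi> i y * \<phi> j y) \<partial>\<mu>) = (if i = j then c else 0)"
  by (simp add: phi_orthonormal)

lemma integrable_phi2: "integrable \<mu> (\<lambda>y. c * (\<phi> i y * \<phi> j y))"
  by (intro integrable_cont cont_intros)

lemma integral_sum3:
  assumes "\<And>i j k. integrable \<mu> (f i j k)"
  shows "(\<integral>y. (\<Sum>i\<in>I. \<Sum>j\<in>J. \<Sum>k\<in>K. f i j k y) \<partial>\<mu>) = (\<Sum>i\<in>I. \<Sum>j\<in>J. \<Sum>k\<in>K. \<integral>y. f i j k y \<partial>\<mu> :: real)"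
  using assms by (simp add: Bochner_Integration.integral_sum Bochner_Integration.integrable_sum)

lemma Kp_trace23:
  "(\<integral>y. Kp p1 p2 p3 x y y \<partial>\<mu>) = (\<Sum>j1\<le>p1. (\<Sum>j\<le>min p2 p3. coeffC t T j j j1) * \<phi> j1 x)"
proof -
  have "(\<integral>y. Kp p1 p2 p3 x y y \<partial>\<mu>)
    = (\<integral>y. (\<Sum>j1\<le>p1. \<Sum>j2\<le>p2. \<Sum>j3\<le>p3. (coeffC t T j3 j2 j1 * \<phi> j1 x) * (\<phi> j2 y * \<phi> j3 y)) \<partial>\<mu>)"
    by (simp add: Kp_def mult_ac)
  also have "\<dots> = (\<Sum>j1\<le>p1. \<Sum>j2\<le>p2. \<Sum>j3\<le>p3. if j2 = j3 then coeffC t T j3 j2 j1 * \<phi> j1 x else 0)"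
    by (simp only: integral_sum3[OF integrable_phi2] trace_integral_aux)
  finally show ?thesis by (simp only: sum_min sum_distrib_right)
qed

lemma Kp_trace12:
  "(\<integral>y. Kp p1 p2 p3 y y x \<partial>\<mu>) = (\<Sum>j3\<le>p3. (\<Sum>j\<le>min p1 p2. coeffC t T j3 j j) * \<phi> j3 x)"
proof -
  have "(\<integral>y. Kp p1 p2 p3 y y x \<partial>\<mu>)
    = (\<integral>y. (\<Sum>j1\<le>p1. \<Sum>j2\<le>p2. \<Sum>j3\<le>p3. (coeffC t T j3 j2 j1 * \<phi> j3 x) * (\<phi> j1 y * \<phi> j2 y)) \<partial>\<mu>)"
    by (simp add: Kp_def mult_ac)
  also have "\<dots> = (\<Sum>j1\<le>p1. \<Sum>j2\<le>p2. \<Sum>j3\<le>p3. if j1 = j2 then coeffC t T j3 j2 j1 * \<phi> j3 x else 0)"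
    by (simp only: integral_sum3[OF integrable_phi2] trace_integral_aux)
  also have "\<dots> = (\<Sum>j1\<le>p1. \<Sum>j2\<le>p2. if j1 = j2 then (\<Sum>j3\<le>p3. coeffC t T j3 j2 j1 * \<phi> j3 x) else 0)"
    by (intro sum.cong refl) auto
  also have "\<dots> = (\<Sum>j\<le>min p1 p2. \<Sum>j3\<le>p3. coeffC t T j3 j j * \<phi> j3 x)" by (rule sum_min)
  also have "\<dots> = (\<Sum>j3\<le>p3. \<Sum>j\<le>min p1 p2. coeffC t T j3 j j * \<phi> j3 x)" by (rule sum.swap)
  finally show ?thesis by (simp add: sum_distrib_right)
qed

lemma Kp_trace13:
  "(\<integral>y. Kp p1 p2 p3 y x y \<partial>\<mu>) = (\<Sum>j2\<le>p2. (\<Sum>j\<le>min p1 p3. coeffC t T j j2 j) * \<phi> j2 x)"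
proof -
  have "(\<integral>y. Kp p1 p2 p3 y x y \<partial>\<mu>)
    = (\<integral>y. (\<Sum>j1\<le>p1. \<Sum>j2\<le>p2. \<Sum>j3\<le>p3. (coeffC t T j3 j2 j1 * \<phi> j2 x) * (\<phi> j1 y * \<phi> j3 y)) \<partial>\<mu>)"
    by (simp add: Kp_def mult_ac)
  also have "\<dots> = (\<Sum>j1\<le>p1. \<Sum>j2\<le>p2. \<Sum>j3\<le>p3. if j1 = j3 then coeffC t T j3 j2 j1 * \<phi> j2 x else 0)"
    by (simp only: integral_sum3[OF integrable_phi2] trace_integral_aux)
  also have "\<dots> = (\<Sum>j2\<le>p2. \<Sum>j1\<le>p1. \<Sum>j3\<le>p3. if j1 = j3 then coeffC t T j3 j2 j1 * \<phi> j2 x else 0)"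
    by (rule sum.swap)
  finally show ?thesis by (simp only: sum_min sum_distrib_right)
qed

lemma bdd_Kp: "bdd_meas \<mu> (\<lambda>y. Kp p1 p2 p3 x y y)" "bdd_meas \<mu> (\<lambda>y. Kp p1 p2 p3 y x y)" "bdd_meas \<mu> (\<lambda>y. Kp p1 p2 p3 y y x)"
  unfolding Kp_def by (intro bdd_intros bdd_phi)+

definition Ap :: "nat \<Rightarrow> nat \<Rightarrow> nat \<Rightarrow> real \<Rightarrow> real \<Rightarrow> real \<Rightarrow> real" where
  "Ap p1 p2 p3 x y z = Kp p1 p2 p3 x y z - heavi x y * heavi y z"

text \<open>On the diagonal y = z the kernel has the factor 1/2, so its trace is (T - x) / 2, and
  this is exactly the g which the trace of the expansion approaches. Any other diagonal value would
  leave a gap.\<close>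

lemma Ap_trace23: "x \<in> {t..T} \<Longrightarrow> (\<integral>y. Ap p1 p2 p3 x y y \<partial>\<mu>)
   = - ((T - x) / 2 - (\<Sum>j1\<le>p1. (\<integral>u. ((T - u) / 2 - 1 / 2 * \<theta> (min p2 p3) u) * \<phi> j1 u \<partial>\<mu>) * \<phi> j1 x))"
proof -
  assume x: "x \<in> {t..T}"
  have "(\<integral>y. Ap p1 p2 p3 x y y \<partial>\<mu>) = (\<integral>y. Kp p1 p2 p3 x y y \<partial>\<mu>) - (\<integral>y. heavi x y * (1 / 2) \<partial>\<mu>)"
    unfolding Ap_def heavi_diag
    by (intro Bochner_Integration.integral_diff bdd_meas_integrable[OF finite_\<mu>] bdd_Kp bdd_intros bdd_heavi)
  also have "(\<integral>y. heavi x y * (1 / 2) \<partial>\<mu>) = (T - x) / 2"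
    using x tT integral_heavi_upper[of "\<lambda>_. 1" x] by simp
  finally show ?thesis unfolding Kp_trace23 trace23 by simp
qed

lemma Ap_trace12: "x \<in> {t..T} \<Longrightarrow> (\<integral>y. Ap p1 p2 p3 y y x \<partial>\<mu>)
   = - ((x - t) / 2 - (\<Sum>j3\<le>p3. (\<integral>u. ((u - t) / 2 - 1 / 2 * \<theta> (min p1 p2) u) * \<phi> j3 u \<partial>\<mu>) * \<phi> j3 x))"
proof -
  assume x: "x \<in> {t..T}"
  have "(\<integral>y. Ap p1 p2 p3 y y x \<partial>\<mu>) = (\<integral>y. Kp p1 p2 p3 y y x \<partial>\<mu>) - (\<integral>y. 1 / 2 * heavi y x \<partial>\<mu>)"
    unfolding Ap_def heavi_diag
    by (intro Bochner_Integration.integral_diff bdd_meas_integrable[OF finite_\<mu>] bdd_Kp bdd_intros bdd_heavi)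
  also have "(\<integral>y. 1 / 2 * heavi y x \<partial>\<mu>) = (x - t) / 2"
    using x tT integral_heavi_lower[of "\<lambda>_. 1" x] by simp
  finally show ?thesis unfolding Kp_trace12 trace12 by simp
qed

text \<open>The kernel demands x both before and after y, so it vanishes except at one point and has
  trace 0.\<close>

lemma Ap_trace13: "(\<integral>y. Ap p1 p2 p3 y x y \<partial>\<mu>)
   = - (0 - (\<Sum>j2\<le>p2. (\<integral>u. (0 - (-1) * \<theta> (min p1 p3) u) * \<phi> j2 u \<partial>\<mu>) * \<phi> j2 x))"
proof -
  have "(\<integral>y. Ap p1 p2 p3 y x y \<partial>\<mu>) = (\<integral>y. Kp p1 p2 p3 y x y \<partial>\<mu>) - (\<integral>y. heavi y x * heavi x y \<partial>\<mu>)"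
    unfolding Ap_def
    by (intro Bochner_Integration.integral_diff bdd_meas_integrable[OF finite_\<mu>] bdd_Kp bdd_intros bdd_heavi)
  also have "(\<integral>y. heavi y x * heavi x y \<partial>\<mu>) = (\<integral>y. 0 \<partial>\<mu>)"
  proof (rule integral_cong_AE)
    show "(\<lambda>y. heavi y x * heavi x y) \<in> borel_measurable \<mu>"
      by (intro bdd_meas_measurable bdd_intros bdd_heavi)
    show "AE y in \<mu>. heavi y x * heavi x y = 0"
      using AE_\<mu>_neq[of x] by eventually_elim (auto simp: heavi_def)
  qed simp
  finally show ?thesis unfolding Kp_trace13 trace13 by simp
qed

text \<open>The right-hand side of \<open>cubic_form_moment\<close> with sums over cells replaced by
  integrals.\<close>

definition det_bound :: "nat \<Rightarrow> nat \<Rightarrow> nat \<Rightarrow> real" where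
  "det_bound p1 p2 p3 =
     3 * (\<integral>x. (\<integral>y. Ap p1 p2 p3 x y y \<partial>\<mu>)\<^sup>2 \<partial>\<mu>) + 3 * (\<integral>x. (\<integral>y. Ap p1 p2 p3 y x y \<partial>\<mu>)\<^sup>2 \<partial>\<mu>)
     + 3 * (\<integral>x. (\<integral>y. Ap p1 p2 p3 y y x \<partial>\<mu>)\<^sup>2 \<partial>\<mu>)
     + 6 * (\<integral>p. (Ap p1 p2 p3 (fst (snd p)) (fst p) (snd (snd p)))\<^sup>2 \<partial>N3)"

lemma det_bound_le:
  "det_bound p1 p2 p3 \<le> 3 * (tail (\<lambda>x. (T - x) / 2) p1 + (1 / 2)\<^sup>2 * (\<integral>x. (\<theta> (min p2 p3) x)\<^sup>2 \<partial>\<mu>))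
     + 3 * (tail (\<lambda>_. 0) p2 + (-1)\<^sup>2 * (\<integral>x. (\<theta> (min p1 p3) x)\<^sup>2 \<partial>\<mu>))
     + 3 * (tail (\<lambda>x. (x - t) / 2) p3 + (1 / 2)\<^sup>2 * (\<integral>x. (\<theta> (min p1 p2) x)\<^sup>2 \<partial>\<mu>))
     + 6 * ((T - t) ^ 3 / 6 - boxsum p1 p2 p3)"
  unfolding det_bound_def
proof (intro add_mono mult_left_mono)
  have cong: "(\<integral>x. (f x)\<^sup>2 \<partial>\<mu>) = (\<integral>x. (g x)\<^sup>2 \<partial>\<mu>)" if "\<And>x. x \<in> {t..T} \<Longrightarrow> f x = - g x" for f g :: "real \<Rightarrow> real"
    using that by (intro Bochner_Integration.integral_cong refl) auto
  show "(\<integral>x. (\<integral>y. Ap p1 p2 p3 x y y \<partial>\<mu>)\<^sup>2 \<partial>\<mu>) \<le> tail (\<lambda>x. (T - x) / 2) p1 + (1 / 2)\<^sup>2 * (\<integral>x. (\<theta> (min p2 p3) x)\<^sup>2 \<partial>\<mu>)"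
    by (subst cong[OF Ap_trace23], assumption) (rule trace_norm, intro continuous_intros; simp)
  show "(\<integral>x. (\<integral>y. Ap p1 p2 p3 y x y \<partial>\<mu>)\<^sup>2 \<partial>\<mu>) \<le> tail (\<lambda>_. 0) p2 + (-1)\<^sup>2 * (\<integral>x. (\<theta> (min p1 p3) x)\<^sup>2 \<partial>\<mu>)"
    by (subst cong[OF Ap_trace13]) (rule trace_norm, intro continuous_intros)
  show "(\<integral>x. (\<integral>y. Ap p1 p2 p3 y y x \<partial>\<mu>)\<^sup>2 \<partial>\<mu>) \<le> tail (\<lambda>x. (x - t) / 2) p3 + (1 / 2)\<^sup>2 * (\<integral>x. (\<theta> (min p1 p2) x)\<^sup>2 \<partial>\<mu>)"
    by (subst cong[OF Ap_trace12], assumption) (rule trace_norm, intro continuous_intros; simp)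
  show "(\<integral>p. (Ap p1 p2 p3 (fst (snd p)) (fst p) (snd (snd p)))\<^sup>2 \<partial>N3) \<le> (T - t) ^ 3 / 6 - boxsum p1 p2 p3"
    unfolding kernel_dist[symmetric] Ap_def K3_def by (subst power2_commute) simp
qed auto

lemma det_bound_tendsto_0:
  "((\<lambda>(p1, p2, p3). det_bound p1 p2 p3) \<longlongrightarrow> 0) (sequentially \<times>\<^sub>F sequentially \<times>\<^sub>F sequentially)"
proof (rule order_tendstoI)
  have nn: "0 \<le> det_bound p1 p2 p3" for p1 p2 p3 by (simp add: det_bound_def)
  show "\<forall>\<^sub>F p in sequentially \<times>\<^sub>F sequentially \<times>\<^sub>F sequentially. a < (case p of (p1, p2, p3) \<Rightarrow> det_bound p1 p2 p3)" if "a < 0" for a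
    using that nn by (intro always_eventually) (auto intro: less_le_trans)
  fix e :: real assume e: "0 < e"
  have "\<exists>n. \<forall>p1\<ge>n. \<forall>p2\<ge>n. \<forall>p3\<ge>n. det_bound p1 p2 p3 < e"
  proof -
    \<comment> \<open>In \<open>det_bound_le\<close> the terms to be made small carry the total
      weight 19.5, so e / 36 for each is ample.\<close>
    have small: "\<exists>n. \<forall>p\<ge>n. f p < e / 36" if "f \<longlonglongrightarrow> 0" for f :: "nat \<Rightarrow> real"
      using order_tendstoD(2)[OF that, of "e / 36"] e by (simp add: eventually_sequentially)
    have c: "continuous_on {t..T} (\<lambda>x. (T - x) / 2)" "continuous_on {t..T} (\<lambda>x. 0 :: real)"
      "continuous_on {t..T} (\<lambda>x. (x - t) / 2)"
      by (intro continuous_intros; simp)+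
    obtain n1 where n1: "\<And>p. p \<ge> n1 \<Longrightarrow> tail (\<lambda>x. (T - x) / 2) p < e / 36"
      using small[OF tail_continuous[OF c(1)]] by blast
    obtain n2 where n2: "\<And>p. p \<ge> n2 \<Longrightarrow> tail (\<lambda>_. 0) p < e / 36"
      using small[OF tail_continuous[OF c(2)]] by blast
    obtain n3 where n3: "\<And>p. p \<ge> n3 \<Longrightarrow> tail (\<lambda>x. (x - t) / 2) p < e / 36"
      using small[OF tail_continuous[OF c(3)]] by blast
    obtain n4 where n4: "\<And>p. p \<ge> n4 \<Longrightarrow> (\<integral>x. (\<theta> p x)\<^sup>2 \<partial>\<mu>) < e / 36"
      using small[OF theta_square_tendsto_0] by blast
    obtain n5 where n5: "\<And>p1 p2 p3. p1 \<ge> n5 \<Longrightarrow> p2 \<ge> n5 \<Longrightarrow> p3 \<ge> n5 \<Longrightarrow> (T - t) ^ 3 / 6 - boxsum p1 p2 p3 < e / 36"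
      using boxsum_limit[of "e / 36"] e by auto
    define n where "n = Max {n1, n2, n3, n4, n5}"
    have n: "n1 \<le> n" "n2 \<le> n" "n3 \<le> n" "n4 \<le> n" "n5 \<le> n" by (auto simp: n_def)
    have "det_bound p1 p2 p3 < e" if p: "p1 \<ge> n" "p2 \<ge> n" "p3 \<ge> n" for p1 p2 p3
    proof -
      have "tail (\<lambda>x. (T - x) / 2) p1 < e / 36" "tail (\<lambda>_. 0) p2 < e / 36" "tail (\<lambda>x. (x - t) / 2) p3 < e / 36"
        using n1 n2 n3 n p by (meson order_trans)+
      moreover have "(\<integral>x. (\<theta> (min p2 p3) x)\<^sup>2 \<partial>\<mu>) < e / 36" "(\<integral>x. (\<theta> (min p1 p3) x)\<^sup>2 \<partial>\<mu>) < e / 36"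
        "(\<integral>x. (\<theta> (min p1 p2) x)\<^sup>2 \<partial>\<mu>) < e / 36"
        using n4 n p by (auto simp: min_def)
      moreover have "(T - t) ^ 3 / 6 - boxsum p1 p2 p3 < e / 36" using n5[of p1 p2 p3] n p by auto
      ultimately show ?thesis
        using det_bound_le[of p1 p2 p3] e by (simp add: power2_eq_square)
    qed
    then show ?thesis by blast
  qed
  then obtain n where n: "\<And>p1 p2 p3. p1 \<ge> n \<Longrightarrow> p2 \<ge> n \<Longrightarrow> p3 \<ge> n \<Longrightarrow> det_bound p1 p2 p3 < e" by blast
  have "\<forall>\<^sub>F p in sequentially \<times>\<^sub>F sequentially \<times>\<^sub>F sequentially. fst p \<ge> n \<and> fst (snd p) \<ge> n \<and> snd (snd p) \<ge> n"
    unfolding eventually_prod_filter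
    by (rule exI[of _ "\<lambda>x. x \<ge> n"], rule exI[of _ "\<lambda>p. fst p \<ge> n \<and> snd p \<ge> n"])
       (auto simp: eventually_prod_filter intro!: exI[of _ "\<lambda>x. x \<ge> n"] eventually_ge_at_top)
  then show "\<forall>\<^sub>F p in sequentially \<times>\<^sub>F sequentially \<times>\<^sub>F sequentially. (case p of (p1, p2, p3) \<Rightarrow> det_bound p1 p2 p3) < e"
    by eventually_elim (auto intro: n)
qed

end

section \<open>Riemann sums\<close>

lemma lo_uniform_partition_tendsto:
  assumes "t < T" "u \<in> {t..<T}"
  shows "(\<lambda>n. lo (uniform_partition t T n) u) \<longlonglongrightarrow> u"
proof (rule LIMSEQ_I)
  fix e :: real assume e: "0 < e"
  have tT: "t \<le> T" using assms by simp
  obtain N where N: "\<And>n. n \<ge> N \<Longrightarrow> mesh_below T (uniform_partition t T n) e"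
    using uniform_partition_eventually[OF tT e] by (auto simp: eventually_sequentially)
  have "norm (lo (uniform_partition t T n) u - u) < e" if "n \<ge> N" for n
    using mesh_cell[OF uniform_partition_of[OF tT] assms(2) N[OF that]] lo_le[OF uniform_partition_of[OF tT] assms(2), of n]
      less_hi[OF uniform_partition_of[OF tT] assms(2), of n] by simp
  then show "\<exists>N. \<forall>n\<ge>N. norm (lo (uniform_partition t T n) u - u) < e" by blast
qed

context interval
begin

abbreviation U :: "nat \<Rightarrow> real set" where "U \<equiv> uniform_partition t T"

lemma U: "partition_of t T (U n)" using tT by (intro uniform_partition_of) simp

lemma lo_tendsto: "u \<in> {t..<T} \<Longrightarrow> (\<lambda>n. lo (U n) u) \<longlonglongrightarrow> u"
  by (rule lo_uniform_partition_tendsto[OF tT])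

text \<open>The jump does no harm: for x < y the left cell ends are eventually in strict order, and
  for x = y they coincide. Convergence therefore holds on the diagonal too, where the traces are
  evaluated.\<close>

lemma heavi_tendsto:
  assumes x: "x \<in> {t..<T}" and y: "y \<in> {t..<T}"
  shows "(\<lambda>n. heavi (lo (U n) x) (lo (U n) y)) \<longlonglongrightarrow> heavi x y"
proof (cases x y rule: linorder_cases)
  case less
  have "\<forall>\<^sub>F n in sequentially. x < lo (U n) y" using order_tendstoD(1)[OF lo_tendsto[OF y] less] .
  then have "\<forall>\<^sub>F n in sequentially. heavi (lo (U n) x) (lo (U n) y) = heavi x y"
  proof eventually_elim
    fix n assume "x < lo (U n) y"
    then have "lo (U n) x < lo (U n) y" using lo_le[OF U x, of n] by simp
    then show "heavi (lo (U n) x) (lo (U n) y) = heavi x y" using less by (simp add: heavi_def)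
  qed
  then show ?thesis by (rule tendsto_eventually)
next
  case equal then show ?thesis by simp
next
  case greater
  have "\<forall>\<^sub>F n in sequentially. y < lo (U n) x" using order_tendstoD(1)[OF lo_tendsto[OF x] greater] .
  then have "\<forall>\<^sub>F n in sequentially. heavi (lo (U n) x) (lo (U n) y) = heavi x y"
  proof eventually_elim
    fix n assume "y < lo (U n) x"
    then have "lo (U n) y < lo (U n) x" using lo_le[OF U y, of n] by simp
    then show "heavi (lo (U n) x) (lo (U n) y) = heavi x y" using greater by (simp add: heavi_def)
  qed
  then show ?thesis by (rule tendsto_eventually)
qed

lemma phi_tendsto: "x \<in> {t..<T} \<Longrightarrow> (\<lambda>n. \<phi> j (lo (U n) x)) \<longlonglongrightarrow> \<phi> j x"
  using continuous_on_tendsto_compose[OF continuous_phi[of UNIV j] lo_tendsto[of x]] by auto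

lemma Ap_tendsto:
  assumes "x \<in> {t..<T}" "y \<in> {t..<T}" "z \<in> {t..<T}"
  shows "(\<lambda>n. Ap p1 p2 p3 (lo (U n) x) (lo (U n) y) (lo (U n) z)) \<longlonglongrightarrow> Ap p1 p2 p3 x y z"
  unfolding Ap_def Kp_def using assms by (intro tendsto_intros phi_tendsto heavi_tendsto)

lemma Ap_bounded: "\<exists>B. \<forall>x\<in>{t..<T}. \<forall>y\<in>{t..<T}. \<forall>z\<in>{t..<T}. \<bar>Ap p1 p2 p3 x y z\<bar> \<le> B"
proof -
  have "bdd_meas N3 (\<lambda>p. Ap p1 p2 p3 (fst (snd p)) (fst p) (snd (snd p)))"
    unfolding Ap_def Kp_def by (intro bdd_intros bdd_N3_proj bdd_phi bdd_heavi_N3)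
  then obtain B where "\<forall>p\<in>space N3. \<bar>Ap p1 p2 p3 (fst (snd p)) (fst p) (snd (snd p))\<bar> \<le> B"
    unfolding bdd_meas_def by blast
  then show ?thesis by (intro exI[of _ B]) (force simp: space_N3)
qed

lemma step_repr:
  fixes g :: "real \<Rightarrow> real"
  assumes R: "partition_of t T R" and u: "u \<in> {t..<T}"
  shows "g (lo R u) = (\<Sum>r\<in>R - {T}. g r * indicator {r..<hi R r} u)"
proof -
  have "(\<Sum>r\<in>R - {T}. g r * indicator {r..<hi R r} u) = (\<Sum>r\<in>R - {T}. if lo R u = r then g r else 0)"
    by (intro sum.cong refl) (simp add: lo_eq_iff[OF R u] indicator_def)
  then show ?thesis using R lo_less_b(1)[OF R u] by (simp add: sum.delta')
qed

lemma bdd_cell_indicator: "bdd_meas \<mu> (indicator {r..<s})"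
  by (rule bdd_measI[of _ _ 1]) (auto intro!: measurable_\<mu>)

lemma bdd_meas_cong: "(\<And>x. x \<in> space N \<Longrightarrow> f x = g x) \<Longrightarrow> bdd_meas N f \<Longrightarrow> bdd_meas N g"
  unfolding bdd_meas_def by (auto cong: measurable_cong)

lemma bdd_lo:
  fixes g :: "real \<Rightarrow> real"
  assumes R: "partition_of t T R"
  shows "bdd_meas \<mu> (\<lambda>u. g (lo R u))"
proof (rule bdd_meas_cong)
  show "(\<Sum>r\<in>R - {T}. g r * indicator {r..<hi R r} u) = g (lo R u)" if "u \<in> space \<mu>" for u
    using step_repr[OF R, of u g] that by simp
  show "bdd_meas \<mu> (\<lambda>u. \<Sum>r\<in>R - {T}. g r * indicator {r..<hi R r} u)"
    by (intro bdd_intros bdd_cell_indicator)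
qed

text \<open>A Riemann sum is the integral of the step function g at the left cell end. Being a
  finite combination of cell indicators, it is measurable for arbitrary g.\<close>

lemma sum_integral:
  assumes R: "partition_of t T R"
  shows "(\<Sum>r\<in>R - {T}. (hi R r - r) * g r) = (\<integral>u. g (lo R u) \<partial>\<mu>)"
proof -
  have "(\<integral>u. g (lo R u) \<partial>\<mu>) = (\<integral>u. (\<Sum>r\<in>R - {T}. g r * indicator {r..<hi R r} u) \<partial>\<mu>)"
    by (intro Bochner_Integration.integral_cong refl step_repr[OF R]) simp
  also have "\<dots> = (\<Sum>r\<in>R - {T}. g r * (\<integral>u. indicator {r..<hi R r} u \<partial>\<mu>))"
    by (subst Bochner_Integration.integral_sum)
       (auto intro!: bdd_meas_integrable[OF finite_\<mu>] bdd_meas_mult bdd_meas_const bdd_cell_indicator)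
  also have "\<dots> = (\<Sum>r\<in>R - {T}. (hi R r - r) * g r)"
  proof (intro sum.cong refl)
    fix r assume r: "r \<in> R - {T}"
    have rc: "r \<in> {t..<T}" using partition_cell[OF R r] .
    have sub: "{r..<hi R r} \<subseteq> {t..<T}" using rc hi_bounds[OF R rc] by auto
    have "(\<integral>u. indicator {r..<hi R r} u \<partial>\<mu>) = measure \<mu> {r..<hi R r}"
      by (subst Bochner_Integration.integral_indicator) (simp only: space_\<mu> Int_absorb2[OF sub])
    also have "\<dots> = measure lborel {r..<hi R r}"
      unfolding \<mu>_def using sub by (intro measure_restrict_space) auto
    also have "\<dots> = hi R r - r" using less_hi[OF R rc] by simp
    finally show "g r * (\<integral>u. indicator {r..<hi R r} u \<partial>\<mu>) = (hi R r - r) * g r" by simp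
  qed
  finally show ?thesis by simp
qed

lemma bdd_lo3:
  fixes G :: "real \<Rightarrow> real \<Rightarrow> real \<Rightarrow> real"
  assumes R: "partition_of t T R"
  shows "bdd_meas N3 (\<lambda>p. G (lo R (fst (snd p))) (lo R (fst p)) (lo R (snd (snd p))))"
proof (rule bdd_meas_cong)
  let ?i = "\<lambda>r u. indicator {r..<hi R r} u :: real"
  show "(\<Sum>x\<in>R - {T}. (\<Sum>y\<in>R - {T}. (\<Sum>z\<in>R - {T}. G x y z * ?i z (snd (snd p))) * ?i y (fst p)) * ?i x (fst (snd p)))
     = G (lo R (fst (snd p))) (lo R (fst p)) (lo R (snd (snd p)))" if "p \<in> space N3" for p
  proof -
    have p: "fst p \<in> {t..<T}" "fst (snd p) \<in> {t..<T}" "snd (snd p) \<in> {t..<T}"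
      using that by (auto simp: space_N3)
    show ?thesis
      by (simp only: step_repr[OF R p(3), symmetric] step_repr[OF R p(1), of "\<lambda>y. G _ y (lo R (snd (snd p)))", symmetric]
          step_repr[OF R p(2), of "\<lambda>x. G x (lo R (fst p)) (lo R (snd (snd p)))", symmetric])
  qed
  show "bdd_meas N3 (\<lambda>p. \<Sum>x\<in>R - {T}. (\<Sum>y\<in>R - {T}. (\<Sum>z\<in>R - {T}. G x y z * ?i z (snd (snd p))) * ?i y (fst p)) * ?i x (fst (snd p)))"
    by (intro bdd_intros bdd_N3_proj bdd_cell_indicator)
qed

lemma sum3_integral:
  assumes R: "partition_of t T R"
  shows "(\<Sum>x\<in>R - {T}. \<Sum>y\<in>R - {T}. \<Sum>z\<in>R - {T}. (hi R x - x) * (hi R y - y) * (hi R z - z) * G x y z)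
    = (\<integral>p. G (lo R (fst (snd p))) (lo R (fst p)) (lo R (snd (snd p))) \<partial>N3)"
proof -
  let ?X = "R - {T}" let ?\<delta> = "\<lambda>x. hi R x - x"
  have "(\<integral>p. G (lo R (fst (snd p))) (lo R (fst p)) (lo R (snd (snd p))) \<partial>N3)
    = (\<integral>y. \<integral>x. \<integral>z. G (lo R x) (lo R y) (lo R z) \<partial>\<mu> \<partial>\<mu> \<partial>\<mu>)"
    unfolding integral_N3[OF bdd_lo3[OF R]] by simp
  also have "\<dots> = (\<Sum>y\<in>?X. ?\<delta> y * (\<Sum>x\<in>?X. ?\<delta> x * (\<Sum>z\<in>?X. ?\<delta> z * G x y z)))"
    by (simp only: sum_integral[OF R, of "\<lambda>z. G _ _ z", symmetric]
        sum_integral[OF R, of "\<lambda>x. \<Sum>z\<in>?X. ?\<delta> z * G x _ z", symmetric]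
        sum_integral[OF R, of "\<lambda>y. \<Sum>x\<in>?X. ?\<delta> x * (\<Sum>z\<in>?X. ?\<delta> z * G x y z)", symmetric])
  also have "\<dots> = (\<Sum>y\<in>?X. \<Sum>x\<in>?X. \<Sum>z\<in>?X. ?\<delta> x * ?\<delta> y * ?\<delta> z * G x y z)"
    unfolding sum_distrib_left by (intro sum.cong refl) (simp add: mult_ac)
  also have "\<dots> = (\<Sum>x\<in>?X. \<Sum>y\<in>?X. \<Sum>z\<in>?X. ?\<delta> x * ?\<delta> y * ?\<delta> z * G x y z)" by (rule sum.swap)
  finally show ?thesis by simp
qed

lemma sum3_limit:
  assumes lim: "\<And>x y z. x \<in> {t..<T} \<Longrightarrow> y \<in> {t..<T} \<Longrightarrow> z \<in> {t..<T} \<Longrightarrow>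
      (\<lambda>n. G (lo (U n) x) (lo (U n) y) (lo (U n) z)) \<longlonglongrightarrow> G x y z"
    and B: "\<And>x y z. x \<in> {t..<T} \<Longrightarrow> y \<in> {t..<T} \<Longrightarrow> z \<in> {t..<T} \<Longrightarrow> \<bar>G x y z\<bar> \<le> B"
  shows "(\<lambda>n. \<Sum>x\<in>U n - {T}. \<Sum>y\<in>U n - {T}. \<Sum>z\<in>U n - {T}.
      (hi (U n) x - x) * (hi (U n) y - y) * (hi (U n) z - z) * G x y z)
    \<longlonglongrightarrow> (\<integral>p. G (fst (snd p)) (fst p) (snd (snd p)) \<partial>N3)"
  unfolding sum3_integral[OF U]
proof (rule integral_dominated_convergence[where w = "\<lambda>_. B"])
  let ?f = "\<lambda>n p. G (lo (U n) (fst (snd p))) (lo (U n) (fst p)) (lo (U n) (snd (snd p)))"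
  have l: "(\<lambda>n. ?f n p) \<longlonglongrightarrow> G (fst (snd p)) (fst p) (snd (snd p))" if "p \<in> space N3" for p
    using that by (intro lim) (auto simp: space_N3)
  show m: "?f n \<in> borel_measurable N3" for n by (rule bdd_meas_measurable[OF bdd_lo3[OF U]])
  show "(\<lambda>p. G (fst (snd p)) (fst p) (snd (snd p))) \<in> borel_measurable N3"
    by (rule borel_measurable_LIMSEQ_real[OF l m])
  show "AE p in N3. (\<lambda>n. ?f n p) \<longlonglongrightarrow> G (fst (snd p)) (fst p) (snd (snd p))" by (intro AE_I2 l)
  show "AE p in N3. norm (?f n p) \<le> B" for n
    using lo_less_b(2)[OF U] by (intro AE_I2) (auto simp: space_N3 intro!: B)
  show "integrable N3 (\<lambda>_. B)" by (rule bdd_meas_integrable[OF finite_N3 bdd_meas_const])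
qed

text \<open>Dominated convergence twice, for the inner integral and for its square. Measurability of
  G in each variable is inherited from the step functions.\<close>

lemma sum2_limit:
  assumes lim: "\<And>x y. x \<in> {t..<T} \<Longrightarrow> y \<in> {t..<T} \<Longrightarrow> (\<lambda>n. G (lo (U n) x) (lo (U n) y)) \<longlonglongrightarrow> G x y"
    and B: "\<And>x y. x \<in> {t..<T} \<Longrightarrow> y \<in> {t..<T} \<Longrightarrow> \<bar>G x y\<bar> \<le> B"
  shows "(\<lambda>n. \<Sum>x\<in>U n - {T}. (hi (U n) x - x) * (\<Sum>y\<in>U n - {T}. (hi (U n) y - y) * G x y)\<^sup>2)
    \<longlonglongrightarrow> (\<integral>x. (\<integral>y. G x y \<partial>\<mu>)\<^sup>2 \<partial>\<mu>)"
  unfolding sum_integral[OF U, where g = "\<lambda>y. G _ y"] sum_integral[OF U, where g = "\<lambda>x. (\<integral>y. G x (lo (U _) y) \<partial>\<mu>)\<^sup>2"]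
proof (rule integral_dominated_convergence[where w = "\<lambda>_. (B * (T - t))\<^sup>2"])
  let ?f = "\<lambda>n x. (\<integral>y. G (lo (U n) x) (lo (U n) y) \<partial>\<mu>)\<^sup>2"
  have l: "(\<lambda>n. ?f n x) \<longlonglongrightarrow> (\<integral>y. G x y \<partial>\<mu>)\<^sup>2" if "x \<in> space \<mu>" for x
  proof (intro tendsto_power integral_dominated_convergence[where w = "\<lambda>_. B"])
    have l': "(\<lambda>n. G (lo (U n) x) (lo (U n) y)) \<longlonglongrightarrow> G x y" if "y \<in> space \<mu>" for y
      using that \<open>x \<in> space \<mu>\<close> by (intro lim) auto
    show m: "(\<lambda>y. G (lo (U n) x) (lo (U n) y)) \<in> borel_measurable \<mu>" for n
      by (rule bdd_meas_measurable[OF bdd_lo[OF U]])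
    show "(\<lambda>y. G x y) \<in> borel_measurable \<mu>" by (rule borel_measurable_LIMSEQ_real[OF l' m])
    show "AE y in \<mu>. (\<lambda>n. G (lo (U n) x) (lo (U n) y)) \<longlonglongrightarrow> G x y" by (intro AE_I2 l')
    show "AE y in \<mu>. norm (G (lo (U n) x) (lo (U n) y)) \<le> B" for n
      using lo_less_b(2)[OF U] that by (intro AE_I2) (auto intro!: B)
  qed simp
  show m: "?f n \<in> borel_measurable \<mu>" for n
    by (rule bdd_meas_measurable[OF bdd_lo[OF U, of "\<lambda>x. (\<integral>y. G x (lo (U n) y) \<partial>\<mu>)\<^sup>2"]])
  show "(\<lambda>x. (\<integral>y. G x y \<partial>\<mu>)\<^sup>2) \<in> borel_measurable \<mu>" by (rule borel_measurable_LIMSEQ_real[OF l m])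
  show "AE x in \<mu>. (\<lambda>n. ?f n x) \<longlonglongrightarrow> (\<integral>y. G x y \<partial>\<mu>)\<^sup>2" by (intro AE_I2 l)
  show "AE x in \<mu>. norm (?f n x) \<le> (B * (T - t))\<^sup>2" for n
  proof (intro AE_I2)
    fix x assume x: "x \<in> space \<mu>"
    have xl: "lo (U n) x \<in> {t..<T}" using lo_less_b(2)[OF U] x by auto
    have B0: "0 \<le> B" using B[OF xl xl] by linarith
    have "\<bar>\<integral>y. G (lo (U n) x) (lo (U n) y) \<partial>\<mu>\<bar> \<le> (\<integral>y. \<bar>G (lo (U n) x) (lo (U n) y)\<bar> \<partial>\<mu>)"
      using integral_norm_bound[of \<mu> "\<lambda>y. G (lo (U n) x) (lo (U n) y)"] by simp
    also have "\<dots> \<le> (\<integral>y. B \<partial>\<mu>)"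
      using lo_less_b(2)[OF U] xl
      by (intro integral_mono bdd_meas_integrable[OF finite_\<mu>] bdd_meas_const bdd_lo[OF U, of "\<lambda>y. \<bar>G (lo (U n) x) y\<bar>"])
         (auto intro!: B)
    also have "\<dots> = B * (T - t)" by (simp add: measure_\<mu> mult.commute del: space_\<mu>)
    finally show "norm (?f n x) \<le> (B * (T - t))\<^sup>2"
      using B0 tT by (simp add: power2_le_iff_abs_le)
  qed
qed simp

definition riemann_bound :: "nat \<Rightarrow> nat \<Rightarrow> nat \<Rightarrow> nat \<Rightarrow> real" where
  "riemann_bound p1 p2 p3 n =
      3 * (\<Sum>x\<in>U n - {T}. (hi (U n) x - x) * (\<Sum>y\<in>U n - {T}. (hi (U n) y - y) * Ap p1 p2 p3 x y y)\<^sup>2)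
      + 3 * (\<Sum>x\<in>U n - {T}. (hi (U n) x - x) * (\<Sum>y\<in>U n - {T}. (hi (U n) y - y) * Ap p1 p2 p3 y x y)\<^sup>2)
      + 3 * (\<Sum>x\<in>U n - {T}. (hi (U n) x - x) * (\<Sum>y\<in>U n - {T}. (hi (U n) y - y) * Ap p1 p2 p3 y y x)\<^sup>2)
      + 6 * (\<Sum>x\<in>U n - {T}. \<Sum>y\<in>U n - {T}. \<Sum>z\<in>U n - {T}.
           (hi (U n) x - x) * (hi (U n) y - y) * (hi (U n) z - z) * (Ap p1 p2 p3 x y z)\<^sup>2)"

lemma riemann_bound_limit: "riemann_bound p1 p2 p3 \<longlonglongrightarrow> det_bound p1 p2 p3"
proof -
  obtain B where B: "\<And>x y z. x \<in> {t..<T} \<Longrightarrow> y \<in> {t..<T} \<Longrightarrow> z \<in> {t..<T} \<Longrightarrow> \<bar>Ap p1 p2 p3 x y z\<bar> \<le> B"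
    using Ap_bounded by blast
  have Bsq: "\<bar>(Ap p1 p2 p3 x y z)\<^sup>2\<bar> \<le> B\<^sup>2" if "x \<in> {t..<T}" "y \<in> {t..<T}" "z \<in> {t..<T}" for x y z
    using power_mono[OF B[OF that], of 2] by simp
  show ?thesis
    unfolding riemann_bound_def det_bound_def
    by (intro tendsto_add tendsto_mult tendsto_const sum3_limit[where B = "B\<^sup>2"] sum2_limit[where B = B]
        tendsto_power Ap_tendsto B Bsq)
qed

end

section \<open>Convergence of the expansion\<close>

lemma sum_triple:
  "(\<Sum>a\<in>A. \<Sum>b\<in>B. \<Sum>c\<in>C. g a b c) = (\<Sum>q\<in>A \<times> B \<times> C. g (fst q) (fst (snd q)) (snd (snd q)) :: real)"
  by (simp add: sum.cartesian_product case_prod_beta)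

lemma sum_product3:
  fixes c :: real
  shows "c * (\<Sum>x\<in>X. f x) * (\<Sum>y\<in>Y. g y) * (\<Sum>z\<in>Z. h z) = (\<Sum>x\<in>X. \<Sum>y\<in>Y. \<Sum>z\<in>Z. c * f x * g y * h z)"
  by (simp only: sum_distrib_left[symmetric] sum_distrib_right[symmetric])

lemma sum_swap3:
  "(\<Sum>a\<in>A. \<Sum>b\<in>B. \<Sum>c\<in>C. \<Sum>x\<in>X. \<Sum>y\<in>Y. \<Sum>z\<in>Z. f a b c x y z)
    = (\<Sum>x\<in>X. \<Sum>y\<in>Y. \<Sum>z\<in>Z. \<Sum>a\<in>A. \<Sum>b\<in>B. \<Sum>c\<in>C. f a b c x y z :: real)"
proof -
  have "(\<Sum>a\<in>A. \<Sum>b\<in>B. \<Sum>c\<in>C. \<Sum>x\<in>X. \<Sum>y\<in>Y. \<Sum>z\<in>Z. f a b c x y z)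
    = (\<Sum>q\<in>A \<times> B \<times> C. \<Sum>x\<in>X. \<Sum>y\<in>Y. \<Sum>z\<in>Z. f (fst q) (fst (snd q)) (snd (snd q)) x y z)"
    by (rule sum_triple)
  also have "\<dots> = (\<Sum>x\<in>X. \<Sum>q\<in>A \<times> B \<times> C. \<Sum>y\<in>Y. \<Sum>z\<in>Z. f (fst q) (fst (snd q)) (snd (snd q)) x y z)"
    by (rule sum.swap)
  also have "\<dots> = (\<Sum>x\<in>X. \<Sum>y\<in>Y. \<Sum>q\<in>A \<times> B \<times> C. \<Sum>z\<in>Z. f (fst q) (fst (snd q)) (snd (snd q)) x y z)"
    by (rule sum.cong[OF refl], rule sum.swap)
  also have "\<dots> = (\<Sum>x\<in>X. \<Sum>y\<in>Y. \<Sum>z\<in>Z. \<Sum>q\<in>A \<times> B \<times> C. f (fst q) (fst (snd q)) (snd (snd q)) x y z)"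
    by (rule sum.cong[OF refl], rule sum.cong[OF refl], rule sum.swap)
  also have "\<dots> = (\<Sum>x\<in>X. \<Sum>y\<in>Y. \<Sum>z\<in>Z. \<Sum>a\<in>A. \<Sum>b\<in>B. \<Sum>c\<in>C. f a b c x y z)"
    by (rule sum.cong[OF refl], rule sum.cong[OF refl], rule sum.cong[OF refl], rule sum_triple[symmetric])
  finally show ?thesis .
qed

context wiener
begin

text \<open>The variables Z are a parameter because the same expression is used with the Ito
  integrals and with their discretisations.\<close>

definition partial_sum :: "real \<Rightarrow> nat \<Rightarrow> nat \<Rightarrow> nat \<Rightarrow> nat \<times> nat \<times> nat \<Rightarrow> (nat \<Rightarrow> nat \<Rightarrow> 'a \<Rightarrow> real) \<Rightarrow> 'a \<Rightarrow> real" where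
  "partial_sum t i1 i2 i3 p Z \<omega> = (case p of (p1, p2, p3) \<Rightarrow> \<Sum>j1\<le>p1. \<Sum>j2\<le>p2. \<Sum>j3\<le>p3.
     coeffC t T j3 j2 j1 * Z i1 j1 \<omega> * Z i2 j2 \<omega> * Z i3 j3 \<omega>)"

lemma partial_sum_ito_sum:
  assumes "t < T"
  shows "partial_sum t i1 i2 i3 (p1, p2, p3) (\<lambda>i j. ito_sum (legendre_phi t T j) i T R) \<omega> =
    (\<Sum>x\<in>R - {T}. \<Sum>y\<in>R - {T}. \<Sum>z\<in>R - {T}. interval.Kp t T p1 p2 p3 x y z * dW i1 R x \<omega> * dW i2 R y \<omega> * dW i3 R z \<omega>)"
proof -
  interpret interval t T by unfold_locales fact
  let ?X = "R - {T}"
  have "partial_sum t i1 i2 i3 (p1, p2, p3) (\<lambda>i j. ito_sum (\<phi> j) i T R) \<omega> =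
    (\<Sum>j1\<le>p1. \<Sum>j2\<le>p2. \<Sum>j3\<le>p3. \<Sum>x\<in>?X. \<Sum>y\<in>?X. \<Sum>z\<in>?X. coeffC t T j3 j2 j1 * (\<phi> j1 x * dW i1 R x \<omega>) * (\<phi> j2 y * dW i2 R y \<omega>) * (\<phi> j3 z * dW i3 R z \<omega>))"
    unfolding partial_sum_def ito_sum_def prod.case
    by (intro sum.cong refl sum_product3)
  also have "\<dots> = (\<Sum>x\<in>?X. \<Sum>y\<in>?X. \<Sum>z\<in>?X. \<Sum>j1\<le>p1. \<Sum>j2\<le>p2. \<Sum>j3\<le>p3. coeffC t T j3 j2 j1 * (\<phi> j1 x * dW i1 R x \<omega>) * (\<phi> j2 y * dW i2 R y \<omega>) * (\<phi> j3 z * dW i3 R z \<omega>))"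
    by (rule sum_swap3)
  also have "\<dots> = (\<Sum>x\<in>?X. \<Sum>y\<in>?X. \<Sum>z\<in>?X. Kp p1 p2 p3 x y z * dW i1 R x \<omega> * dW i2 R y \<omega> * dW i3 R z \<omega>)"
    unfolding Kp_def sum_distrib_right by (intro sum.cong refl) (simp add: mult_ac)
  finally show ?thesis .
qed

text \<open>On uniform partitions the discretised difference is a cubic form with kernel
  \<open>Ap\<close>, bounded by \<open>riemann_bound\<close>. The three discretised integrals and
  the Stratonovich sum converge almost everywhere along one subsequence, so their polynomial does
  too, and Fatou gives the bound for the limit.\<close>

lemma approx_bound:
  fixes p1 p2 p3 :: nat
  assumes t: "0 \<le> t" "t < T" and i: "i1 \<in> {1..m}" "i2 \<in> {1..m}" "i3 \<in> {1..m}"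
  defines "D \<equiv> \<lambda>\<omega>. partial_sum t i1 i2 i3 (p1, p2, p3) (\<lambda>i j. ito_integral M (legendre_phi t T j) (W i) t T) \<omega>
     - strat_iter3 M (W i1) (W i2) (W i3) t T \<omega>"
  shows "integrable M (\<lambda>\<omega>. (D \<omega>)\<^sup>2)" "expectation (\<lambda>\<omega>. (D \<omega>)\<^sup>2) \<le> interval.det_bound t T p1 p2 p3"
proof -
  interpret interval t T by unfold_locales fact
  let ?J = "strat_iter3 M (W i1) (W i2) (W i3) t T"
  let ?\<zeta> = "\<lambda>i j. ito_integral M (\<phi> j) (W i) t T"
  have tT': "t \<le> T" using t by simp
  \<comment> \<open>\<open>None\<close> stands for the iterated integral, \<open>Some (i, j)\<close>
    for the Fourier variable of component i and index j; one finite index set yields one subsequence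
    for everything.\<close>
  define I where "I = insert None (Some ` ({i1, i2, i3} \<times> {..max p1 (max p2 p3)}))"
  define X where "X n k = (case k of None \<Rightarrow> strat_sum3 i1 i2 i3 t T (U n) (U n) | Some (i, j) \<Rightarrow> ito_sum (\<phi> j) i T (U n))" for n k
  define Y where "Y k = (case k of None \<Rightarrow> ?J | Some (i, j) \<Rightarrow> ?\<zeta> i j)" for k
  note Jlim = strat_iter3_net_limit[OF t(1) tT' order.refl i]
  have \<zeta>lim: "net_limit M t T (ito_sum (\<phi> j) k T) (?\<zeta> k j)" if "k \<in> {1..m}" for k j
    by (rule ito_net_limit[OF t order.refl that continuous_phi])
  have int: "integrable M (\<lambda>\<omega>. (X n k \<omega> - Y k \<omega>)\<^sup>2)" if kI: "k \<in> I" for n k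
  proof (cases k)
    case None then show ?thesis
      using net_limit_integrable[OF tT' Jlim all_moments_strat_sum3[OF _ _ order.refl t(1) order.refl i] U]
      by (simp add: X_def Y_def)
  next
    case (Some a)
    then obtain l j where l: "k = Some (l, j)" "l \<in> {1..m}" using kI i by (auto simp: I_def)
    then show ?thesis
      using net_limit_integrable[OF tT' \<zeta>lim all_moments_ito_sum[OF _ t(1) order.refl l(2)] U]
      by (simp add: X_def Y_def)
  qed
  have lim: "(\<lambda>n. expectation (\<lambda>\<omega>. (X n k \<omega> - Y k \<omega>)\<^sup>2)) \<longlonglongrightarrow> 0" if kI: "k \<in> I" for k
  proof (cases k)
    case None then show ?thesis
      using net_limit_uniform(2)[OF Jlim tT'] by (simp add: X_def Y_def)
  next
    case (Some a)
    then obtain l j where l: "k = Some (l, j)" "l \<in> {1..m}" using kI i by (auto simp: I_def)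
    then show ?thesis
      using net_limit_uniform(2)[OF \<zeta>lim tT', of l j] by (simp add: X_def Y_def)
  qed
  have "finite I" by (simp add: I_def)
  then obtain r :: "nat \<Rightarrow> nat" where r: "strict_mono r" and AE: "AE \<omega> in M. \<forall>k\<in>I. (\<lambda>n. X (r n) k \<omega>) \<longlonglongrightarrow> Y k \<omega>"
    by (rule L2_AE_subseq[OF _ int lim])
  define Dn where "Dn n \<omega> = partial_sum t i1 i2 i3 (p1, p2, p3) (\<lambda>i j. ito_sum (\<phi> j) i T (U n)) \<omega>
     - strat_sum3 i1 i2 i3 t T (U n) (U n) \<omega>" for n \<omega>
  have AE_D: "AE \<omega> in M. (\<lambda>n. Dn (r n) \<omega>) \<longlonglongrightarrow> D \<omega>"
    using AE
  proof eventually_elim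
    fix \<omega> assume *: "\<forall>k\<in>I. (\<lambda>n. X (r n) k \<omega>) \<longlonglongrightarrow> Y k \<omega>"
    have "(\<lambda>n. strat_sum3 i1 i2 i3 t T (U (r n)) (U (r n)) \<omega>) \<longlonglongrightarrow> ?J \<omega>"
      using *[rule_format, of None] by (simp add: I_def X_def Y_def)
    moreover have "(\<lambda>n. ito_sum (\<phi> j) l T (U (r n)) \<omega>) \<longlonglongrightarrow> ?\<zeta> l j \<omega>"
      if "l \<in> {i1, i2, i3}" "j \<le> max p1 (max p2 p3)" for l j
      using *[rule_format, of "Some (l, j)"] that by (simp add: I_def X_def Y_def image_iff)
    ultimately show "(\<lambda>n. Dn (r n) \<omega>) \<longlonglongrightarrow> D \<omega>"
      unfolding Dn_def D_def partial_sum_def prod.case by (intro tendsto_intros) auto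
  qed
  have mom: "all_moments M (Dn n)" for n
    unfolding Dn_def[abs_def] partial_sum_def prod.case
    by (intro all_moments_diff moments_intros all_moments_ito_sum[OF U] all_moments_strat_sum3[OF U U order.refl] i t order.refl)
  have D_meas: "D \<in> borel_measurable M"
  proof -
    have "?J \<in> borel_measurable M" "k \<in> {1..m} \<Longrightarrow> ?\<zeta> k j \<in> borel_measurable M" for k j
      using Jlim \<zeta>lim[of k j] by (auto simp: net_limit_def)
    then show ?thesis unfolding D_def partial_sum_def prod.case
      using i by (intro borel_measurable_diff borel_measurable_sum borel_measurable_times borel_measurable_const) auto
  qed
  have le: "expectation (\<lambda>\<omega>. (Dn n \<omega>)\<^sup>2) \<le> riemann_bound p1 p2 p3 n" for n
  proof -
    have "Dn n \<omega> = (\<Sum>x\<in>U n - {T}. \<Sum>y\<in>U n - {T}. \<Sum>z\<in>U n - {T}. Ap p1 p2 p3 x y z * dW i1 (U n) x \<omega> * dW i2 (U n) y \<omega> * dW i3 (U n) z \<omega>)" for \<omega>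
      unfolding Dn_def partial_sum_ito_sum[OF t(2)] strat_sum3_diag[OF U] sum_subtractf[symmetric] Ap_def
      by (intro sum.cong refl) (simp add: left_diff_distrib)
    then show ?thesis
      unfolding riemann_bound_def using cubic_form_moment[OF U[of n] t(1) order.refl i, where A = "Ap p1 p2 p3"] by simp
  qed
  have lim_c: "(\<lambda>n. riemann_bound p1 p2 p3 (r n)) \<longlonglongrightarrow> det_bound p1 p2 p3"
    using LIMSEQ_subseq_LIMSEQ[OF riemann_bound_limit r] by (simp add: comp_def)
  show "integrable M (\<lambda>\<omega>. (D \<omega>)\<^sup>2)" "expectation (\<lambda>\<omega>. (D \<omega>)\<^sup>2) \<le> det_bound p1 p2 p3"
    using Fatou_square[OF all_moments_measurable[OF mom] D_meas AE_D all_moments_square_integrable[OF mom] le lim_c] .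
qed

end

theorem theorem2:
  fixes M :: "'a measure" and F :: "real \<Rightarrow> 'a measure"
    and W :: "nat \<Rightarrow> real \<Rightarrow> 'a \<Rightarrow> real"
    and m :: nat and t T :: real and i1 i2 i3 :: nat
  assumes "filtered_complete_prob_space M F T"
    and "wiener_process M F m T W"
    and "0 \<le> t" and "t < T"
    and "i1 \<in> {1..m}" and "i2 \<in> {1..m}" and "i3 \<in> {1..m}"
  shows "l2_tendsto M
           (\<lambda>(p1, p2, p3) \<omega>. \<Sum>j1\<le>p1. \<Sum>j2\<le>p2. \<Sum>j3\<le>p3.
              coeffC t T j3 j2 j1
              * ito_integral M (legendre_phi t T j1) (W i1) t T \<omega>
              * ito_integral M (legendre_phi t T j2) (W i2) t T \<omega>
              * ito_integral M (legendre_phi t T j3) (W i3) t T \<omega>)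
           (strat_iter3 M (W i1) (W i2) (W i3) t T)
           (sequentially \<times>\<^sub>F sequentially \<times>\<^sub>F sequentially)"
proof -
  have "prob_space M" using assms(1) by (simp add: filtered_complete_prob_space_def)
  then interpret wiener M F m T W using assms(1,2) by (intro wiener.intro wiener_axioms.intro)
  interpret interval t T by unfold_locales fact
  let ?X = "\<lambda>(p1, p2, p3) \<omega>. \<Sum>j1\<le>p1. \<Sum>j2\<le>p2. \<Sum>j3\<le>p3.
              coeffC t T j3 j2 j1
              * ito_integral M (legendre_phi t T j1) (W i1) t T \<omega>
              * ito_integral M (legendre_phi t T j2) (W i2) t T \<omega>
              * ito_integral M (legendre_phi t T j3) (W i3) t T \<omega>"
  let ?J = "strat_iter3 M (W i1) (W i2) (W i3) t T"
  have meas: "?J \<in> borel_measurable M"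
    using strat_iter3_net_limit[OF assms(3) less_imp_le[OF assms(4)] order.refl assms(5,6,7)] by (simp add: net_limit_def)
  \<comment> \<open>Valid for every triple of truncation indices, so the product filter concerns
    only the deterministic bound.\<close>
  have bound: "integrable M (\<lambda>\<omega>. (?X p \<omega> - ?J \<omega>)\<^sup>2)"
    "expectation (\<lambda>\<omega>. (?X p \<omega> - ?J \<omega>)\<^sup>2) \<le> (case p of (p1, p2, p3) \<Rightarrow> det_bound p1 p2 p3)" for p
    using approx_bound[OF assms(3-7), of "fst p" "fst (snd p)" "snd (snd p)"]
    by (simp_all add: partial_sum_def case_prod_beta)
  show ?thesis
    unfolding l2_tendsto_def
  proof (intro conjI meas always_eventually allI bound)
    show "((\<lambda>p. expectation (\<lambda>\<omega>. (?X p \<omega> - ?J \<omega>)\<^sup>2)) \<longlongrightarrow> 0) (sequentially \<times>\<^sub>F sequentially \<times>\<^sub>F sequentially)"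
      by (rule tendsto_sandwich[OF _ _ tendsto_const det_bound_tendsto_0])
         (intro always_eventually allI, simp, intro always_eventually allI bound(2))
  qed
qed

end
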